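(* Let $\mathcal H$ be a graded connected Hopf algebra over $\mathbb R$, and $\tilde\tau:\mathcal H\to\mathcal H$ a linear graded involution that is an algebra antimorphism and a coalgebra morphism or antimorphism. Define, for $a\ge1$, $\tilde\tau^{+}_a=m\circ(\mathrm{id}\otimes\tilde\tau\otimes\mathrm{id}\otimes\tilde\tau\otimes\cdots)\circ\Delta^{[a]}$ and $\tilde\tau^{-}_a=m\circ(\tilde\tau\otimes\mathrm{id}\otimes\tilde\tau\otimes\mathrm{id}\otimes\cdots)\circ\Delta^{[a]}$ (each with $a$ alternating tensor factors, starting with $\mathrm{id}$, resp. $\tilde\tau$). (i) Let $p_1,\dots,p_k\in(\mathrm{Prim}\,\mathcal H)^{\tilde\tau}$ and $\bar p_1,\dots,\bar p_{\bar k}\in(\mathrm{Prim}\,\mathcal H)^{-\tilde\tau}$ ($k,\bar k\ge0$), and write $S=\sum_{\sigma\in\mathfrak S_k}p_{\sigma(1)}\cdots p_{\sigma(k)}$. (a) If $a$ is even, then $S\,\bar p_1\cdots\bar p_{\bar k}$ is an eigenvector of $\tilde\tau^+_a$ and $\bar p_1\cdots\bar p_{\bar k}\,S$ is an eigenvector of $\tilde\tau^-_a$, in both cases with eigenvalue $a^k$ if $\bar k=0$ and $0$ if $\bar k>0$. (b) If $a$ is odd, then $\bar p_1\cdots\bar p_{\bar k}\,S$ and $S\,\bar p_1\cdots\bar p_{\bar k}$ are eigenvectors of $\tilde\tau^+_a$ with eigenvalue $a^k$. (c) If $a$ is odd, then $\bar p_1\cdots\bar p_{\bar k}\,S+S\,\bar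 p_1\cdots\bar p_{\bar k}$ is an eigenvector of $\tilde\tau^-_a$ with eigenvalue $(-1)^{\bar k}a^k$. (ii) Let $\mathcal P$, $\bar{\mathcal P}$ be bases of $(\mathrm{Prim}\,\mathcal H)^{\tilde\tau}$, $(\mathrm{Prim}\,\mathcal H)^{-\tilde\tau}$ respectively, each totally ordered by $\preceq$. For any one fixed one of the five expressions in (i) (namely $S\bar p_1\cdots\bar p_{\bar k}$, $\bar p_1\cdots\bar p_{\bar k}S$, or $\bar p_1\cdots\bar p_{\bar k}S+S\bar p_1\cdots\bar p_{\bar k}$), the vectors obtained over all $k,\bar k\ge0$ and all choices $p_1\preceq\cdots\preceq p_k$ in $\mathcal P$ and $\bar p_1\preceq\cdots\preceq\bar p_{\bar k}$ in $\bar{\mathcal P}$ are linearly independent. (iii) If moreover $\mathcal H$ is cocommutative, each such set in (ii) is a basis of $\mathcal H$ consisting of eigenvectors of the corresponding operator from (i).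
   Context: Graded connected Hopf algebra over $\mathbb R$: $\mathcal H=\bigoplus_n\mathcal H_n$, $\mathcal H_0=\mathbb R\cdot1$, product $m$ (iterated products also denoted $m$), coproduct $\Delta$; $\Delta^{[2]}=\Delta$, $\Delta^{[l]}=(\Delta^{[l-1]}\otimes\mathrm{id})\circ\Delta$. $\mathrm{Prim}\,\mathcal H=\{x:\Delta(x)=1\otimes x+x\otimes 1\}$. Algebra antimorphism: $f(wz)=f(z)f(w)$; coalgebra morphism: $\Delta\circ f=(f\otimes f)\circ\Delta$; coalgebra antimorphism: $\Delta\circ f=(f\otimes f)\circ\mathrm{swap}\circ\Delta$. For a linear map $\tau$ on a space $V$, $V^{\tau}$ and $V^{-\tau}$ are its eigenspaces for eigenvalues $1$ and $-1$. $\mathcal H$ is cocommutative if $\Delta(x)$ is invariant under swapping tensor factors. $\mathfrak S_k$ is the symmetric group.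
   Formalization: (i)(c) is false as printed (T(V), antipode, a=1: 2xy maps to 2yx); there and in (iii) the eigenvector is p̄_1⋯p̄_k̄ S + S p̄_k̄⋯p̄_1, and the printed sum is claimed an eigenvector only if p̄_1⋯p̄_k̄ = p̄_k̄⋯p̄_1. In (i), vectors are claimed nonzero only if all p_i, p̄_j are nonzero. *)

theory Defs
  imports
    Complex_Main
    "HOL-Library.Poly_Mapping"
    "HOL-Combinatorics.Permutations"
begin

section \<open>Tensor powers of a real vector space\<close>

instantiation poly_mapping :: (type, real_vector) real_vector
begin

lift_definition scaleR_poly_mapping :: "real \<Rightarrow> ('a \<Rightarrow>\<^sub>0 'b) \<Rightarrow> ('a \<Rightarrow>\<^sub>0 'b)"
  is "\<lambda>c f k. c *\<^sub>R f k"
  by (erule finite_subset[rotated]) auto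

instance
  by standard (transfer; simp add: fun_eq_iff algebra_simps)+

end

lemma lookup_scaleR [simp]:
  "Poly_Mapping.lookup (c *\<^sub>R f) k = c *\<^sub>R Poly_Mapping.lookup f k"
  by transfer simp

definition multilinear :: "('a::real_vector list \<Rightarrow> 'b::real_vector) \<Rightarrow> bool" where
  "multilinear \<phi> \<longleftrightarrow> (\<forall>xs ys. linear (\<lambda>x. \<phi> (xs @ x # ys)))"

text \<open>
  All tensor powers live in the one type \<open>'a tensor\<close>, the underlying space of the tensor algebra
  (the direct sum of all tensor powers): the real vector space freely generated by the finite lists
  \<open>[x\<^sub>1, \<dots>, x\<^sub>n]\<close>, modulo linearity in every list entry.  The \<open>n\<close>-th tensor power is the subspace
  \<open>tensor_power n\<close> spanned by the classes \<open>tens [x\<^sub>1, \<dots>, x\<^sub>n]\<close>, which stand for the pure tensors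
  \<open>x\<^sub>1 \<otimes> \<dots> \<otimes> x\<^sub>n\<close>.
\<close>

definition tensor_relations :: "('a::real_vector list \<Rightarrow>\<^sub>0 real) set" where
  "tensor_relations =
     {Poly_Mapping.single (xs @ (x + y) # ys) 1
        - Poly_Mapping.single (xs @ x # ys) 1 - Poly_Mapping.single (xs @ y # ys) 1 | xs x y ys. True}
   \<union> {Poly_Mapping.single (xs @ (c *\<^sub>R x) # ys) 1
        - c *\<^sub>R Poly_Mapping.single (xs @ x # ys) 1 | xs c x ys. True}"

quotient_type (overloaded) 'a tensor =
  "'a::real_vector list \<Rightarrow>\<^sub>0 real" / "\<lambda>f g. f - g \<in> span tensor_relations"
proof (rule equivpI)
  show "reflp (\<lambda>f g::'a list \<Rightarrow>\<^sub>0 real. f - g \<in> span tensor_relations)"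
    by (auto intro!: reflpI span_zero)
  show "symp (\<lambda>f g::'a list \<Rightarrow>\<^sub>0 real. f - g \<in> span tensor_relations)"
  proof (rule sympI)
    fix f g :: "'a list \<Rightarrow>\<^sub>0 real"
    assume "f - g \<in> span tensor_relations"
    then have "- (f - g) \<in> span tensor_relations" by (rule span_neg)
    then show "g - f \<in> span tensor_relations" by simp
  qed
  show "transp (\<lambda>f g::'a list \<Rightarrow>\<^sub>0 real. f - g \<in> span tensor_relations)"
  proof (rule transpI)
    fix f g h :: "'a list \<Rightarrow>\<^sub>0 real"
    assume "f - g \<in> span tensor_relations" "g - h \<in> span tensor_relations"
    then have "(f - g) + (g - h) \<in> span tensor_relations" by (rule span_add)
    then show "f - h \<in> span tensor_relations" by simp
  qed
qed

instantiation tensor :: (real_vector) real_vector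
begin

lift_definition zero_tensor :: "'a tensor" is 0 .

lift_definition plus_tensor :: "'a tensor \<Rightarrow> 'a tensor \<Rightarrow> 'a tensor" is "(+)"
  by (drule (1) span_add) (simp add: algebra_simps)

lift_definition uminus_tensor :: "'a tensor \<Rightarrow> 'a tensor" is uminus
  by (drule span_neg) (simp add: algebra_simps)

lift_definition minus_tensor :: "'a tensor \<Rightarrow> 'a tensor \<Rightarrow> 'a tensor" is "(-)"
  by (drule (1) span_diff) (simp add: algebra_simps)

lift_definition scaleR_tensor :: "real \<Rightarrow> 'a tensor \<Rightarrow> 'a tensor" is "scaleR"
  by (simp add: scaleR_diff_right[symmetric] span_scale)

instance
  by standard (transfer; simp add: algebra_simps span_zero)+

end

lift_definition tens :: "'a::real_vector list \<Rightarrow> 'a tensor"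
  is "\<lambda>xs. Poly_Mapping.single xs 1" .

definition tensor_power :: "nat \<Rightarrow> 'a::real_vector tensor set" where
  "tensor_power n = span {tens xs | xs. length xs = n}"

text \<open>
  \<open>tlift \<phi>\<close> is the linear map sending \<open>tens xs\<close> to \<open>\<phi> xs\<close>.  It is meant for multilinear \<open>\<phi>\<close> only, for
  which the choice of representative does not matter.
\<close>

definition free_lift :: "('a list \<Rightarrow> 'b::real_vector) \<Rightarrow> ('a list \<Rightarrow>\<^sub>0 real) \<Rightarrow> 'b" where
  "free_lift \<phi> f = (\<Sum>xs\<in>Poly_Mapping.keys f. Poly_Mapping.lookup f xs *\<^sub>R \<phi> xs)"

definition tlift :: "('a::real_vector list \<Rightarrow> 'b::real_vector) \<Rightarrow> 'a tensor \<Rightarrow> 'b" where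
  "tlift \<phi> t = free_lift \<phi> (rep_tensor t)"

lemma free_lift_superset:
  assumes "finite A" "Poly_Mapping.keys f \<subseteq> A"
  shows "free_lift \<phi> f = (\<Sum>xs\<in>A. Poly_Mapping.lookup f xs *\<^sub>R \<phi> xs)"
  unfolding free_lift_def using assms
  by (intro sum.mono_neutral_left) (auto simp: in_keys_iff)

lemma linear_free_lift: "linear (free_lift \<phi>)"
proof (rule linearI)
  fix f g :: "'a list \<Rightarrow>\<^sub>0 real"
  let ?A = "Poly_Mapping.keys f \<union> Poly_Mapping.keys g"
  have "free_lift \<phi> (f + g) = (\<Sum>xs\<in>?A. Poly_Mapping.lookup (f + g) xs *\<^sub>R \<phi> xs)"
    using keys_add[of f g] by (intro free_lift_superset) auto
  also have "\<dots> = free_lift \<phi> f + free_lift \<phi> g"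
    by (simp add: lookup_add scaleR_left_distrib sum.distrib free_lift_superset[of ?A])
  finally show "free_lift \<phi> (f + g) = free_lift \<phi> f + free_lift \<phi> g" .
next
  fix c and f :: "'a list \<Rightarrow>\<^sub>0 real"
  have "free_lift \<phi> (c *\<^sub>R f) = (\<Sum>xs\<in>Poly_Mapping.keys f. Poly_Mapping.lookup (c *\<^sub>R f) xs *\<^sub>R \<phi> xs)"
    by (intro free_lift_superset) (auto simp: in_keys_iff)
  then show "free_lift \<phi> (c *\<^sub>R f) = c *\<^sub>R free_lift \<phi> f"
    by (simp add: free_lift_def scaleR_sum_right)
qed

lemma free_lift_single [simp]: "free_lift \<phi> (Poly_Mapping.single xs c) = c *\<^sub>R \<phi> xs"
  by (simp add: free_lift_def)

lemma free_lift_relations: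
  assumes "multilinear \<phi>" "f \<in> span tensor_relations"
  shows "free_lift \<phi> f = 0"
  using assms(2)
proof (rule linear_eq_0_on_span[OF linear_free_lift, rotated])
  fix r :: "'a list \<Rightarrow>\<^sub>0 real"
  assume "r \<in> tensor_relations"
  moreover have "\<phi> (xs @ (x + y) # ys) = \<phi> (xs @ x # ys) + \<phi> (xs @ y # ys)"
    and "\<phi> (xs @ (c *\<^sub>R x) # ys) = c *\<^sub>R \<phi> (xs @ x # ys)" for xs ys x y c
    using assms(1) linear_add[of "\<lambda>x. \<phi> (xs @ x # ys)" x y] linear_scale[of "\<lambda>x. \<phi> (xs @ x # ys)" c x]
    by (simp_all add: multilinear_def)
  ultimately show "free_lift \<phi> r = 0"
    by (auto simp: tensor_relations_def linear_diff[OF linear_free_lift]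
        linear_scale[OF linear_free_lift])
qed

lemma tlift_abs:
  assumes "multilinear \<phi>"
  shows "tlift \<phi> (abs_tensor f) = free_lift \<phi> f"
proof -
  have "rep_tensor (abs_tensor f) - f \<in> span tensor_relations"
    by (rule Quotient3_rep_abs[OF Quotient3_tensor]) (simp add: span_zero)
  then have "free_lift \<phi> (rep_tensor (abs_tensor f) - f) = 0"
    by (rule free_lift_relations[OF assms])
  then show ?thesis
    by (simp add: tlift_def linear_diff[OF linear_free_lift])
qed

lemma abs_tensor_exhaust: "\<exists>f. t = abs_tensor f"
  by (rule exI[of _ "rep_tensor t"]) (simp add: Quotient3_abs_rep[OF Quotient3_tensor])

lemma linear_tlift:
  assumes "multilinear \<phi>"
  shows "linear (tlift \<phi>)"
proof (rule linearI)
  fix s t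
  show "tlift \<phi> (s + t) = tlift \<phi> s + tlift \<phi> t"
    using abs_tensor_exhaust[of s] abs_tensor_exhaust[of t]
    by (auto simp: plus_tensor.abs_eq tlift_abs[OF assms] linear_add[OF linear_free_lift])
next
  fix c t
  show "tlift \<phi> (c *\<^sub>R t) = c *\<^sub>R tlift \<phi> t"
    using abs_tensor_exhaust[of t]
    by (auto simp: scaleR_tensor.abs_eq tlift_abs[OF assms] linear_scale[OF linear_free_lift])
qed

lemma tlift_tens:
  assumes "multilinear \<phi>"
  shows "tlift \<phi> (tens xs) = \<phi> xs"
  by (simp add: tens.abs_eq tlift_abs[OF assms])

lemma multilinear_tens: "multilinear tens"
  unfolding multilinear_def
proof (intro allI linearI)
  fix xs ys :: "'a list" and x y :: 'a
  have "Poly_Mapping.single (xs @ (x + y) # ys) 1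
      - Poly_Mapping.single (xs @ x # ys) 1 - Poly_Mapping.single (xs @ y # ys) (1::real)
      \<in> span tensor_relations"
    unfolding tensor_relations_def by (rule span_base, rule UnI1) blast
  then show "tens (xs @ (x + y) # ys) = tens (xs @ x # ys) + tens (xs @ y # ys)"
    by (simp only: tens.abs_eq plus_tensor.abs_eq tensor.abs_eq_iff diff_diff_eq)
next
  fix xs ys :: "'a list" and x :: 'a and c
  have "Poly_Mapping.single (xs @ (c *\<^sub>R x) # ys) 1
      - c *\<^sub>R Poly_Mapping.single (xs @ x # ys) (1::real) \<in> span tensor_relations"
    unfolding tensor_relations_def by (rule span_base, rule UnI2) blast
  then show "tens (xs @ (c *\<^sub>R x) # ys) = c *\<^sub>R tens (xs @ x # ys)"
    by (simp only: tens.abs_eq scaleR_tensor.abs_eq tensor.abs_eq_iff)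
qed

definition tcat :: "'a::real_vector tensor \<Rightarrow> 'a tensor \<Rightarrow> 'a tensor"  (infixr \<open>\<otimes>\<close> 70) where
  "s \<otimes> t = tlift (\<lambda>xs. tlift (\<lambda>ys. tens (xs @ ys)) t) s"

text \<open>
  Maps out of a fixed tensor power are extended by \<open>0\<close> to the other ones: \<open>tlift2 b\<close> is the linear
  map on the second tensor power induced by the bilinear map \<open>b\<close>, and \<open>tmap [f\<^sub>1, \<dots>, f\<^sub>n]\<close> is
  \<open>f\<^sub>1 \<otimes> \<dots> \<otimes> f\<^sub>n\<close> on the \<open>n\<close>-th tensor power.
\<close>

definition tlift2 :: "('a::real_vector \<Rightarrow> 'a \<Rightarrow> 'b::real_vector) \<Rightarrow> 'a tensor \<Rightarrow> 'b" where
  "tlift2 b = tlift (\<lambda>xs. case xs of [x, y] \<Rightarrow> b x y | _ \<Rightarrow> 0)"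

definition tmap :: "('a::real_vector \<Rightarrow> 'a) list \<Rightarrow> 'a tensor \<Rightarrow> 'a tensor" where
  "tmap fs = tlift (\<lambda>xs. if length xs = length fs then tens (map2 (\<lambda>f x. f x) fs xs) else 0)"

definition tswap :: "'a::real_vector tensor \<Rightarrow> 'a tensor" where
  "tswap = tlift2 (\<lambda>x y. tens [y, x])"

lemma linear_tens_entry: "linear (\<lambda>x. tens (xs @ x # ys))"
  by (rule multilinear_tens[unfolded multilinear_def, rule_format])

lemma multilinear_append_left: "multilinear (\<lambda>ys. tens (xs @ ys))"
  unfolding multilinear_def
  using linear_tens_entry[of "xs @ us" vs for us vs] by simp

lemma multilinear_append_right: "multilinear (\<lambda>xs. tens (xs @ ys))"
  unfolding multilinear_def
  using linear_tens_entry[of us "vs @ ys" for us vs] by simp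

lemma tcat_tens: "tens xs \<otimes> tens ys = tens (xs @ ys)"
proof -
  have "tlift (\<lambda>ys. tens (xs @ ys)) (tens ys) = tens (xs @ ys)" for xs
    by (rule tlift_tens[OF multilinear_append_left])
  then show ?thesis
    by (simp add: tcat_def tlift_tens[OF multilinear_append_right])
qed

lemma multilinear_case2:
  assumes "\<And>y. linear (\<lambda>x. b x y)" "\<And>x. linear (b x)"
  shows "multilinear (\<lambda>xs. case xs of [x, y] \<Rightarrow> b x y | _ \<Rightarrow> 0)"
  unfolding multilinear_def
proof (intro allI)
  fix xs ys :: "'a list"
  have zero: "linear (\<lambda>x::'a. 0::'b)" by (rule linear_zero)
  show "linear (\<lambda>x. case xs @ x # ys of [x, y] \<Rightarrow> b x y | _ \<Rightarrow> 0)"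
  proof (cases xs)
    case Nil
    then show ?thesis using assms(1) zero by (cases ys; cases "tl ys"; simp)
  next
    case (Cons z zs)
    then show ?thesis using assms(2) zero by (cases zs; cases "tl zs"; cases ys; simp)
  qed
qed

lemma tlift2_tens:
  assumes "\<And>y. linear (\<lambda>x. b x y)" "\<And>x. linear (b x)"
  shows "tlift2 b (tens [x, y]) = b x y"
  by (simp add: tlift2_def tlift_tens[OF multilinear_case2[OF assms]])

lemma linear_tlift2:
  assumes "\<And>y. linear (\<lambda>x. b x y)" "\<And>x. linear (b x)"
  shows "linear (tlift2 b)"
  unfolding tlift2_def by (rule linear_tlift[OF multilinear_case2[OF assms]])

lemma multilinear_tmap:
  assumes "\<And>f. f \<in> set fs \<Longrightarrow> linear f"
  shows "multilinear (\<lambda>xs. if length xs = length fs then tens (map2 (\<lambda>f x. f x) fs xs) else 0)"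
  unfolding multilinear_def
proof (intro allI)
  fix xs ys :: "'a list"
  show "linear (\<lambda>x. if length (xs @ x # ys) = length fs
                    then tens (map2 (\<lambda>f x. f x) fs (xs @ x # ys)) else 0)"
  proof (cases "length xs + Suc (length ys) = length fs")
    case True
    define gs g hs where "gs = take (length xs) fs" and "g = fs ! length xs"
      and "hs = drop (Suc (length xs)) fs"
    have fs: "fs = gs @ g # hs" "length gs = length xs"
      using True by (auto simp: gs_def g_def hs_def id_take_nth_drop)
    have "linear g" using assms fs by simp
    moreover have "linear (\<lambda>x. tens (map2 (\<lambda>f x. f x) gs xs @ x # map2 (\<lambda>f x. f x) hs ys))"
      by (rule linear_tens_entry)
    ultimately have "linear (\<lambda>x. tens (map2 (\<lambda>f x. f x) gs xs @ g x # map2 (\<lambda>f x. f x) hs ys))"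
      using linear_compose[of g] by (simp add: o_def)
    then show ?thesis using True fs by simp
  next
    case False
    then show ?thesis by (simp add: linear_zero)
  qed
qed

lemma tmap_tens:
  assumes "\<And>f. f \<in> set fs \<Longrightarrow> linear f" "length xs = length fs"
  shows "tmap fs (tens xs) = tens (map2 (\<lambda>f x. f x) fs xs)"
  using tlift_tens[OF multilinear_tmap[OF assms(1)]] assms(2) by (simp add: tmap_def)

lemma linear_tens1: "linear (\<lambda>x. tens [x])"
  and linear_tens2_left: "linear (\<lambda>x. tens [x, y])"
  and linear_tens2_right: "linear (\<lambda>y. tens [x, y])"
  using linear_tens_entry[of "[]" "[]"] linear_tens_entry[of "[]" "[y]"] linear_tens_entry[of "[x]" "[]"]
  by simp_all

lemma tswap_tens: "tswap (tens [x, y]) = tens [y, x]"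
  unfolding tswap_def by (rule tlift2_tens) (rule linear_tens2_right linear_tens2_left)+

text \<open>The product of the algebra \<open>H \<otimes> H\<close>: \<open>(x \<otimes> y) (x' \<otimes> y') = x x' \<otimes> y y'\<close>.\<close>

definition tmult :: "'a::real_algebra_1 tensor \<Rightarrow> 'a tensor \<Rightarrow> 'a tensor" where
  "tmult s t = tlift2 (\<lambda>x y. tlift2 (\<lambda>x' y'. tens [x * x', y * y']) t) s"

text \<open>The iterated product \<open>x\<^sub>1 \<otimes> \<dots> \<otimes> x\<^sub>n \<mapsto> x\<^sub>1 \<cdots> x\<^sub>n\<close>.\<close>

definition tprod :: "'a::real_algebra_1 tensor \<Rightarrow> 'a" where
  "tprod = tlift prod_list"

lemma tmult_tens: "tmult (tens [x, y]) (tens [x', y']) = tens [x * x', y * y']"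
proof -
  have l: "linear (\<lambda>x. tens [f x, z])" and r: "linear (\<lambda>x. tens [z, f x])"
    if "linear f" for f :: "'a \<Rightarrow> 'a" and z
    using linear_compose[OF that linear_tens2_left] linear_compose[OF that linear_tens2_right]
    by (simp_all add: o_def)
  have mult: "linear ((*) u)" "linear (\<lambda>x. x * u)" for u :: 'a
    by (auto intro!: linearI simp: algebra_simps)
  have "tlift2 (\<lambda>x' y'. tens [x * x', y * y']) (tens [x', y']) = tens [x * x', y * y']" for x y
    by (rule tlift2_tens) (intro l r mult)+
  then have "tmult (tens [x, y]) (tens [x', y'])
      = tlift2 (\<lambda>x y. tens [x * x', y * y']) (tens [x, y])"
    by (simp add: tmult_def)
  also have "\<dots> = tens [x * x', y * y']"
    by (rule tlift2_tens) (intro l r mult)+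
  finally show ?thesis .
qed

lemma tprod_tens: "tprod (tens xs) = prod_list xs"
  unfolding tprod_def
  by (rule tlift_tens) (auto simp: multilinear_def algebra_simps intro!: linearI)


section \<open>Graded connected Hopf algebras\<close>

locale hopf_algebra =
  fixes \<Delta> :: "'a::real_algebra_1 \<Rightarrow> 'a tensor"
    and \<epsilon> :: "'a \<Rightarrow> real"
    and antipode :: "'a \<Rightarrow> 'a"
  assumes linear_coproduct: "linear \<Delta>"
    and coproduct_in: "\<Delta> x \<in> tensor_power 2"
    and linear_counit: "linear \<epsilon>"
    and coassoc: "tlift2 (\<lambda>y z. \<Delta> y \<otimes> tens [z]) (\<Delta> x) = tlift2 (\<lambda>y z. tens [y] \<otimes> \<Delta> z) (\<Delta> x)"
    and counit_left: "tlift2 (\<lambda>y z. \<epsilon> y *\<^sub>R z) (\<Delta> x) = x"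
    and counit_right: "tlift2 (\<lambda>y z. \<epsilon> z *\<^sub>R y) (\<Delta> x) = x"
    and coproduct_one: "\<Delta> 1 = tens [1, 1]"
    and coproduct_mult: "\<Delta> (x * y) = tmult (\<Delta> x) (\<Delta> y)"
    and counit_one: "\<epsilon> 1 = 1"
    and counit_mult: "\<epsilon> (x * y) = \<epsilon> x * \<epsilon> y"
    and linear_antipode: "linear antipode"
    and antipode_left: "tprod (tmap [antipode, id] (\<Delta> x)) = \<epsilon> x *\<^sub>R 1"
    and antipode_right: "tprod (tmap [id, antipode] (\<Delta> x)) = \<epsilon> x *\<^sub>R 1"

locale graded_connected_hopf_algebra = hopf_algebra \<Delta> \<epsilon> antipode
  for H :: "nat \<Rightarrow> 'a::real_algebra_1 set"
    and \<Delta> :: "'a \<Rightarrow> 'a tensor"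
    and \<epsilon> :: "'a \<Rightarrow> real"
    and antipode :: "'a \<Rightarrow> 'a" +
  assumes subspace_grading: "subspace (H n)"
    and direct_sum:
      "\<exists>!f. (\<forall>n. f n \<in> H n) \<and> finite {n. f n \<noteq> 0} \<and> x = (\<Sum>n | f n \<noteq> 0. f n)"
    and connected: "H 0 = span {1}"
    and mult_graded: "x \<in> H i \<Longrightarrow> y \<in> H j \<Longrightarrow> x * y \<in> H (i + j)"
    and coproduct_graded:
      "x \<in> H n \<Longrightarrow> \<Delta> x \<in> span {tens [y, z] | y z i j. i + j = n \<and> y \<in> H i \<and> z \<in> H j}"
    and counit_graded: "x \<in> H n \<Longrightarrow> n > 0 \<Longrightarrow> \<epsilon> x = 0"
    and antipode_graded: "x \<in> H n \<Longrightarrow> antipode x \<in> H n"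

definition cocommutative :: "('a::real_vector \<Rightarrow> 'a tensor) \<Rightarrow> bool" where
  "cocommutative \<Delta> \<longleftrightarrow> (\<forall>x. tswap (\<Delta> x) = \<Delta> x)"

definition primitives :: "('a::real_algebra_1 \<Rightarrow> 'a tensor) \<Rightarrow> 'a set" where
  "primitives \<Delta> = {x. \<Delta> x = tens [1, x] + tens [x, 1]}"

definition algebra_antimorphism :: "('a::real_algebra_1 \<Rightarrow> 'a) \<Rightarrow> bool" where
  "algebra_antimorphism f \<longleftrightarrow> (\<forall>w z. f (w * z) = f z * f w)"

definition coalgebra_morphism :: "('a::real_vector \<Rightarrow> 'a tensor) \<Rightarrow> ('a \<Rightarrow> 'a) \<Rightarrow> bool" where
  "coalgebra_morphism \<Delta> f \<longleftrightarrow> (\<forall>x. \<Delta> (f x) = tmap [f, f] (\<Delta> x))"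

definition coalgebra_antimorphism :: "('a::real_vector \<Rightarrow> 'a tensor) \<Rightarrow> ('a \<Rightarrow> 'a) \<Rightarrow> bool" where
  "coalgebra_antimorphism \<Delta> f \<longleftrightarrow> (\<forall>x. \<Delta> (f x) = tmap [f, f] (tswap (\<Delta> x)))"

text \<open>
  \<open>\<Delta>\<^sup>[\<^sup>l\<^sup>]\<close> for \<open>l \<ge> 1\<close>, with \<open>\<Delta>\<^sup>[\<^sup>1\<^sup>] = id\<close>; the value at \<open>l = 0\<close> is a dummy.
\<close>

fun iter_coproduct :: "('a::real_vector \<Rightarrow> 'a tensor) \<Rightarrow> nat \<Rightarrow> 'a \<Rightarrow> 'a tensor" where
  "iter_coproduct \<Delta> 0 x = 0"
| "iter_coproduct \<Delta> (Suc 0) x = tens [x]"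
| "iter_coproduct \<Delta> (Suc (Suc n)) x =
     tlift2 (\<lambda>y z. iter_coproduct \<Delta> (Suc n) y \<otimes> tens [z]) (\<Delta> x)"

lemma iter_coproduct_2:
  assumes "\<Delta> x \<in> tensor_power 2"
  shows "iter_coproduct \<Delta> 2 x = \<Delta> x"
proof -
  have "(\<lambda>y z. tens [y] \<otimes> tens [z]) = (\<lambda>y z::'a. tens [y, z])"
    by (simp add: tcat_tens)
  then have "iter_coproduct \<Delta> 2 x = tlift2 (\<lambda>y z. tens [y, z]) (\<Delta> x)"
    by (simp add: numeral_2_eq_2)
  also have "\<dots> = id (\<Delta> x)"
  proof (rule linear_eq_on_span[OF _ _ _ assms[unfolded tensor_power_def]])
    show "linear (tlift2 (\<lambda>y z::'a. tens [y, z]))"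
      by (rule linear_tlift2) (rule linear_tens2_left linear_tens2_right)+
    show "linear (id :: 'a tensor \<Rightarrow> 'a tensor)" by (rule linear_id)
    fix t :: "'a tensor"
    assume "t \<in> {tens xs |xs. length xs = 2}"
    then obtain y z where "t = tens [y, z]" by (auto simp: length_Suc_conv numeral_2_eq_2)
    then show "tlift2 (\<lambda>y z. tens [y, z]) t = id t"
      by (simp add: tlift2_tens linear_tens2_left linear_tens2_right)
  qed
  finally show ?thesis by simp
qed


section \<open>The operators and their eigenvectors\<close>

definition tau_plus :: "('a::real_algebra_1 \<Rightarrow> 'a tensor) \<Rightarrow> ('a \<Rightarrow> 'a) \<Rightarrow> nat \<Rightarrow> 'a \<Rightarrow> 'a" where
  "tau_plus \<Delta> \<tau> a x =
     tprod (tmap (map (\<lambda>i. if even i then id else \<tau>) [0..<a]) (iter_coproduct \<Delta> a x))"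

definition tau_minus :: "('a::real_algebra_1 \<Rightarrow> 'a tensor) \<Rightarrow> ('a \<Rightarrow> 'a) \<Rightarrow> nat \<Rightarrow> 'a \<Rightarrow> 'a" where
  "tau_minus \<Delta> \<tau> a x =
     tprod (tmap (map (\<lambda>i. if even i then \<tau> else id) [0..<a]) (iter_coproduct \<Delta> a x))"

definition eigenspace :: "'a::real_vector set \<Rightarrow> ('a \<Rightarrow> 'a) \<Rightarrow> real \<Rightarrow> 'a set" where
  "eigenspace V T c = {v \<in> V. T v = c *\<^sub>R v}"

definition eigenvector :: "('a::real_vector \<Rightarrow> 'a) \<Rightarrow> real \<Rightarrow> 'a \<Rightarrow> bool" where
  "eigenvector T c v \<longleftrightarrow> v \<noteq> 0 \<and> T v = c *\<^sub>R v"

definition is_basis :: "'a::real_vector set \<Rightarrow> 'a set \<Rightarrow> bool" where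
  "is_basis B V \<longleftrightarrow> independent B \<and> span B = V"

definition independent_family :: "('i \<Rightarrow> 'a::real_vector) \<Rightarrow> 'i set \<Rightarrow> bool" where
  "independent_family v I \<longleftrightarrow> inj_on v I \<and> independent (v ` I)"

definition sym_prod :: "'a::real_algebra_1 list \<Rightarrow> 'a" where
  "sym_prod ps = (\<Sum>\<sigma> | \<sigma> permutes {..<length ps}. prod_list (map (\<lambda>i. ps ! \<sigma> i) [0..<length ps]))"

text \<open>
  A pair \<open>(ps, qs)\<close> of lists stands for \<open>p\<^sub>1, \<dots>, p\<^sub>k\<close> (the \<open>\<tau>\<close>-invariant primitives) and for their
  negated counterparts \<open>q\<^sub>1, \<dots>, q\<^sub>l\<close>.  For odd \<open>a\<close>, \<open>tau_minus\<close>
  maps \<open>q\<^sub>1 \<cdots> q\<^sub>l S\<close> to a scalar multiple of \<open>S q\<^sub>l \<cdots> q\<^sub>1\<close>, and \<open>S q\<^sub>1 \<cdots> q\<^sub>l\<close> to the same multiple of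
  \<open>q\<^sub>l \<cdots> q\<^sub>1 S\<close>, because \<open>\<tau>\<close> is an antimorphism.  Hence \<open>vec_rev_sum\<close> always yields an eigenvector,
  whereas \<open>vec_sum\<close> does so if \<open>q\<^sub>1 \<cdots> q\<^sub>l\<close> equals its reversal, but not in general: for \<open>\<tau>\<close> the antipode of
  the tensor algebra on primitives \<open>x, y\<close> and \<open>a = 1\<close>, it sends \<open>2 x y\<close> to \<open>2 y x\<close>.  The two agree for
  \<open>l \<le> 1\<close>.
\<close>

fun vec_right :: "'a::real_algebra_1 list \<times> 'a list \<Rightarrow> 'a" where
  "vec_right (ps, qs) = sym_prod ps * prod_list qs"

fun vec_left :: "'a::real_algebra_1 list \<times> 'a list \<Rightarrow> 'a" where
  "vec_left (ps, qs) = prod_list qs * sym_prod ps"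

fun vec_sum :: "'a::real_algebra_1 list \<times> 'a list \<Rightarrow> 'a" where
  "vec_sum (ps, qs) = prod_list qs * sym_prod ps + sym_prod ps * prod_list qs"

fun vec_rev_sum :: "'a::real_algebra_1 list \<times> 'a list \<Rightarrow> 'a" where
  "vec_rev_sum (ps, qs) = prod_list qs * sym_prod ps + sym_prod ps * prod_list (rev qs)"

definition ordered_pairs ::
    "'a set \<Rightarrow> ('a \<times> 'a) set \<Rightarrow> 'a set \<Rightarrow> ('a \<times> 'a) set \<Rightarrow> ('a list \<times> 'a list) set" where
  "ordered_pairs P r Q s =
     {(ps, qs). set ps \<subseteq> P \<and> sorted_wrt (\<lambda>x y. (x, y) \<in> r) ps \<and>
                set qs \<subseteq> Q \<and> sorted_wrt (\<lambda>x y. (x, y) \<in> s) qs}"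

end

theory Submission
  imports Defs
begin

text \<open>
  On products of primitives every operator here is computed from the unshuffle formula for the
  coproduct.  By polarization the symmetrized product may be replaced by a power of one primitive
  \<open>p\<close>; with the group-like elements \<open>E = exp p\<close> and \<open>Q = exp q\<^sub>1 \<cdots> exp q\<^sub>l\<close>, the antimorphism sends
  \<open>E Q\<close> to \<open>Q\<^sup>-\<^sup>1 E\<close>, so alternating products collapse to powers of \<open>E\<close> with at most one factor \<open>Q\<^sup>\<plusminus>\<^sup>1\<close>.

  For independence, convolve \<open>n\<close> linear functionals that vanish at \<open>1\<close>: the result kills products of fewer
  than \<open>n\<close> primitives and evaluates a product of \<open>n\<close> primitives to a permanent.  Functionals dual to a
  basis separate leading terms, and a generic functional shows that no vector vanishes.

  In the cocommutative case the Hopf powers \<open>id\<^sup>*\<^sup>a\<close> are coalgebra maps, and \<open>id\<^sup>*\<^sup>a x\<close> is polynomial in \<open>a\<close>.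
  Its linear coefficient is therefore primitive, and it differs from a homogeneous \<open>x\<close> of positive degree
  by products of elements of lower degree, so primitives generate.  Since commutators of primitives are primitive,
  reordering the letters of a word only changes it by shorter words, and the vectors span.
\<close>

section \<open>Tensors\<close>

text \<open>The exponentials E and Q live only in a completion of the Hopf algebra, so the argument
  runs on their coefficients: a product of group-like elements becomes a sum over unshuffles of a
  word, scaled so that no factorials appear. Polarization makes this manageable, because every
  subword of p...p is a power of p, whereas symmetrized products of distinct letters would have to
  be unshuffled as well. Likewise the convolution logarithm of the identity, an infinite series, is
  replaced by a coefficient of a polynomial in natural numbers a; identities valid for all a become
  identities of coefficients. Independence and spanning are the two halves of a
  Poincare-Birkhoff-Witt statement and are proved directly. The obstacle in both is that a vector is
  a sum of many arrangements of the same letters, which must not cancel. Functionals with positive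
  values on the leading terms settle the first half; dividing by the number of arrangements settles
  the second.\<close>

definition bilin :: "('a::real_vector \<Rightarrow> 'b::real_vector \<Rightarrow> 'c::real_vector) \<Rightarrow> bool" where
  "bilin b \<longleftrightarrow> (\<forall>y. linear (\<lambda>x. b x y)) \<and> (\<forall>x. linear (b x))"

lemma bilinI: "(\<And>y. linear (\<lambda>x. b x y)) \<Longrightarrow> (\<And>x. linear (b x)) \<Longrightarrow> bilin b"
  by (simp add: bilin_def)

lemma bilinD1: "bilin b \<Longrightarrow> linear (\<lambda>x. b x y)"
  and bilinD2: "bilin b \<Longrightarrow> linear (b x)"
  by (simp_all add: bilin_def)

lemma linear_comp: "linear g \<Longrightarrow> linear f \<Longrightarrow> linear (\<lambda>x. g (f x))"
  using linear_compose[of f g] by (simp add: o_def)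

lemma linear_mult_left: "linear f \<Longrightarrow> linear (\<lambda>x. f x * (c::'b::real_algebra))"
  and linear_mult_right: "linear f \<Longrightarrow> linear (\<lambda>x. (c::'b::real_algebra) * f x)"
  by (auto intro!: linearI simp: linear_add linear_scale algebra_simps)

lemma linear_scaleR_left: "linear f \<Longrightarrow> linear (\<lambda>x. f x *\<^sub>R c)"
  and linear_scaleR_right: "linear g \<Longrightarrow> linear (\<lambda>x. r *\<^sub>R g x)"
  by (auto intro!: linearI simp: linear_add linear_scale algebra_simps)

lemma linear_tens_left: "linear f \<Longrightarrow> linear (\<lambda>x. tens [f x, y])"
  and linear_tens_right: "linear f \<Longrightarrow> linear (\<lambda>x. tens [y, f x])"
  by (rule linear_comp[OF linear_tens2_left] linear_comp[OF linear_tens2_right], assumption)+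

lemma linear_if: "linear f \<Longrightarrow> linear g \<Longrightarrow> linear (\<lambda>x. if b then f x else g x)"
  by (cases b) auto

lemmas linear_rules = linear_ident linear_id linear_mult_left linear_mult_right
  linear_scaleR_left linear_scaleR_right linear_tens_left linear_tens_right

text \<open>A lift is literally a finite linear combination of values, taken at one chosen
  representative. Membership in subspaces, linearity in a parameter and images under linear maps are
  read off that sum, here and in the lemmas on \<open>tlift2\<close> below.\<close>

lemma free_lift_in_subspace:
  assumes "subspace S" "\<And>xs. \<phi> xs \<in> S"
  shows "free_lift \<phi> f \<in> S"
  unfolding free_lift_def by (intro subspace_sum subspace_scale assms)

lemma tlift2_in_subspace:
  assumes "subspace S" "\<And>y z. b y z \<in> S"
  shows "tlift2 b t \<in> S"
  unfolding tlift2_def tlift_def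
  by (rule free_lift_in_subspace) (auto split: list.splits simp: assms subspace_0)

lemma linear_free_lift_param:
  assumes "\<And>xs. linear (\<lambda>t. \<phi> t xs)"
  shows "linear (\<lambda>t. free_lift (\<phi> t) f)"
  unfolding free_lift_def by (intro linear_compose_sum ballI linear_scaleR_right assms)

lemma linear_tlift2_param:
  assumes "\<And>y z. linear (\<lambda>t. b t y z)"
  shows "linear (\<lambda>t. tlift2 (b t) s)"
  unfolding tlift2_def tlift_def
proof (rule linear_free_lift_param)
  fix xs
  show "linear (\<lambda>t. case xs of [y, z] \<Rightarrow> b t y z | _ \<Rightarrow> 0)"
    by (cases xs; cases "tl xs"; cases "tl (tl xs)") (auto simp: assms linear_zero)
qed

lemma free_lift_image: "linear L \<Longrightarrow> L (free_lift \<phi> f) = free_lift (\<lambda>xs. L (\<phi> xs)) f"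
  by (simp add: free_lift_def linear_sum linear_scale)

lemma tlift2_image:
  assumes "linear L"
  shows "L (tlift2 b t) = tlift2 (\<lambda>y z. L (b y z)) t"
proof -
  have "(\<lambda>xs. L (case xs of [y, z] \<Rightarrow> b y z | _ \<Rightarrow> 0)) = (\<lambda>xs. case xs of [y, z] \<Rightarrow> L (b y z) | _ \<Rightarrow> 0)"
    by (rule ext) (auto split: list.splits simp: linear_0[OF assms])
  then show ?thesis
    unfolding tlift2_def tlift_def by (subst free_lift_image[OF assms]) simp
qed

lemma free_lift_add: "free_lift (\<lambda>xs. \<phi> xs + \<psi> xs) f = free_lift \<phi> f + free_lift \<psi> f"
  by (simp add: free_lift_def scaleR_add_right sum.distrib)

lemma tlift2_add: "tlift2 (\<lambda>y z. b y z + c y z) t = tlift2 b t + tlift2 c t"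
proof -
  have "(\<lambda>xs. case xs of [y, z] \<Rightarrow> b y z + c y z | _ \<Rightarrow> 0)
      = (\<lambda>xs. (case xs of [y, z] \<Rightarrow> b y z | _ \<Rightarrow> 0) + (case xs of [y, z] \<Rightarrow> c y z | _ \<Rightarrow> 0))"
    by (auto simp: fun_eq_iff split: list.splits)
  then show ?thesis by (simp add: tlift2_def tlift_def free_lift_add)
qed

lemma linear_tlift2': "bilin b \<Longrightarrow> linear (tlift2 b)"
  and tlift2_tens': "bilin b \<Longrightarrow> tlift2 b (tens [x, y]) = b x y"
  by (auto intro!: linear_tlift2 tlift2_tens dest: bilinD1 bilinD2)

lemma tensor_power_2: "tensor_power 2 = span {tens [y, z] | y z. True}"
proof -
  have "{tens xs |xs. length xs = 2} = {tens [y, z] | y (z::'a). True}"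
    by (force simp: length_Suc_conv numeral_2_eq_2)
  then show ?thesis by (simp add: tensor_power_def)
qed

lemma tlift2_id: "t \<in> tensor_power 2 \<Longrightarrow> tlift2 (\<lambda>y z. tens [y, z]) t = t"
  unfolding tensor_power_2
  by (erule linear_eq_on_span[rotated 3])
     (auto intro!: linear_tlift2' bilinI linear_rules simp: tlift2_tens' bilin_def linear_rules linear_tens2_left linear_tens2_right)

lemma bilin_tens: "bilin (\<lambda>y z. tens [y, z])"
  by (rule bilinI) (rule linear_tens2_left linear_tens2_right)+

lemma tlift2_tswap:
  assumes "bilin b"
  shows "tlift2 b (tswap t) = tlift2 (\<lambda>y z. b z y) t"
  unfolding tswap_def
  by (subst tlift2_image[OF linear_tlift2'[OF assms]]) (simp add: tlift2_tens'[OF assms])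

lemma bilin_tmult: "bilin tmult"
  unfolding tmult_def
  by (intro bilinI linear_tlift2' linear_tlift2_param linear_rules)

lemma tmult_tlift2:
  "tmult (tlift2 b s) (tlift2 c t) = tlift2 (\<lambda>y z. tlift2 (\<lambda>y' z'. tmult (b y z) (c y' z')) t) s"
  by (subst tlift2_image[OF bilinD1[OF bilin_tmult]], subst tlift2_image[OF bilinD2[OF bilin_tmult]]) simp

lemma linear_tcat_left: "linear (\<lambda>s. s \<otimes> t)"
proof -
  have "multilinear (\<lambda>xs. tlift (\<lambda>ys. tens (xs @ ys)) t)"
    unfolding multilinear_def tlift_def
    by (auto intro!: linear_free_lift_param linear_tens_entry)
  then show ?thesis unfolding tcat_def by (rule linear_tlift)
qed

text \<open>The outer lift runs over \<open>s\<close>, so \<open>t\<close> is only a parameter of a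
  finite sum whose terms are lifts linear in \<open>t\<close>.\<close>

lemma linear_tcat_right: "linear (\<lambda>t. s \<otimes> t)"
  unfolding tcat_def tlift_def[of "\<lambda>xs. tlift (\<lambda>ys. tens (xs @ ys)) t" for t]
  by (intro linear_free_lift_param linear_tlift multilinear_append_left)

lemma tcat_in_tensor_power:
  assumes "s \<in> tensor_power n"
  shows "s \<otimes> tens [z] \<in> tensor_power (Suc n)"
proof -
  have "(\<lambda>s. s \<otimes> tens [z]) ` tensor_power n \<subseteq> tensor_power (Suc n)"
    unfolding tensor_power_def
    by (subst linear_span_image[OF linear_tcat_left, symmetric], rule span_mono)
       (auto simp: tcat_tens)
  then show ?thesis using assms by auto
qed

lemma linear_tprod: "linear tprod"
  unfolding tprod_def
  by (rule linear_tlift) (auto simp: multilinear_def algebra_simps intro!: linearI)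

lemma linear_tmap: "(\<And>f. f \<in> set fs \<Longrightarrow> linear f) \<Longrightarrow> linear (tmap fs)"
  unfolding tmap_def by (intro linear_tlift multilinear_tmap)

text \<open>The threefold analogue of the case distinction behind \<open>tlift2\<close>, zero off
  the third tensor power. It evaluates both sides of coassociativity on one trilinear map.\<close>

definition case3 :: "('a \<Rightarrow> 'a \<Rightarrow> 'a \<Rightarrow> 'b::zero) \<Rightarrow> 'a list \<Rightarrow> 'b" where
  "case3 b xs = (if length xs = 3 then b (xs ! 0) (xs ! 1) (xs ! 2) else 0)"

lemma multilinear_case3:
  assumes "\<And>y z. linear (\<lambda>x. b x y z)" "\<And>x z. linear (\<lambda>y. b x y z)" "\<And>x y. linear (b x y)"
  shows "multilinear (case3 b)"
  unfolding multilinear_def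
proof (intro allI)
  fix xs ys :: "'a list"
  consider "length xs + length ys \<noteq> 2" | "length xs = 0" "length ys = 2"
    | "length xs = 1" "length ys = 1" | "length xs = 2" "length ys = 0" by linarith
  then show "linear (\<lambda>x. case3 b (xs @ x # ys))"
  proof cases
    case 1 then show ?thesis by (simp add: case3_def linear_zero)
  qed (auto simp: case3_def nth_append assms)
qed

section \<open>Convolution\<close>

context hopf_algebra
begin

definition sweedler :: "('a \<Rightarrow> 'a \<Rightarrow> 'b::real_vector) \<Rightarrow> 'a \<Rightarrow> 'b" where
  "sweedler b x = tlift2 b (\<Delta> x)"

text \<open>The target may be any real algebra: target \<open>'a\<close> gives the operators of the
  theorem, target \<open>real\<close> the functionals of the independence proof.\<close>

definition conv :: "('a \<Rightarrow> 'b::real_algebra) \<Rightarrow> ('a \<Rightarrow> 'b) \<Rightarrow> 'a \<Rightarrow> 'b" where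
  "conv f g = sweedler (\<lambda>y z. f y * g z)"

lemma linear_sweedler: "bilin b \<Longrightarrow> linear f \<Longrightarrow> linear (\<lambda>x. sweedler b (f x))"
  unfolding sweedler_def
  by (intro linear_comp[OF linear_tlift2'] linear_comp[OF linear_coproduct])

lemma linear_sweedler_param:
  assumes "\<And>y z. linear (\<lambda>t. b t y z)"
  shows "linear (\<lambda>t. sweedler (b t) x)"
  unfolding sweedler_def using assms by (rule linear_tlift2_param)

lemma sweedler_image: "linear L \<Longrightarrow> L (sweedler b x) = sweedler (\<lambda>y z. L (b y z)) x"
  unfolding sweedler_def by (rule tlift2_image)

text \<open>Coproducts lie in the second tensor power, where this lift is the identity. A bare
  \<open>\<Delta> x\<close> can thus be pushed through linear maps as if it were a sum of pure
  tensors.\<close>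

lemma sweedler_tens: "sweedler (\<lambda>y z. tens [y, z]) x = \<Delta> x"
  unfolding sweedler_def by (rule tlift2_id[OF coproduct_in])

lemma linear_conv: "linear f \<Longrightarrow> linear g \<Longrightarrow> linear (conv f g)"
  unfolding conv_def
  by (rule linear_sweedler[OF _ linear_ident]) (intro bilinI linear_rules; assumption)

lemma coproduct_tcat_right:
  "multilinear (case3 b) \<Longrightarrow> tlift (case3 b) (\<Delta> y \<otimes> tens [z]) = sweedler (\<lambda>u v. b u v z) y"
proof -
  assume m: "multilinear (case3 b)"
  have lin: "linear (\<lambda>s. tlift (case3 b) (s \<otimes> tens [z]))"
    by (rule linear_comp[OF linear_tlift[OF m] linear_tcat_left])
  have "tlift (case3 b) (sweedler (\<lambda>u v. tens [u, v]) y \<otimes> tens [z])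
      = sweedler (\<lambda>u v. tlift (case3 b) (tens [u, v] \<otimes> tens [z])) y"
    by (rule sweedler_image[OF lin])
  then show ?thesis by (simp add: sweedler_tens tcat_tens tlift_tens[OF m] case3_def)
qed

lemma coproduct_tcat_left:
  "multilinear (case3 b) \<Longrightarrow> tlift (case3 b) (tens [z] \<otimes> \<Delta> y) = sweedler (\<lambda>u v. b z u v) y"
proof -
  assume m: "multilinear (case3 b)"
  have lin: "linear (\<lambda>s. tlift (case3 b) (tens [z] \<otimes> s))"
    by (rule linear_comp[OF linear_tlift[OF m] linear_tcat_right])
  have "tlift (case3 b) (tens [z] \<otimes> sweedler (\<lambda>u v. tens [u, v]) y)
      = sweedler (\<lambda>u v. tlift (case3 b) (tens [z] \<otimes> tens [u, v])) y"
    by (rule sweedler_image[OF lin])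
  then show ?thesis by (simp add: sweedler_tens tcat_tens tlift_tens[OF m] case3_def numeral_3_eq_3)
qed

text \<open>Apply the linear map that \<open>b\<close> induces on the third tensor power to the
  coassociativity axiom.\<close>

lemma sweedler_coassoc:
  assumes "\<And>y z. linear (\<lambda>x. b x y z)" "\<And>x z. linear (\<lambda>y. b x y z)" "\<And>x y. linear (b x y)"
  shows "sweedler (\<lambda>y z. sweedler (\<lambda>u v. b u v z) y) x = sweedler (\<lambda>y z. sweedler (\<lambda>u v. b y u v) z) x"
proof -
  have m: "multilinear (case3 b)" using assms by (rule multilinear_case3)
  have "tlift (case3 b) (sweedler (\<lambda>y z. \<Delta> y \<otimes> tens [z]) x)
      = tlift (case3 b) (sweedler (\<lambda>y z. tens [y] \<otimes> \<Delta> z) x)"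
    by (simp add: sweedler_def coassoc)
  then show ?thesis
    by (simp add: sweedler_image[OF linear_tlift[OF m]] coproduct_tcat_right[OF m] coproduct_tcat_left[OF m])
qed

lemma conv_assoc:
  assumes "linear f" "linear g" "linear h"
  shows "conv (conv f g) h = conv f (conv g h)"
proof
  fix x
  have r: "a * sweedler b y = sweedler (\<lambda>u v. a * b u v) y"
    and l: "sweedler b y * a = sweedler (\<lambda>u v. b u v * a) y" for a :: 'b and b y
    using sweedler_image[of "\<lambda>c. a * c"] sweedler_image[of "\<lambda>c. c * a"] by (simp_all add: linear_rules)
  have "sweedler (\<lambda>y z. sweedler (\<lambda>u v. f u * g v * h z) y) x
      = sweedler (\<lambda>y z. sweedler (\<lambda>u v. f y * g u * h v) z) x"
    by (rule sweedler_coassoc) (intro linear_rules assms)+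
  then show "conv (conv f g) h x = conv f (conv g h) x"
    by (simp add: conv_def r l mult.assoc)
qed

lemma sweedler_cocommute:
  assumes "cocommutative \<Delta>" "bilin b"
  shows "sweedler b x = sweedler (\<lambda>y z. b z y) x"
  using assms tlift2_tswap[OF assms(2), of "\<Delta> x"] by (simp add: sweedler_def cocommutative_def)

text \<open>By coassociativity, the two middle legs of the fourfold coproduct are the coproduct of a
  single element, so cocommutativity lets them change places.\<close>

lemma sweedler_interchange:
  assumes "cocommutative \<Delta>"
    and "\<And>x y z. linear (\<lambda>w. B w x y z)" "\<And>w y z. linear (\<lambda>x. B w x y z)"
    and "\<And>w x z. linear (\<lambda>y. B w x y z)" "\<And>w x y. linear (B w x y)"
  shows "sweedler (\<lambda>y z. sweedler (\<lambda>y1 y2. sweedler (\<lambda>z1 z2. B y1 y2 z1 z2) z) y) x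
       = sweedler (\<lambda>y z. sweedler (\<lambda>y1 y2. sweedler (\<lambda>z1 z2. B y1 z1 y2 z2) z) y) x"
proof -
  have split: "sweedler (\<lambda>y z. sweedler (\<lambda>y1 y2. sweedler (\<lambda>z1 z2. C y1 y2 z1 z2) z) y) x
      = sweedler (\<lambda>y z. sweedler (\<lambda>s z2. sweedler (\<lambda>u v. C y u v z2) s) z) x"
    if C: "\<And>x y z. linear (\<lambda>w. C w x y z)" "\<And>w y z. linear (\<lambda>x. C w x y z)"
      "\<And>w x z. linear (\<lambda>y. C w x y z)" "\<And>w x y. linear (C w x y)" for C :: "'a \<Rightarrow> 'a \<Rightarrow> 'a \<Rightarrow> 'a \<Rightarrow> 'b"
  proof -
    have "sweedler (\<lambda>y z. sweedler (\<lambda>y1 y2. sweedler (\<lambda>z1 z2. C y1 y2 z1 z2) z) y) x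
        = sweedler (\<lambda>y z. sweedler (\<lambda>u v. sweedler (\<lambda>z1 z2. C y u z1 z2) v) z) x"
      by (rule sweedler_coassoc)
         (intro linear_sweedler_param linear_sweedler[OF _ linear_ident] bilinI C)+
    also have "\<dots> = sweedler (\<lambda>y z. sweedler (\<lambda>s z2. sweedler (\<lambda>u v. C y u v z2) s) z) x"
      by (simp add: sweedler_coassoc[OF C(2,3,4)])
    finally show ?thesis .
  qed
  have "sweedler (\<lambda>u v. B y u v z2) s = sweedler (\<lambda>u v. B y v u z2) s" for y z2 s
    by (rule sweedler_cocommute[OF assms(1)]) (intro bilinI assms)
  then show ?thesis
    using split[of B] split[of "\<lambda>w x y. B w y x"] assms by simp
qed

end

section \<open>Alternating products as iterated convolutions\<close>

lemma iter_coproduct_in_tensor_power: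
  "iter_coproduct \<Delta> (Suc n) x \<in> tensor_power (Suc n)"
proof (induction n arbitrary: x)
  case 0
  show ?case by (auto simp: tensor_power_def intro!: span_base)
next
  case (Suc n)
  show ?case
    unfolding iter_coproduct.simps
    by (rule tlift2_in_subspace)
       (auto simp: Suc tcat_in_tensor_power, simp add: tensor_power_def)
qed

lemma tprod_tmap_snoc:
  assumes "\<And>g. g \<in> set fs \<Longrightarrow> linear g" "linear f" "s \<in> tensor_power (length fs)"
  shows "tprod (tmap (fs @ [f]) (s \<otimes> tens [z])) = tprod (tmap fs s) * f z"
proof (rule linear_eq_on_span[OF _ _ _ assms(3)[unfolded tensor_power_def]])
  have lin: "\<And>g. g \<in> set (fs @ [f]) \<Longrightarrow> linear g" using assms(1,2) by auto
  show "linear (\<lambda>s. tprod (tmap (fs @ [f]) (s \<otimes> tens [z])))"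
    by (rule linear_comp[OF linear_tprod linear_comp[OF linear_tmap[OF lin] linear_tcat_left]])
  show "linear (\<lambda>s. tprod (tmap fs s) * f z)"
    by (rule linear_mult_left linear_comp[OF linear_tprod linear_tmap[OF assms(1)]])+
  show "tprod (tmap (fs @ [f]) (t \<otimes> tens [z])) = tprod (tmap fs t) * f z"
    if "t \<in> {tens xs |xs. length xs = length fs}" for t
  proof -
    obtain xs where t: "t = tens xs" "length xs = length fs" using \<open>t \<in> _\<close> by auto
    have "tmap (fs @ [f]) (tens (xs @ [z])) = tens (map2 (\<lambda>f x. f x) (fs @ [f]) (xs @ [z]))"
      by (rule tmap_tens[OF lin]) (auto simp: t)
    moreover have "tmap fs (tens xs) = tens (map2 (\<lambda>f x. f x) fs xs)"
      by (rule tmap_tens[OF assms(1)]) (auto simp: t)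
    ultimately show ?thesis by (simp add: t tcat_tens tprod_tens)
  qed
qed

context hopf_algebra
begin

text \<open>The recursion of \<open>iter_coproduct\<close> splits off the rightmost tensor factor,
  so a further map is convolved on the right. The list \<open>fs\<close> must be nonempty because
  the value of \<open>iter_coproduct\<close> at 0 is a dummy.\<close>

lemma tprod_tmap_iter_coproduct_snoc:
  assumes "\<And>g. g \<in> set fs \<Longrightarrow> linear g" "linear f" "fs \<noteq> []"
  shows "tprod (tmap (fs @ [f]) (iter_coproduct \<Delta> (Suc (length fs)) x))
       = conv (\<lambda>y. tprod (tmap fs (iter_coproduct \<Delta> (length fs) y))) f x"
proof -
  obtain n where n: "length fs = Suc n" using assms(3) by (cases fs) auto
  have lin: "linear (\<lambda>s. tprod (tmap (fs @ [f]) s))"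
    by (rule linear_comp[OF linear_tprod linear_tmap]) (use assms in auto)
  show ?thesis
    unfolding n iter_coproduct.simps conv_def sweedler_def tlift2_image[OF lin]
    by (subst tprod_tmap_snoc) (use assms n iter_coproduct_in_tensor_power in \<open>auto\<close>)
qed

text \<open>With \<open>f = id\<close> and \<open>g = \<tau>\<close> this is \<open>\<tau>\<^sup>+\<close>, with the roles exchanged it is \<open>\<tau>\<^sup>-\<close>; the value at
  \<open>0\<close> is a dummy.\<close>

definition alt_conv :: "('a \<Rightarrow> 'a) \<Rightarrow> ('a \<Rightarrow> 'a) \<Rightarrow> nat \<Rightarrow> 'a \<Rightarrow> 'a" where
  "alt_conv f g a x =
     tprod (tmap (map (\<lambda>i. if even i then f else g) [0..<a]) (iter_coproduct \<Delta> a x))"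

lemma alt_conv_1:
  assumes "linear f"
  shows "alt_conv f g (Suc 0) x = f x"
  using assms tmap_tens[of "[f]" "[x]"] by (simp add: alt_conv_def tprod_tens)

lemma alt_conv_Suc:
  assumes "linear f" "linear g" "a > 0"
  shows "alt_conv f g (Suc a) = conv (alt_conv f g a) (if even a then f else g)"
proof
  fix x
  have "tprod (tmap (map (\<lambda>i. if even i then f else g) [0..<a] @ [if even a then f else g])
          (iter_coproduct \<Delta> (Suc (length (map (\<lambda>i. if even i then f else g) [0..<a]))) x))
      = conv (\<lambda>y. tprod (tmap (map (\<lambda>i. if even i then f else g) [0..<a])
          (iter_coproduct \<Delta> (length (map (\<lambda>i. if even i then f else g) [0..<a])) y)))
            (if even a then f else g) x"
    by (rule tprod_tmap_iter_coproduct_snoc) (use assms in \<open>auto split: if_splits\<close>)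
  then show "alt_conv f g (Suc a) x = conv (alt_conv f g a) (if even a then f else g) x"
    by (simp add: alt_conv_def[abs_def])
qed

lemma linear_alt_conv:
  assumes "linear f" "linear g" "a > 0"
  shows "linear (alt_conv f g a)"
  using assms(3)
proof (induction a rule: nat_induct_non_zero)
  case 1
  have "alt_conv f g 1 = f" using assms by (auto simp: alt_conv_1)
  then show ?case using assms by simp
next
  case (Suc a)
  then show ?case using assms by (auto simp: alt_conv_Suc intro!: linear_conv)
qed

text \<open>By associativity the alternating product may be peeled from the left as well. A factor
  in front shifts all positions by one, hence the exchange of \<open>f\<close> and \<open>g\<close>;
  an odd product starting with \<open>g\<close> is reduced in this way to an even one starting with
  \<open>f\<close>.\<close>

lemma alt_conv_Suc_left:
  assumes "linear f" "linear g" "a > 0"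
  shows "alt_conv g f (Suc a) = conv g (alt_conv f g a)"
  using assms(3)
proof (induction a rule: nat_induct_non_zero)
  case 1
  have "alt_conv f g (Suc 0) = f" "alt_conv g f (Suc 0) = g"
    using assms by (auto simp: alt_conv_1)
  then show ?case using assms by (simp add: alt_conv_Suc)
next
  case (Suc a)
  then show ?case
    using assms by (simp add: alt_conv_Suc conv_assoc linear_alt_conv)
qed

lemma tau_plus_eq_alt_conv: "tau_plus \<Delta> \<tau> = alt_conv id \<tau>"
  and tau_minus_eq_alt_conv: "tau_minus \<Delta> \<tau> = alt_conv \<tau> id"
  by (auto simp: fun_eq_iff tau_plus_def tau_minus_def alt_conv_def)

end

section \<open>Products of primitive elements\<close>

text \<open>The unshuffle coproduct of a word, evaluated by \<open>h\<close>. Splittings are counted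
  by positions, so a word of n letters contributes 2^n terms even if letters repeat.\<close>

fun unshuffle_sum :: "('a list \<Rightarrow> 'a list \<Rightarrow> 'b::monoid_add) \<Rightarrow> 'a list \<Rightarrow> 'b" where
  "unshuffle_sum h [] = h [] []"
| "unshuffle_sum h (x # w) = unshuffle_sum (\<lambda>u v. h (x # u) v) w + unshuffle_sum (\<lambda>u v. h u (x # v)) w"

lemma unshuffle_sum_image:
  assumes "linear L"
  shows "L (unshuffle_sum h w) = unshuffle_sum (\<lambda>u v. L (h u v)) w"
  by (induction w arbitrary: h) (auto simp: linear_add[OF assms])

lemma unshuffle_sum_append:
  "unshuffle_sum h (w @ w') = unshuffle_sum (\<lambda>u v. unshuffle_sum (\<lambda>u' v'. h (u @ u') (v @ v')) w') w"
  by (induction w arbitrary: h) auto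

text \<open>Of an unshuffle only the multiset equation is retained. It suffices later: it gives the
  total length and the set of letters, and it determines the subwords of p...p up to their
  lengths.\<close>

lemma unshuffle_sum_cong:
  assumes "\<And>u v. mset u + mset v = mset w \<Longrightarrow> h u v = h' u v"
  shows "unshuffle_sum h w = unshuffle_sum h' w"
  using assms
proof (induction w arbitrary: h h')
  case (Cons x w)
  have "unshuffle_sum (\<lambda>u v. h (x # u) v) w = unshuffle_sum (\<lambda>u v. h' (x # u) v) w"
    and "unshuffle_sum (\<lambda>u v. h u (x # v)) w = unshuffle_sum (\<lambda>u v. h' u (x # v)) w"
    by (rule Cons.IH, rule Cons.prems, simp)+
  then show ?case by simp
qed simp

lemma unshuffle_sum_zero [simp]: "unshuffle_sum (\<lambda>u v. 0) w = 0"
  by (induction w) auto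

lemma unshuffle_sum_Nil_left:
  "unshuffle_sum (\<lambda>u v. if u = [] then h v else 0) w = h w"
  by (induction w arbitrary: h) auto

lemma unshuffle_sum_Nil_right:
  "unshuffle_sum (\<lambda>u v. if v = [] then h u else 0) w = h w"
  by (induction w arbitrary: h) auto

text \<open>The binomial theorem, as n choose j splittings of a word of length n have a left part of
  length j.\<close>

lemma unshuffle_sum_power:
  "unshuffle_sum (\<lambda>u v. c ^ length u) w = (1 + c :: real) ^ length w"
  by (induction w)
     (simp_all add: unshuffle_sum_image[of "\<lambda>x. c * x", OF linear_mult_right[OF linear_ident], symmetric] algebra_simps)

text \<open>The value of the antipode on a product of primitives. In the overview it is the
  coefficient of the inverse of Q.\<close>

definition signed_rev_prod :: "'a::real_algebra_1 list \<Rightarrow> 'a" where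
  "signed_rev_prod w = (-1) ^ length w *\<^sub>R prod_list (rev w)"

text \<open>The first letter \<open>x\<close> ends up outermost, on the left with sign + or on the
  right with sign -. It therefore contributes its commutator with the sum for the remaining word,
  and that sum is the scalar 0 or 1.\<close>

lemma unshuffle_sum_signed_rev_right:
  "unshuffle_sum (\<lambda>u v. prod_list u * signed_rev_prod v) w = (if w = [] then 1 else 0)"
proof (induction w)
  case (Cons x w)
  have "unshuffle_sum (\<lambda>u v. prod_list (x # u) * signed_rev_prod v) w
      = x * unshuffle_sum (\<lambda>u v. prod_list u * signed_rev_prod v) w"
    by (subst unshuffle_sum_image) (auto intro!: linear_rules simp: mult.assoc)
  moreover have "unshuffle_sum (\<lambda>u v. prod_list u * signed_rev_prod (x # v)) w
      = unshuffle_sum (\<lambda>u v. prod_list u * signed_rev_prod v) w * (- x)"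
    by (subst unshuffle_sum_image[OF linear_mult_left[OF linear_ident]])
       (simp add: mult.assoc signed_rev_prod_def)
  ultimately show ?case using Cons by simp
qed (simp add: signed_rev_prod_def)

text \<open>With the reversed factor in front it is the last letter that ends up outermost, so the
  same commutator argument needs induction from the right end.\<close>

lemma unshuffle_sum_signed_rev_left:
  "unshuffle_sum (\<lambda>u v. signed_rev_prod u * prod_list v) w = (if w = [] then 1 else 0)"
proof (induction w rule: rev_induct)
  case (snoc x w)
  have 1: "unshuffle_sum (\<lambda>u v. signed_rev_prod (u @ [x]) * prod_list v) w
      = (- x) * unshuffle_sum (\<lambda>u v. signed_rev_prod u * prod_list v) w"
    by (subst unshuffle_sum_image[OF linear_mult_right[OF linear_ident]])
       (simp add: mult.assoc signed_rev_prod_def)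
  have 2: "unshuffle_sum (\<lambda>u v. signed_rev_prod u * prod_list (v @ [x])) w
      = unshuffle_sum (\<lambda>u v. signed_rev_prod u * prod_list v) w * x"
    by (subst unshuffle_sum_image[of "\<lambda>y. y * x"]) (auto intro!: linear_rules simp: mult.assoc)
  have add: "unshuffle_sum (\<lambda>u v. h u v + h' u v) w = unshuffle_sum h w + unshuffle_sum h' w"
    for h h' :: "'a list \<Rightarrow> 'a list \<Rightarrow> 'a" and w
    by (induction w arbitrary: h h') auto
  show ?case using snoc 1 2 by (simp add: unshuffle_sum_append add)
qed (simp add: signed_rev_prod_def)

section \<open>The coproduct on products of primitives\<close>

context hopf_algebra
begin

lemma subspace_primitives: "subspace (primitives \<Delta>)"
  by (rule subspaceI)
     (auto simp: primitives_def linear_0[OF linear_coproduct] linear_add[OF linear_coproduct]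
       linear_scale[OF linear_coproduct] linear_0[OF linear_tens2_left] linear_0[OF linear_tens2_right]
       linear_add[OF linear_tens2_left] linear_add[OF linear_tens2_right]
       linear_scale[OF linear_tens2_left] linear_scale[OF linear_tens2_right] algebra_simps)

lemma counit_primitive:
  assumes "x \<in> primitives \<Delta>"
  shows "\<epsilon> x = 0"
proof -
  have b: "bilin (\<lambda>y z. \<epsilon> y *\<^sub>R z)"
    by (intro bilinI linear_rules linear_counit)
  have "x = \<epsilon> 1 *\<^sub>R x + \<epsilon> x *\<^sub>R 1"
    using counit_left[of x] assms
    by (simp add: primitives_def linear_add[OF linear_tlift2'[OF b]] tlift2_tens'[OF b])
  then show ?thesis by (simp add: counit_one)
qed

lemma commutator_primitive:
  assumes "x \<in> primitives \<Delta>" "y \<in> primitives \<Delta>"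
  shows "x * y - y * x \<in> primitives \<Delta>"
  using assms
  by (simp add: primitives_def linear_diff[OF linear_coproduct] coproduct_mult tmult_tens
      linear_add[OF bilinD1[OF bilin_tmult]] linear_add[OF bilinD2[OF bilin_tmult]]
      linear_diff[OF linear_tens2_left] linear_diff[OF linear_tens2_right])

text \<open>Multiplication by x \<otimes> 1 puts the letter x into the left subword, multiplication
  by 1 \<otimes> x into the right one: this is the recursion of
  \<open>unshuffle_sum\<close>.\<close>

lemma coproduct_prod_primitives:
  assumes "set w \<subseteq> primitives \<Delta>"
  shows "\<Delta> (prod_list w) = unshuffle_sum (\<lambda>u v. tens [prod_list u, prod_list v]) w"
  using assms
proof (induction w)
  case Nil
  show ?case by (simp add: coproduct_one)
next
  case (Cons x w)
  have "\<Delta> (prod_list (x # w)) = tmult (tens [x, 1]) (\<Delta> (prod_list w)) + tmult (tens [1, x]) (\<Delta> (prod_list w))"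
    using Cons.prems by (simp add: coproduct_mult primitives_def linear_add[OF bilinD1[OF bilin_tmult]])
  also have "\<dots> = unshuffle_sum (\<lambda>u v. tens [prod_list u, prod_list v]) (x # w)"
    using Cons by (simp add: unshuffle_sum_image[OF bilinD2[OF bilin_tmult]] tmult_tens)
  finally show ?case .
qed

lemma sweedler_prod_primitives:
  assumes "set w \<subseteq> primitives \<Delta>" "bilin b"
  shows "sweedler b (prod_list w) = unshuffle_sum (\<lambda>u v. b (prod_list u) (prod_list v)) w"
  using assms
  by (simp add: sweedler_def coproduct_prod_primitives unshuffle_sum_image[OF linear_tlift2'] tlift2_tens')

lemma conv_prod_primitives:
  assumes "set w \<subseteq> primitives \<Delta>" "linear f" "linear g"
  shows "conv f g (prod_list w) = unshuffle_sum (\<lambda>u v. f (prod_list u) * g (prod_list v)) w"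
  unfolding conv_def
  by (rule sweedler_prod_primitives[OF assms(1)]) (intro bilinI linear_rules assms)

end

section \<open>Polarization\<close>

lemma power_sum_eq_sum_words:
  fixes x :: "'i \<Rightarrow> 'a::semiring_1"
  assumes "finite I"
  shows "(\<Sum>i\<in>I. x i) ^ k = (\<Sum>w | set w \<subseteq> I \<and> length w = k. prod_list (map x w))"
proof (induction k)
  case 0
  have "{w. set w \<subseteq> I \<and> length w = 0} = {[]}" by auto
  then show ?case by simp
next
  case (Suc k)
  have "(\<Sum>w | set w \<subseteq> I \<and> length w = Suc k. prod_list (map x w))
      = (\<Sum>(w, i)\<in>{w. set w \<subseteq> I \<and> length w = k} \<times> I. x i * prod_list (map x w))"
    unfolding lists_length_Suc_eq
    by (subst sum.reindex) (auto intro!: inj_onI sum.cong)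
  also have "\<dots> = (\<Sum>w | set w \<subseteq> I \<and> length w = k. \<Sum>i\<in>I. x i * prod_list (map x w))"
    by (simp add: sum.cartesian_product)
  also have "\<dots> = (\<Sum>i\<in>I. x i) * (\<Sum>w | set w \<subseteq> I \<and> length w = k. prod_list (map x w))"
    by (simp add: sum_product sum.swap[of _ I])
  finally show ?case by (simp add: Suc)
qed

text \<open>A word of length k in which all k indices occur contains each of them once, so it lists
  the values of a permutation.\<close>

lemma sum_surjective_words_eq_sym_prod:
  "(\<Sum>w | set w = {..<length ps} \<and> length w = length ps. prod_list (map ((!) ps) w)) = sym_prod ps"
proof -
  let ?k = "length ps"
  have "bij_betw (\<lambda>\<sigma>. map \<sigma> [0..<?k]) {\<sigma>. \<sigma> permutes {..<?k}} {w. set w = {..<?k} \<and> length w = ?k}"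
  proof (rule bij_betwI')
    fix \<sigma> \<rho> assume "\<sigma> \<in> {\<sigma>. \<sigma> permutes {..<?k}}" "\<rho> \<in> {\<sigma>. \<sigma> permutes {..<?k}}"
    then have "\<forall>i. i \<notin> {..<?k} \<longrightarrow> \<sigma> i = \<rho> i" by (auto simp: permutes_def)
    then show "(map \<sigma> [0..<?k] = map \<rho> [0..<?k]) = (\<sigma> = \<rho>)"
      by (auto simp: fun_eq_iff)
  next
    fix \<sigma> assume "\<sigma> \<in> {\<sigma>. \<sigma> permutes {..<?k}}"
    then show "map \<sigma> [0..<?k] \<in> {w. set w = {..<?k} \<and> length w = ?k}"
      using permutes_image[of \<sigma> "{..<?k}"] by (auto simp: atLeast0LessThan)
  next
    fix w assume "w \<in> {w. set w = {..<?k} \<and> length w = ?k}"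
    then have w: "set w = {..<?k}" "length w = ?k" by auto
    define \<sigma> where "\<sigma> = (\<lambda>i. if i < ?k then w ! i else i)"
    have "\<sigma> ` {..<?k} = (!) w ` {..<length w}" using w(2) by (intro image_cong) (auto simp: \<sigma>_def)
    also have "\<dots> = set w" by (auto simp: set_conv_nth)
    finally have img: "\<sigma> ` {..<?k} = {..<?k}" using w(1) by simp
    then have "inj_on \<sigma> {..<?k}" by (intro eq_card_imp_inj_on) auto
    then have "\<sigma> permutes {..<?k}"
      using img by (intro bij_imp_permutes) (auto simp: bij_betw_def \<sigma>_def)
    moreover have "w = map \<sigma> [0..<?k]" using w(2) by (intro nth_equalityI) (auto simp: \<sigma>_def)
    ultimately show "\<exists>\<sigma>\<in>{\<sigma>. \<sigma> permutes {..<?k}}. w = map \<sigma> [0..<?k]" by auto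
  qed
  from sum.reindex_bij_betw[OF this, of "\<lambda>w. prod_list (map ((!) ps) w)"]
  show ?thesis by (simp add: sym_prod_def o_def)
qed

text \<open>Expanding the k-th power of a partial sum over \<open>I\<close> gives all words with
  indices in \<open>I\<close>. Moebius inversion over subsets isolates the words in which every
  index occurs, and these make up the symmetrized product.\<close>

lemma sym_prod_in_span_powers:
  assumes "subspace V" "set ps \<subseteq> V"
  shows "sym_prod ps \<in> span {p ^ length ps | p. p \<in> V}"
proof -
  let ?k = "length ps"
  let ?f = "\<lambda>I. \<Sum>w | set w = I \<and> length w = ?k. prod_list (map ((!) ps) w)"
  let ?g = "\<lambda>I. (\<Sum>i\<in>I. ps ! i) ^ ?k"
  have fg: "?g I = sum ?f (Pow I)" if "finite I" for I
  proof -
    have "sum ?f (Pow I) = (\<Sum>J\<in>Pow I. \<Sum>w | w \<in> {w. set w \<subseteq> I \<and> length w = ?k} \<and> set w = J. prod_list (map ((!) ps) w))"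
      by (intro sum.cong refl) auto
    also have "\<dots> = (\<Sum>w | set w \<subseteq> I \<and> length w = ?k. prod_list (map ((!) ps) w))"
      by (rule sum.group) (use that finite_lists_length_eq[of I ?k] in auto)
    finally show ?thesis using that by (simp add: power_sum_eq_sum_words)
  qed
  have "?f {..<?k} = (\<Sum>T\<in>Pow {..<?k}. (-1) ^ (card {..<?k} - card T) * ?g T)"
    by (rule inclusion_exclusion_mobius[OF fg]) auto
  also have "\<dots> = (\<Sum>T\<in>Pow {..<?k}. (-1) ^ (card {..<?k} - card T) *\<^sub>R ?g T)"
    by (simp add: scaleR_conv_of_real)
  also have "\<dots> \<in> span {p ^ ?k | p. p \<in> V}"
  proof (intro span_sum span_scale)
    fix T assume "T \<in> Pow {..<?k}"
    then have "(\<Sum>i\<in>T. ps ! i) \<in> V" using assms by (intro subspace_sum) (auto dest!: subsetD)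
    then show "?g T \<in> span {p ^ ?k | p. p \<in> V}" by (intro span_base) auto
  qed
  finally show ?thesis by (simp add: sum_surjective_words_eq_sym_prod)
qed

section \<open>The eigenvectors\<close>

lemma unshuffle_sum_power_left:
  "unshuffle_sum (\<lambda>u v. c ^ length u *\<^sub>R y) w = (1 + c) ^ length w *\<^sub>R (y::'a::real_vector)"
  by (subst unshuffle_sum_image[symmetric]) (auto intro!: linear_rules simp: unshuffle_sum_power)

lemma unshuffle_sum_swap:
  "unshuffle_sum h w = unshuffle_sum (\<lambda>u v. h v u) (w :: 'b list)" for h :: "_ \<Rightarrow> _ \<Rightarrow> 'a::comm_monoid_add"
proof (induction w arbitrary: h)
  case (Cons x w)
  show ?case
    using Cons[of "\<lambda>u v. h (x # u) v"] Cons[of "\<lambda>u v. h u (x # v)"] by (simp add: add.commute)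
qed simp

lemma prod_list_unshuffled_replicate:
  assumes "mset r + mset s = mset (replicate k p)"
  shows "prod_list r = p ^ length r" "prod_list s = p ^ length s"
proof -
  have "set r \<subseteq> {p}" "set s \<subseteq> {p}"
    using arg_cong[OF assms, of set_mset] by (auto split: if_splits)
  then have "r = replicate (length r) p" "s = replicate (length s) p"
    by (metis replicate_eqI singletonD subsetD)+
  then show "prod_list r = p ^ length r" "prod_list s = p ^ length s"
    by (metis prod_list_replicate)+
qed

context hopf_algebra
begin

text \<open>
  \<open>X k qs\<close> stands for \<open>p\<^sup>k q\<^sub>1 \<cdots> q\<^sub>l\<close> or \<open>q\<^sub>1 \<cdots> q\<^sub>l p\<^sup>k\<close>, and \<open>Qf\<close>, \<open>Qg\<close> for the coefficients of \<open>Q\<close> and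
  \<open>Q\<^sup>-\<^sup>1\<close>, in either order.
\<close>

lemma alt_conv_powers:
  assumes lin: "linear f" "linear g"
    and conv_X: "\<And>(F :: 'a \<Rightarrow> 'a) G k qs. linear F \<Longrightarrow> linear G \<Longrightarrow> set qs \<subseteq> Q \<Longrightarrow>
      conv F G (X k qs) = unshuffle_sum (\<lambda>r s. unshuffle_sum (\<lambda>u v.
        F (X (length r) u) * G (X (length s) v)) qs) (replicate k p)"
    and f_X: "\<And>k qs. set qs \<subseteq> Q \<Longrightarrow> f (X k qs) = p ^ k * Qf qs"
    and g_X: "\<And>k qs. set qs \<subseteq> Q \<Longrightarrow> g (X k qs) = Qg qs * p ^ k"
    and cancel: "\<And>qs. unshuffle_sum (\<lambda>u v. Qf u * Qg v) qs = (if qs = [] then 1 else 0)"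
    and qs: "set qs \<subseteq> Q" and a: "a > 0"
  shows "alt_conv f g a (X k qs) = (if odd a then real a ^ k *\<^sub>R (p ^ k * Qf qs)
           else if qs = [] then real a ^ k *\<^sub>R p ^ k else 0)"
    and "odd a \<Longrightarrow> alt_conv g f a (X k qs) = real a ^ k *\<^sub>R (Qg qs * p ^ k)"
proof -
  have sub: "set u \<subseteq> Q \<and> set v \<subseteq> Q" if "mset u + mset v = mset qs" "set qs \<subseteq> Q" for u v qs
    using that by (metis le_sup_iff set_mset_mset set_mset_union)
  have len: "length r + length s = k" if "mset r + mset s = mset (replicate k p)" for r s k
    using that by (metis length_replicate size_mset size_union)
  have main: "alt_conv f g a (X k qs) = (if odd a then real a ^ k *\<^sub>R (p ^ k * Qf qs)
           else if qs = [] then real a ^ k *\<^sub>R p ^ k else 0)" if "a > 0" "set qs \<subseteq> Q" for a k qs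
    using that
  proof (induction a arbitrary: k qs rule: nat_induct_non_zero)
    case 1
    then show ?case by (simp add: alt_conv_1 lin f_X)
  next
    case (Suc a)
    note lina = linear_alt_conv[OF lin Suc.hyps]
    show ?case
    proof (cases "odd a")
      case True
      \<comment> \<open>In generating series: E^a Q times Q^-1 E is E^(a+1). The coefficients of Q
        cancel, which leaves only the empty \<open>qs\<close>.\<close>
      have "alt_conv f g (Suc a) (X k qs) = conv (alt_conv f g a) g (X k qs)"
        using True lin Suc.hyps by (simp add: alt_conv_Suc)
      also have "\<dots> = unshuffle_sum (\<lambda>r s. real a ^ length r *\<^sub>R (if qs = [] then p ^ k else 0)) (replicate k p)"
        unfolding conv_X[OF lina lin(2) Suc.prems]
      proof (rule unshuffle_sum_cong)
        fix r s assume "mset r + mset s = mset (replicate k p)"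
        then have k: "length r + length s = k" by (rule len)
        have "unshuffle_sum (\<lambda>u v. alt_conv f g a (X (length r) u) * g (X (length s) v)) qs
            = unshuffle_sum (\<lambda>u v. real a ^ length r *\<^sub>R (p ^ length r * (Qf u * Qg v) * p ^ length s)) qs"
          by (rule unshuffle_sum_cong) (use True Suc.IH g_X sub Suc.prems in \<open>simp add: mult.assoc\<close>)
        also have "\<dots> = real a ^ length r *\<^sub>R (p ^ length r * (if qs = [] then 1 else 0) * p ^ length s)"
          unfolding cancel[symmetric]
          by (rule unshuffle_sum_image[symmetric]) (intro linear_rules)
        finally show "unshuffle_sum (\<lambda>u v. alt_conv f g a (X (length r) u) * g (X (length s) v)) qs
            = real a ^ length r *\<^sub>R (if qs = [] then p ^ k else 0)"
          by (simp add: k power_add[symmetric])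
      qed
      finally show ?thesis using True by (simp add: unshuffle_sum_power_left)
    next
      case False
      \<comment> \<open>In generating series: E^a times E Q is E^(a+1) Q. The left factor contains
        no Q, so all of \<open>qs\<close> has to go to the right.\<close>
      have "alt_conv f g (Suc a) (X k qs) = conv (alt_conv f g a) f (X k qs)"
        using False lin Suc.hyps by (simp add: alt_conv_Suc)
      also have "\<dots> = unshuffle_sum (\<lambda>r s. real a ^ length r *\<^sub>R (p ^ k * Qf qs)) (replicate k p)"
        unfolding conv_X[OF lina lin(1) Suc.prems]
      proof (rule unshuffle_sum_cong)
        fix r s assume "mset r + mset s = mset (replicate k p)"
        then have k: "length r + length s = k" by (rule len)
        have "unshuffle_sum (\<lambda>u v. alt_conv f g a (X (length r) u) * f (X (length s) v)) qs
            = unshuffle_sum (\<lambda>u v. if u = [] then real a ^ length r *\<^sub>R (p ^ length r * p ^ length s * Qf v) else 0) qs"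
          by (rule unshuffle_sum_cong) (use False Suc.IH f_X sub Suc.prems in \<open>simp add: mult.assoc\<close>)
        then show "unshuffle_sum (\<lambda>u v. alt_conv f g a (X (length r) u) * f (X (length s) v)) qs
            = real a ^ length r *\<^sub>R (p ^ k * Qf qs)"
          by (simp add: unshuffle_sum_Nil_left k power_add[symmetric])
      qed
      finally show ?thesis using False by (simp add: unshuffle_sum_power_left)
    qed
  qed
  show "alt_conv f g a (X k qs) = (if odd a then real a ^ k *\<^sub>R (p ^ k * Qf qs)
           else if qs = [] then real a ^ k *\<^sub>R p ^ k else 0)"
    by (rule main[OF a qs])
  show "alt_conv g f a (X k qs) = real a ^ k *\<^sub>R (Qg qs * p ^ k)" if "odd a"
  proof (cases "a = 1")
    case True
    then show ?thesis by (simp add: alt_conv_1 lin g_X qs)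
  next
    case False
    then obtain b where b: "a = Suc b" "b > 0" "even b" using a \<open>odd a\<close> by (cases a) auto
    \<comment> \<open>In generating series: Q^-1 E times the even product E^b, with
      \<open>b = a - 1\<close>. The case \<open>a = 1\<close> is separate because
      \<open>b = 0\<close> would meet the dummy value.\<close>
    have "alt_conv g f a (X k qs) = conv g (alt_conv f g b) (X k qs)"
      using b lin by (simp add: alt_conv_Suc_left)
    also have "\<dots> = unshuffle_sum (\<lambda>r s. real b ^ length s *\<^sub>R (Qg qs * p ^ k)) (replicate k p)"
      unfolding conv_X[OF lin(2) linear_alt_conv[OF lin b(2)] qs]
    proof (rule unshuffle_sum_cong)
      fix r s assume "mset r + mset s = mset (replicate k p)"
      then have k: "length r + length s = k" by (rule len)
      have "unshuffle_sum (\<lambda>u v. g (X (length r) u) * alt_conv f g b (X (length s) v)) qs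
          = unshuffle_sum (\<lambda>u v. if v = [] then real b ^ length s *\<^sub>R (Qg u * (p ^ length r * p ^ length s)) else 0) qs"
        by (rule unshuffle_sum_cong) (use b main g_X sub qs in \<open>simp add: mult.assoc\<close>)
      then show "unshuffle_sum (\<lambda>u v. g (X (length r) u) * alt_conv f g b (X (length s) v)) qs
          = real b ^ length s *\<^sub>R (Qg qs * p ^ k)"
        by (simp add: unshuffle_sum_Nil_right k power_add[symmetric])
    qed
    also have "\<dots> = real a ^ k *\<^sub>R (Qg qs * p ^ k)"
      by (subst unshuffle_sum_swap) (simp add: unshuffle_sum_power_left b)
    finally show ?thesis .
  qed
qed

lemma conv_power_prod:
  assumes "linear F" "linear G" "p \<in> primitives \<Delta>" "set qs \<subseteq> primitives \<Delta>"
  shows "conv F G (p ^ k * prod_list qs) = unshuffle_sum (\<lambda>r s. unshuffle_sum (\<lambda>u v.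
      F (p ^ length r * prod_list u) * G (p ^ length s * prod_list v)) qs) (replicate k p)"
proof -
  have "conv F G (prod_list (replicate k p @ qs)) = unshuffle_sum (\<lambda>r s. unshuffle_sum (\<lambda>u v.
      F (prod_list (r @ u)) * G (prod_list (s @ v))) qs) (replicate k p)"
    by (subst conv_prod_primitives) (use assms in \<open>auto simp: unshuffle_sum_append\<close>)
  also have "\<dots> = unshuffle_sum (\<lambda>r s. unshuffle_sum (\<lambda>u v.
      F (p ^ length r * prod_list u) * G (p ^ length s * prod_list v)) qs) (replicate k p)"
    by (rule unshuffle_sum_cong) (simp add: prod_list_unshuffled_replicate)
  finally show ?thesis by simp
qed

lemma conv_prod_power:
  assumes "linear F" "linear G" "p \<in> primitives \<Delta>" "set qs \<subseteq> primitives \<Delta>"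
  shows "conv F G (prod_list qs * p ^ k) = unshuffle_sum (\<lambda>r s. unshuffle_sum (\<lambda>u v.
      F (prod_list u * p ^ length r) * G (prod_list v * p ^ length s)) qs) (replicate k p)"
proof -
  \<comment> \<open>Here the letters of \<open>qs\<close> come first in the word; the two unshuffles
    are interchanged to obtain the nesting that \<open>alt_conv_powers\<close> expects.\<close>
  have swap: "unshuffle_sum (\<lambda>u v. unshuffle_sum (\<lambda>r s. h u v r s) w') w
      = unshuffle_sum (\<lambda>r s. unshuffle_sum (\<lambda>u v. h u v r s) w) w'"
    for h :: "'a list \<Rightarrow> 'a list \<Rightarrow> 'a list \<Rightarrow> 'a list \<Rightarrow> 'b" and w w'
  proof (induction w arbitrary: h)
    case (Cons x w)
    have add: "unshuffle_sum (\<lambda>u v. h u v + h' u v) w = unshuffle_sum h w + unshuffle_sum h' w"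
      for h h' :: "'a list \<Rightarrow> 'a list \<Rightarrow> 'b" and w
      by (induction w arbitrary: h h') (auto simp: algebra_simps)
    show ?case by (simp add: Cons add)
  qed simp
  have "conv F G (prod_list (qs @ replicate k p)) = unshuffle_sum (\<lambda>r s. unshuffle_sum (\<lambda>u v.
      F (prod_list (u @ r)) * G (prod_list (v @ s))) qs) (replicate k p)"
    by (subst conv_prod_primitives) (use assms in \<open>auto simp: unshuffle_sum_append intro: swap\<close>)
  also have "\<dots> = unshuffle_sum (\<lambda>r s. unshuffle_sum (\<lambda>u v.
      F (prod_list u * p ^ length r) * G (prod_list v * p ^ length s)) qs) (replicate k p)"
    by (rule unshuffle_sum_cong) (simp add: prod_list_unshuffled_replicate)
  finally show ?thesis by simp
qed

end

section \<open>The antiinvolution and eigenvector equations\<close>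

locale hopf_antiinvolution = graded_connected_hopf_algebra H \<Delta> \<epsilon> antipode
  for H :: "nat \<Rightarrow> 'a::real_algebra_1 set" and \<Delta> \<epsilon> antipode +
  fixes \<tau> :: "'a \<Rightarrow> 'a"
  assumes linear_tau: "linear \<tau>"
    and tau_tau: "\<tau> (\<tau> x) = x"
    and antimorphism: "algebra_antimorphism \<tau>"
    and comorphism: "coalgebra_morphism \<Delta> \<tau> \<or> coalgebra_antimorphism \<Delta> \<tau>"
begin

abbreviation "prim_plus \<equiv> eigenspace (primitives \<Delta>) \<tau> 1"
abbreviation "prim_minus \<equiv> eigenspace (primitives \<Delta>) \<tau> (-1)"

lemma tau_mult: "\<tau> (x * y) = \<tau> y * \<tau> x"
  using antimorphism by (simp add: algebra_antimorphism_def)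

text \<open>An involution is onto, and an antimorphism sends 1 to a unit of its image.\<close>

lemma tau_one: "\<tau> 1 = 1"
  by (metis tau_mult tau_tau mult_1 mult_1_right)

lemma tau_power: "p \<in> prim_plus \<Longrightarrow> \<tau> (p ^ k) = p ^ k"
  by (induction k) (auto simp: tau_one tau_mult eigenspace_def power_commutes)

lemma tau_prod_minus: "set qs \<subseteq> prim_minus \<Longrightarrow> \<tau> (prod_list qs) = signed_rev_prod qs"
  by (induction qs) (auto simp: tau_one tau_mult eigenspace_def signed_rev_prod_def)

lemma subspace_eigenspace: "subspace (eigenspace (primitives \<Delta>) \<tau> c)"
  using subspace_primitives
  by (auto simp: subspace_def eigenspace_def linear_0[OF linear_tau] linear_add[OF linear_tau]
      linear_scale[OF linear_tau] algebra_simps)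

text \<open>On words with the powers of \<open>p\<close> in front, the identity has the generating
  series E Q, and \<open>\<tau>\<close>, which fixes \<open>p\<close> and negates the letters of
  \<open>qs\<close>, has Q^-1 E.\<close>

lemma alt_conv_power_prod:
  assumes "p \<in> prim_plus" "set qs \<subseteq> prim_minus" "a > 0"
  shows "alt_conv id \<tau> a (p ^ k * prod_list qs) = (if odd a then real a ^ k *\<^sub>R (p ^ k * prod_list qs)
           else if qs = [] then real a ^ k *\<^sub>R p ^ k else 0)"
    and "odd a \<Longrightarrow> alt_conv \<tau> id a (p ^ k * prod_list qs) = real a ^ k *\<^sub>R (signed_rev_prod qs * p ^ k)"
proof -
  have conv: "conv F G (p ^ k * prod_list qs) = unshuffle_sum (\<lambda>r s. unshuffle_sum (\<lambda>u v.
      F (p ^ length r * prod_list u) * G (p ^ length s * prod_list v)) qs) (replicate k p)"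
    if "linear F" "linear G" "set qs \<subseteq> prim_minus" for F G :: "'a \<Rightarrow> 'a" and k qs
    using that assms by (intro conv_power_prod) (auto simp: eigenspace_def)
  have \<tau>: "\<tau> (p ^ k * prod_list qs) = signed_rev_prod qs * p ^ k" if "set qs \<subseteq> prim_minus" for k qs
    using that assms by (simp add: tau_mult tau_power tau_prod_minus)
  note * = alt_conv_powers[where f = id and g = \<tau> and Q = prim_minus and p = p
      and X = "\<lambda>k qs. p ^ k * prod_list qs" and Qf = prod_list and Qg = signed_rev_prod,
      OF linear_id linear_tau conv _ \<tau> unshuffle_sum_signed_rev_right assms(2,3)]
  show "alt_conv id \<tau> a (p ^ k * prod_list qs) = (if odd a then real a ^ k *\<^sub>R (p ^ k * prod_list qs)
           else if qs = [] then real a ^ k *\<^sub>R p ^ k else 0)"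
    by (rule *(1)) auto
  show "alt_conv \<tau> id a (p ^ k * prod_list qs) = real a ^ k *\<^sub>R (signed_rev_prod qs * p ^ k)" if "odd a"
    by (rule *(2)) (use that in auto)
qed

text \<open>With \<open>qs\<close> in front it is \<open>\<tau>\<close> that yields E on the left,
  namely E Q^-1, while the identity yields Q E. So the two maps exchange roles and the other
  cancellation rule applies.\<close>

lemma alt_conv_prod_power:
  assumes "p \<in> prim_plus" "set qs \<subseteq> prim_minus" "a > 0"
  shows "alt_conv \<tau> id a (prod_list qs * p ^ k) = (if odd a then real a ^ k *\<^sub>R (p ^ k * signed_rev_prod qs)
           else if qs = [] then real a ^ k *\<^sub>R p ^ k else 0)"
    and "odd a \<Longrightarrow> alt_conv id \<tau> a (prod_list qs * p ^ k) = real a ^ k *\<^sub>R (prod_list qs * p ^ k)"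
proof -
  have conv: "conv F G (prod_list qs * p ^ k) = unshuffle_sum (\<lambda>r s. unshuffle_sum (\<lambda>u v.
      F (prod_list u * p ^ length r) * G (prod_list v * p ^ length s)) qs) (replicate k p)"
    if "linear F" "linear G" "set qs \<subseteq> prim_minus" for F G :: "'a \<Rightarrow> 'a" and k qs
    using that assms by (intro conv_prod_power) (auto simp: eigenspace_def)
  have \<tau>: "\<tau> (prod_list qs * p ^ k) = p ^ k * signed_rev_prod qs" if "set qs \<subseteq> prim_minus" for k qs
    using that assms by (simp add: tau_mult tau_power tau_prod_minus)
  note * = alt_conv_powers[where f = \<tau> and g = id and Q = prim_minus and p = p
      and X = "\<lambda>k qs. prod_list qs * p ^ k" and Qf = signed_rev_prod and Qg = prod_list,
      OF linear_tau linear_id conv \<tau> _ unshuffle_sum_signed_rev_left assms(2,3)]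
  show "alt_conv \<tau> id a (prod_list qs * p ^ k) = (if odd a then real a ^ k *\<^sub>R (p ^ k * signed_rev_prod qs)
           else if qs = [] then real a ^ k *\<^sub>R p ^ k else 0)"
    by (rule *(1)) auto
  show "alt_conv id \<tau> a (prod_list qs * p ^ k) = real a ^ k *\<^sub>R (prod_list qs * p ^ k)" if "odd a"
    by (rule *(2)) (use that in auto)
qed

text \<open>Polarization in the form used: two linear maps need only be compared on powers of a
  single invariant primitive.\<close>

lemma linear_eq_sym_prod:
  assumes "linear F" "linear G" "set ps \<subseteq> prim_plus"
    and "\<And>p. p \<in> prim_plus \<Longrightarrow> F (p ^ length ps) = G (p ^ length ps)"
  shows "F (sym_prod ps) = G (sym_prod ps)"
  by (rule linear_eq_on_span[OF assms(1,2) _ sym_prod_in_span_powers[OF subspace_eigenspace assms(3)]])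
     (use assms(4) in auto)

lemma alt_conv_sym_prod:
  assumes "set ps \<subseteq> prim_plus" "set qs \<subseteq> prim_minus" "a > 0"
  shows "alt_conv id \<tau> a (sym_prod ps * prod_list qs) = (if odd a then real a ^ length ps *\<^sub>R (sym_prod ps * prod_list qs)
           else if qs = [] then real a ^ length ps *\<^sub>R sym_prod ps else 0)"
    and "alt_conv \<tau> id a (prod_list qs * sym_prod ps) = (if odd a then real a ^ length ps *\<^sub>R (sym_prod ps * signed_rev_prod qs)
           else if qs = [] then real a ^ length ps *\<^sub>R sym_prod ps else 0)"
    and "odd a \<Longrightarrow> alt_conv \<tau> id a (sym_prod ps * prod_list qs) = real a ^ length ps *\<^sub>R (signed_rev_prod qs * sym_prod ps)"
    and "odd a \<Longrightarrow> alt_conv id \<tau> a (prod_list qs * sym_prod ps) = real a ^ length ps *\<^sub>R (prod_list qs * sym_prod ps)"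
proof -
  note lin = linear_comp[OF linear_alt_conv[OF linear_id linear_tau assms(3)]]
    linear_comp[OF linear_alt_conv[OF linear_tau linear_id assms(3)]] linear_rules linear_zero linear_if
  show "alt_conv id \<tau> a (sym_prod ps * prod_list qs) = (if odd a then real a ^ length ps *\<^sub>R (sym_prod ps * prod_list qs)
           else if qs = [] then real a ^ length ps *\<^sub>R sym_prod ps else 0)"
    by (rule linear_eq_sym_prod[OF _ _ assms(1)], (intro lin)+, erule alt_conv_power_prod(1)[OF _ assms(2,3)])
  show "alt_conv \<tau> id a (prod_list qs * sym_prod ps) = (if odd a then real a ^ length ps *\<^sub>R (sym_prod ps * signed_rev_prod qs)
           else if qs = [] then real a ^ length ps *\<^sub>R sym_prod ps else 0)"
    by (rule linear_eq_sym_prod[OF _ _ assms(1)], (intro lin)+, erule alt_conv_prod_power(1)[OF _ assms(2,3)])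
  assume "odd a"
  show "alt_conv \<tau> id a (sym_prod ps * prod_list qs) = real a ^ length ps *\<^sub>R (signed_rev_prod qs * sym_prod ps)"
    by (rule linear_eq_sym_prod[OF _ _ assms(1)], (intro lin)+, erule alt_conv_power_prod(2)[OF _ assms(2,3) \<open>odd a\<close>])
  show "alt_conv id \<tau> a (prod_list qs * sym_prod ps) = real a ^ length ps *\<^sub>R (prod_list qs * sym_prod ps)"
    by (rule linear_eq_sym_prod[OF _ _ assms(1)], (intro lin)+, erule alt_conv_prod_power(2)[OF _ assms(2,3) \<open>odd a\<close>])
qed

lemma eigen_right_plus:
  assumes "set ps \<subseteq> prim_plus" "set qs \<subseteq> prim_minus" "a > 0"
  shows "tau_plus \<Delta> \<tau> a (vec_right (ps, qs))
       = (if odd a \<or> qs = [] then real a ^ length ps else 0) *\<^sub>R vec_right (ps, qs)"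
  using assms by (auto simp: tau_plus_eq_alt_conv alt_conv_sym_prod)

lemma eigen_left_minus:
  assumes "set ps \<subseteq> prim_plus" "set qs \<subseteq> prim_minus" "a > 0" "even a"
  shows "tau_minus \<Delta> \<tau> a (vec_left (ps, qs)) = (if qs = [] then real a ^ length ps else 0) *\<^sub>R vec_left (ps, qs)"
  using assms by (auto simp: tau_minus_eq_alt_conv alt_conv_sym_prod)

lemma eigen_left_plus:
  assumes "set ps \<subseteq> prim_plus" "set qs \<subseteq> prim_minus" "odd a"
  shows "tau_plus \<Delta> \<tau> a (vec_left (ps, qs)) = real a ^ length ps *\<^sub>R vec_left (ps, qs)"
  using assms by (auto simp: tau_plus_eq_alt_conv alt_conv_sym_prod odd_pos)

text \<open>The operator exchanges the two summands up to the common factor, since reversing twice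
  restores the word.\<close>

lemma eigen_rev_sum_minus:
  assumes "set ps \<subseteq> prim_plus" "set qs \<subseteq> prim_minus" "odd a"
  shows "tau_minus \<Delta> \<tau> a (vec_rev_sum (ps, qs)) = ((-1) ^ length qs * real a ^ length ps) *\<^sub>R vec_rev_sum (ps, qs)"
  using assms
  by (simp add: tau_minus_eq_alt_conv alt_conv_sym_prod odd_pos signed_rev_prod_def algebra_simps
      linear_add[OF linear_alt_conv[OF linear_tau linear_id]])

text \<open>If the product of \<open>qs\<close> equals its reversal, then \<open>vec_sum\<close> and
  \<open>vec_rev_sum\<close> agree.\<close>

lemma eigen_sum_minus:
  assumes "set ps \<subseteq> prim_plus" "set qs \<subseteq> prim_minus" "odd a" "prod_list (rev qs) = prod_list qs"
  shows "tau_minus \<Delta> \<tau> a (vec_sum (ps, qs)) = ((-1) ^ length qs * real a ^ length ps) *\<^sub>R vec_sum (ps, qs)"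
  using eigen_rev_sum_minus[OF assms(1-3)] assms(4) by simp

end

section \<open>Independence\<close>

lemma unshuffle_sum_length_1:
  "unshuffle_sum (\<lambda>u v. if length u = 1 then c else 0) w = real (length w) * c"
proof (induction w)
  case (Cons x w)
  have "unshuffle_sum (\<lambda>u v. if u = [] then c else 0) w = c"
    using unshuffle_sum_Nil_left[of "\<lambda>_. c" w] by simp
  then show ?case using Cons by (simp add: algebra_simps)
qed simp

lemma unshuffle_sum_nonneg:
  fixes h :: "'b list \<Rightarrow> 'b list \<Rightarrow> real"
  assumes "\<And>u v. mset u + mset v = mset w \<Longrightarrow> h u v \<ge> 0"
  shows "unshuffle_sum h w \<ge> 0"
  using assms
proof (induction w arbitrary: h)
  case (Cons x w)
  have "unshuffle_sum (\<lambda>u v. h (x # u) v) w \<ge> 0" "unshuffle_sum (\<lambda>u v. h u (x # v)) w \<ge> 0"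
    by (rule Cons.IH, rule Cons.prems, simp)+
  then show ?case by simp
qed simp

text \<open>Keeps a single term of a nonnegative sum, the splitting that takes out the first
  occurrence of \<open>x\<close>. Positivity then follows without counting repeated letters.\<close>

lemma unshuffle_sum_ge_letter:
  fixes h :: "'b list \<Rightarrow> 'b list \<Rightarrow> real"
  assumes "\<And>u v. mset u + mset v = mset w \<Longrightarrow> h u v \<ge> 0" "x \<in> set w"
  shows "h [x] (remove1 x w) \<le> unshuffle_sum h w"
proof -
  \<comment> \<open>Once the letter has been taken out, all the others go to the right.\<close>
  have Nil: "h [] w \<le> unshuffle_sum h w"
    if "\<And>u v. mset u + mset v = mset w \<Longrightarrow> h u v \<ge> 0" for h :: "'b list \<Rightarrow> 'b list \<Rightarrow> real" and w
    using that
  proof (induction w arbitrary: h)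
    case (Cons x w)
    have "h [] (x # w) \<le> unshuffle_sum (\<lambda>u v. h u (x # v)) w"
      by (rule Cons.IH, rule Cons.prems, simp)
    moreover have "unshuffle_sum (\<lambda>u v. h (x # u) v) w \<ge> 0"
      by (rule unshuffle_sum_nonneg, rule Cons.prems, simp)
    ultimately show ?case by simp
  qed simp
  show ?thesis
    using assms
  proof (induction w arbitrary: h)
    case (Cons y w)
    have pos: "unshuffle_sum (\<lambda>u v. h (y # u) v) w \<ge> 0" "unshuffle_sum (\<lambda>u v. h u (y # v)) w \<ge> 0"
      by (rule unshuffle_sum_nonneg, rule Cons.prems, simp)+
    show ?case
    proof (cases "x = y")
      case True
      have "h [y] w \<le> unshuffle_sum (\<lambda>u v. h (y # u) v) w"
        by (rule Nil, rule Cons.prems, simp)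
      then show ?thesis using pos True by simp
    next
      case False
      have "h [x] (y # remove1 x w) \<le> unshuffle_sum (\<lambda>u v. h u (y # v)) w"
        by (rule Cons.IH) (use Cons.prems False in auto)
      then show ?thesis using pos False by simp
    qed
  qed simp
qed

section \<open>Convolved functionals on products of primitives\<close>

context hopf_algebra
begin

text \<open>The empty convolution is the counit because the counit is the unit of
  convolution.\<close>

fun dual_conv :: "('a \<Rightarrow> real) list \<Rightarrow> 'a \<Rightarrow> real" where
  "dual_conv [] = \<epsilon>"
| "dual_conv (\<phi> # \<phi>s) = conv \<phi> (dual_conv \<phi>s)"

lemma linear_dual_conv: "(\<And>\<phi>. \<phi> \<in> set \<phi>s \<Longrightarrow> linear \<phi>) \<Longrightarrow> linear (dual_conv \<phi>s)"
  by (induction \<phi>s) (auto intro: linear_counit linear_conv)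

text \<open>A functional that vanishes at 1 must receive at least one letter. So n of them kill
  shorter words, and on n letters each receives exactly one, in n! ways with equal
  contributions.\<close>

lemma dual_conv_replicate:
  assumes "linear \<phi>" "\<phi> 1 = 0" "set w \<subseteq> primitives \<Delta>" "length w \<le> n"
  shows "dual_conv (replicate n \<phi>) (prod_list w) = (if length w = n then fact n * prod_list (map \<phi> w) else 0)"
  using assms(3,4)
proof (induction n arbitrary: w)
  case 0
  then show ?case by (simp add: counit_one)
next
  case (Suc n)
  have "dual_conv (replicate (Suc n) \<phi>) (prod_list w)
      = unshuffle_sum (\<lambda>u v. \<phi> (prod_list u) * dual_conv (replicate n \<phi>) (prod_list v)) w"
    using Suc.prems assms(1) by (simp, intro conv_prod_primitives linear_dual_conv) auto
  also have "\<dots> = unshuffle_sum (\<lambda>u v. if length u = 1 then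
      (if length w = Suc n then fact n * prod_list (map \<phi> w) else 0) else 0) w"
  proof (rule unshuffle_sum_cong)
    fix u v assume uv: "mset u + mset v = mset w"
    have len: "length u + length v = length w" by (metis uv size_mset size_union)
    have sub: "set v \<subseteq> primitives \<Delta>"
      using Suc.prems(1) by (metis uv le_sup_iff set_mset_mset set_mset_union)
    have prod: "prod_list (map \<phi> u) * prod_list (map \<phi> v) = prod_list (map \<phi> w)"
      by (metis uv image_mset_union mset_map prod_mset_Un prod_mset_prod_list)
    show "\<phi> (prod_list u) * dual_conv (replicate n \<phi>) (prod_list v)
        = (if length u = 1 then (if length w = Suc n then fact n * prod_list (map \<phi> w) else 0) else 0)"
    proof (cases u)
      case Nil
      then show ?thesis by (simp add: assms)
    next
      case (Cons x u')
      then have "dual_conv (replicate n \<phi>) (prod_list v) = (if length v = n then fact n * prod_list (map \<phi> v) else 0)"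
        using len Suc.prems sub by (intro Suc.IH) auto
      then show ?thesis using len Suc.prems Cons prod by (cases u') (auto simp: algebra_simps)
    qed
  qed
  finally show ?case
    using Suc.prems by (auto simp: unshuffle_sum_length_1[unfolded One_nat_def] simp del: replicate_Suc)
qed

text \<open>The permanent counts the bijections that match the letters of \<open>w\<close> with
  equal letters of \<open>w0\<close>. Its value would be a product of factorials of multiplicities;
  only its sign is recorded.\<close>

lemma dual_conv_dual_basis:
  assumes \<phi>: "\<And>b. linear (\<phi> b)" "\<And>b. b \<in> B \<Longrightarrow> \<phi> b 1 = 0"
      "\<And>b c. b \<in> B \<Longrightarrow> c \<in> B \<Longrightarrow> \<phi> b c = (if c = b then 1 else 0)"
    and B: "B \<subseteq> primitives \<Delta>" "set w0 \<subseteq> B" "set w \<subseteq> B" "length w \<le> length w0"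
  shows "mset w = mset w0 \<Longrightarrow> dual_conv (map \<phi> w0) (prod_list w) > 0"
    and "mset w \<noteq> mset w0 \<Longrightarrow> dual_conv (map \<phi> w0) (prod_list w) = 0"
proof -
  have "if mset w = mset w0 then dual_conv (map \<phi> w0) (prod_list w) > 0
        else dual_conv (map \<phi> w0) (prod_list w) = 0"
    using B(2-4)
  proof (induction w0 arbitrary: w)
    case Nil
    then show ?case by (simp add: counit_one)
  next
    case (Cons b w0)
    let ?h = "\<lambda>u v. \<phi> b (prod_list u) * dual_conv (map \<phi> w0) (prod_list v)"
    have eq: "dual_conv (map \<phi> (b # w0)) (prod_list w) = unshuffle_sum ?h w"
      using Cons.prems B(1) \<phi>(1) by (simp, intro conv_prod_primitives linear_dual_conv) auto
    \<comment> \<open>A nonzero value needs a letter in \<open>u\<close>, as \<open>\<phi> b\<close>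
      kills 1. Then \<open>v\<close> is short enough for the induction hypothesis, and if it
      rearranges \<open>w0\<close>, the length bound leaves \<open>u\<close> a single letter, which
      \<open>\<phi> b\<close> compares with \<open>b\<close>.\<close>
    have h: "if u = [b] \<and> mset v = mset w0 then ?h u v > 0 else ?h u v = 0"
      if uv: "mset u + mset v = mset w" for u v
    proof (cases u)
      case Nil
      then show ?thesis using Cons.prems \<phi>(2) by simp
    next
      case (Cons x u')
      have len: "length u + length v = length w" by (metis uv size_mset size_union)
      have sub: "set u \<subseteq> B" "set v \<subseteq> B"
        using Cons.prems(2) by (metis uv le_sup_iff set_mset_mset set_mset_union)+
      have IH: "if mset v = mset w0 then dual_conv (map \<phi> w0) (prod_list v) > 0
        else dual_conv (map \<phi> w0) (prod_list v) = 0"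
        using Cons.prems sub len Cons by (intro Cons.IH) auto
      show ?thesis
      proof (cases "mset v = mset w0")
        case True
        then have "u' = []" using len Cons.prems(3) Cons by (metis Suc_le_mono add_Suc add_le_same_cancel2 le_zero_eq length_0_conv length_Cons size_mset)
        then show ?thesis using IH True \<phi>(3)[of b x] sub Cons Cons.prems(1) by auto
      qed (use IH in auto)
    qed
    show ?case
    proof (cases "mset w = mset (b # w0)")
      case True
      then have "b \<in> set w" "mset (remove1 b w) = mset w0" by (metis list.set_intros(1) set_mset_mset, simp)
      moreover have "mset [b] + mset (remove1 b w) = mset w" using True by simp
      ultimately have "?h [b] (remove1 b w) > 0" using h by fastforce
      also have "?h [b] (remove1 b w) \<le> unshuffle_sum ?h w"
      proof (rule unshuffle_sum_ge_letter[OF _ \<open>b \<in> set w\<close>])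
        fix u v assume "mset u + mset v = mset w"
        from h[OF this] show "?h u v \<ge> 0" by (metis order_refl order_less_imp_le)
      qed
      finally show ?thesis using True eq by simp
    next
      case False
      have "unshuffle_sum ?h w = unshuffle_sum (\<lambda>u v. 0) w"
      proof (rule unshuffle_sum_cong)
        fix u v assume uv: "mset u + mset v = mset w"
        then have "\<not> (u = [b] \<and> mset v = mset w0)" using False by auto
        then show "?h u v = 0" using h[OF uv] by simp
      qed
      then show ?thesis using False eq by simp
    qed
  qed
  then show "mset w = mset w0 \<Longrightarrow> dual_conv (map \<phi> w0) (prod_list w) > 0"
    and "mset w \<noteq> mset w0 \<Longrightarrow> dual_conv (map \<phi> w0) (prod_list w) = 0"
    by simp_all
qed

lemma one_notin_primitives: "1 \<notin> primitives \<Delta>"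
  using counit_primitive[of 1] counit_one by auto

lemma independent_insert_one:
  assumes "independent B" "B \<subseteq> primitives \<Delta>"
  shows "independent (insert 1 B)"
  using assms one_notin_primitives span_minimal[OF assms(2) subspace_primitives]
  by (auto simp: independent_insert)

text \<open>The element 1 is not primitive, hence independent of \<open>B\<close>, so the
  functionals can be prescribed on \<open>B\<close> and made to vanish at 1 at the same
  time.\<close>

lemma dual_basis_exists:
  assumes "independent B" "B \<subseteq> primitives \<Delta>"
  obtains \<phi> :: "'a \<Rightarrow> 'a \<Rightarrow> real" where "\<And>b. linear (\<phi> b)" "\<And>b. b \<in> B \<Longrightarrow> \<phi> b 1 = 0"
      "\<And>b c. b \<in> B \<Longrightarrow> c \<in> B \<Longrightarrow> \<phi> b c = (if c = b then 1 else 0)"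
proof -
  have "\<exists>g. linear g \<and> (\<forall>x\<in>insert 1 B. g x = (if x = b then 1 else 0 :: real))" for b
    by (rule linear_independent_extend[OF independent_insert_one[OF assms]])
  then obtain \<phi> where \<phi>: "linear (\<phi> b) \<and> (\<forall>x\<in>insert 1 B. \<phi> b x = (if x = b then 1 else 0 :: real))" for b
    by metis
  have "1 \<notin> B" using assms(2) one_notin_primitives by auto
  then show ?thesis by (intro that[of \<phi>]) (use \<phi> in auto)
qed

text \<open>Add a multiple of a functional that is nonzero on the new vector; each vector of the
  finite set excludes at most one value of the factor.\<close>

lemma generic_functional_exists:
  assumes "finite F" "F \<subseteq> primitives \<Delta>" "0 \<notin> F"
  shows "\<exists>\<phi>. linear \<phi> \<and> \<phi> 1 = 0 \<and> (\<forall>x\<in>F. \<phi> x \<noteq> (0::real))"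
  using assms
proof (induction F rule: finite_induct)
  case empty
  then show ?case by (intro exI[of _ "\<lambda>_. 0"]) (auto simp: linear_zero)
next
  case (insert y F)
  then obtain \<phi> where \<phi>: "linear \<phi>" "\<phi> 1 = 0" "\<forall>x\<in>F. \<phi> x \<noteq> (0::real)" by auto
  have "independent {y}" "{y} \<subseteq> primitives \<Delta>" using insert.prems by (auto simp: independent_insert)
  from dual_basis_exists[OF this] obtain \<psi> where \<psi>: "\<And>b. linear (\<psi> b)" "\<And>b. b \<in> {y} \<Longrightarrow> \<psi> b 1 = 0"
    "\<And>b c. b \<in> {y} \<Longrightarrow> c \<in> {y} \<Longrightarrow> \<psi> b c = (if c = b then 1 else 0 :: real)" by blast
  \<comment> \<open>If \<open>\<psi> y x = 0\<close>, the quotient is 0 by convention and merely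
    excludes one more value; such an \<open>x\<close> keeps its nonzero value under
    \<open>\<phi>\<close>.\<close>
  obtain t where t: "t \<notin> insert (- \<phi> y) ((\<lambda>x. - \<phi> x / \<psi> y x) ` F)"
    using ex_new_if_finite[OF infinite_UNIV_char_0, of "insert (- \<phi> y) ((\<lambda>x. - \<phi> x / \<psi> y x) ` F)"]
      insert.hyps by auto
  have "linear (\<lambda>x. \<phi> x + t * \<psi> y x)"
    using \<phi>(1) \<psi>(1) by (intro linear_compose_add linear_rules)
  moreover have "\<phi> x + t * \<psi> y x \<noteq> 0" if "x \<in> F" for x
  proof
    assume z: "\<phi> x + t * \<psi> y x = 0"
    then have "\<psi> y x \<noteq> 0" using \<phi>(3) that by auto
    then have "t = - \<phi> x / \<psi> y x" using z by (simp add: field_simps)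
    then show False using t that by auto
  qed
  moreover have "\<phi> y + t * \<psi> y y \<noteq> 0" using t \<psi>(3)[of y y] by auto
  ultimately show ?case using \<phi>(2) \<psi>(2)[of y] by (intro exI[of _ "\<lambda>x. \<phi> x + t * \<psi> y x"]) auto
qed

end

section \<open>Leading terms of the vectors\<close>

text \<open>
  All four families of vectors are sums of products of one multiset of letters; everything about
  leading terms only uses this.
\<close>

definition arrangement_sum :: "'b::semiring_1 list \<Rightarrow> 'b \<Rightarrow> bool" where
  "arrangement_sum w x \<longleftrightarrow> (\<exists>L. L \<noteq> [] \<and> (\<forall>w'\<in>set L. mset w' = mset w) \<and> x = sum_list (map prod_list L))"

lemma arrangement_sum_sym_prod:
  fixes ps :: "'b::real_algebra_1 list"
  shows "arrangement_sum ps (sym_prod ps)"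
proof -
  let ?S = "{\<sigma>. \<sigma> permutes {..<length ps}}"
  obtain ss where ss: "set ss = ?S" "distinct ss"
    using finite_distinct_list[OF finite_permutations[of "{..<length ps}"]] by auto
  have "id \<in> set ss" using permutes_id[of "{..<length ps}"] unfolding ss(1) by blast
  then have "ss \<noteq> []" by auto
  moreover have "sym_prod ps = sum_list (map prod_list (map (\<lambda>\<sigma>. permute_list \<sigma> ps) ss))"
    unfolding sym_prod_def ss(1)[symmetric]
    by (simp add: sum_list_distinct_conv_sum_set[OF ss(2)] o_def permute_list_def)
  ultimately show ?thesis
    unfolding arrangement_sum_def using ss(1)
    by (intro exI[of _ "map (\<lambda>\<sigma>. permute_list \<sigma> ps) ss"]) auto
qed

text \<open>Only the multiset of letters matters, so \<open>w @ v\<close> is used although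
  \<open>v\<close> is multiplied on the left. Both orders thus share one index word.\<close>

lemma arrangement_sum_mult_left: 
  assumes "arrangement_sum w x"
  shows "arrangement_sum (w @ v) (prod_list v * x)"
proof -
  obtain L where "L \<noteq> []" "\<forall>w'\<in>set L. mset w' = mset w" "x = sum_list (map prod_list L)"
    using assms by (auto simp: arrangement_sum_def)
  then show ?thesis
    by (auto simp: arrangement_sum_def sum_list_const_mult[symmetric] o_def intro!: exI[of _ "map ((@) v) L"])
qed

lemma arrangement_sum_mult_right:
  assumes "arrangement_sum w x"
  shows "arrangement_sum (w @ v) (x * prod_list v)"
proof -
  obtain L where "L \<noteq> []" "\<forall>w'\<in>set L. mset w' = mset w" "x = sum_list (map prod_list L)"
    using assms by (auto simp: arrangement_sum_def)
  then show ?thesis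
    by (auto simp: arrangement_sum_def sum_list_mult_const[symmetric] o_def intro!: exI[of _ "map (\<lambda>w. w @ v) L"])
qed

lemma arrangement_sum_add:
  assumes "arrangement_sum w x" "arrangement_sum w y"
  shows "arrangement_sum w (x + y)"
proof -
  obtain L M where "L \<noteq> []" "\<forall>w'\<in>set L. mset w' = mset w" "x = sum_list (map prod_list L)"
     "\<forall>w'\<in>set M. mset w' = mset w" "y = sum_list (map prod_list M)"
    using assms by (auto simp: arrangement_sum_def)
  then show ?thesis
    by (auto simp: arrangement_sum_def intro!: exI[of _ "L @ M"])
qed

lemma arrangement_sum_cong: "mset w = mset w' \<Longrightarrow> arrangement_sum w = arrangement_sum w'"
  by (auto simp: arrangement_sum_def fun_eq_iff)

lemma arrangement_sum_vec:
  fixes v :: "'b::real_algebra_1 list \<times> 'b list \<Rightarrow> 'b"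
  assumes "v \<in> {vec_right, vec_left, vec_sum, vec_rev_sum}"
  shows "arrangement_sum (ps @ qs) (v (ps, qs))"
proof -
  have r: "arrangement_sum (ps @ qs) (sym_prod ps * prod_list qs)"
    and l: "arrangement_sum (ps @ qs) (prod_list qs * sym_prod ps)"
    by (rule arrangement_sum_mult_left arrangement_sum_mult_right, rule arrangement_sum_sym_prod)+
  have "arrangement_sum (ps @ rev qs) (sym_prod ps * prod_list (rev qs))"
    by (rule arrangement_sum_mult_right, rule arrangement_sum_sym_prod)
  then have "arrangement_sum (ps @ qs) (sym_prod ps * prod_list (rev qs))"
    using arrangement_sum_cong[of "ps @ rev qs" "ps @ qs"] by simp
  then show ?thesis using assms r l by (auto intro: arrangement_sum_add)
qed

context hopf_algebra
begin

text \<open>A convolution power of one generic functional does not see the order of letters, so all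
  arrangements take the same nonzero value and the sum is a positive multiple of it.\<close>

lemma arrangement_sum_nonzero:
  assumes "arrangement_sum w x" "set w \<subseteq> primitives \<Delta>" "0 \<notin> set w"
  shows "x \<noteq> 0"
proof
  obtain L where L: "L \<noteq> []" "\<forall>w'\<in>set L. mset w' = mset w" "x = sum_list (map prod_list L)"
    using assms(1) by (auto simp: arrangement_sum_def)
  obtain \<phi> where \<phi>: "linear \<phi>" "\<phi> 1 = 0" "\<forall>x\<in>set w. \<phi> x \<noteq> (0::real)"
    using generic_functional_exists[OF _ assms(2,3)] by auto
  let ?\<Phi> = "dual_conv (replicate (length w) \<phi>)"
  have lin: "linear ?\<Phi>" by (rule linear_dual_conv) (use \<phi>(1) in auto)
  have val: "?\<Phi> (prod_list w') = fact (length w) * prod_list (map \<phi> w)" if "w' \<in> set L" for w'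
  proof -
    have m: "mset w' = mset w" using L(2) that by auto
    then have "prod_list (map \<phi> w') = prod_list (map \<phi> w)" by (metis mset_map prod_mset_prod_list)
    moreover have "length w' = length w" "set w' = set w" using m by (metis size_mset, metis set_mset_mset)
    ultimately show ?thesis using dual_conv_replicate[OF \<phi>(1,2), of w'] assms(2) by simp
  qed
  have "?\<Phi> (sum_list (map prod_list M)) = real (length M) * (fact (length w) * prod_list (map \<phi> w))"
    if "set M \<subseteq> set L" for M
    using that
    by (induction M) (auto simp: linear_0[OF lin] linear_add[OF lin] val algebra_simps)
  moreover have "prod_list (map \<phi> w) \<noteq> 0" using \<phi>(3) by (induction w) auto
  moreover assume "x = 0"
  ultimately show False using L(1,3) linear_0[OF lin] by (metis fact_nonzero length_0_conv mult_eq_0_iff of_nat_eq_0_iff order_refl)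
qed

text \<open>Here the sign of the permanents is what counts: positive values of the arrangements add
  up to a positive value.\<close>

lemma arrangement_sum_dual_conv:
  assumes \<phi>: "\<And>b. linear (\<phi> b)" "\<And>b. b \<in> B \<Longrightarrow> \<phi> b 1 = 0"
      "\<And>b c. b \<in> B \<Longrightarrow> c \<in> B \<Longrightarrow> \<phi> b c = (if c = b then 1 else 0)"
    and B: "B \<subseteq> primitives \<Delta>" "set w0 \<subseteq> B" "set w \<subseteq> B" "length w \<le> length w0"
    and x: "arrangement_sum w x"
  shows "mset w = mset w0 \<Longrightarrow> dual_conv (map \<phi> w0) x > 0"
    and "mset w \<noteq> mset w0 \<Longrightarrow> dual_conv (map \<phi> w0) x = 0"
proof -
  let ?\<Phi> = "dual_conv (map \<phi> w0)"
  have lin: "linear ?\<Phi>" by (rule linear_dual_conv) (use \<phi>(1) in auto)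
  obtain L where L: "L \<noteq> []" "\<forall>w'\<in>set L. mset w' = mset w" "x = sum_list (map prod_list L)"
    using x by (auto simp: arrangement_sum_def)
  have \<Phi>x: "?\<Phi> x = sum_list (map (\<lambda>w. ?\<Phi> (prod_list w)) L)"
    unfolding L(3) by (induction L) (auto simp: linear_0[OF lin] linear_add[OF lin])
  have L': "set w' \<subseteq> B" "length w' \<le> length w0" "mset w' = mset w" if "w' \<in> set L" for w'
    using L(2) that B by (metis set_mset_mset, metis size_mset, auto)
  note val = dual_conv_dual_basis[where \<phi> = \<phi> and B = B, OF \<phi> B(1,2) L'(1,2)]
  show "?\<Phi> x > 0" if m: "mset w = mset w0"
  proof -
    have "?\<Phi> (prod_list w') > 0" if "w' \<in> set L" for w' using val(1)[OF _ _ _ that that] L'(3)[OF that] m by simp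
    then show ?thesis unfolding \<Phi>x using L(1)
    proof (induction L)
      case (Cons w' L)
      then show ?case by (cases L) (auto simp: add_pos_pos)
    qed simp
  qed
  show "?\<Phi> x = 0" if m: "mset w \<noteq> mset w0"
  proof -
    have "?\<Phi> (prod_list w') = 0" if "w' \<in> set L" for w' using val(2)[OF _ _ _ that that] L'(3)[OF that] m by simp
    then show ?thesis unfolding \<Phi>x by (induction L) auto
  qed
qed

end

text \<open>Apply \<open>F i\<close> to a vanishing combination, with \<open>d i\<close> maximal
  among the indices that occur: all other terms die. Injectivity follows by using the functional of
  the larger of two indices.\<close>

lemma independent_family_triangular:
  fixes v :: "'i \<Rightarrow> 'a::real_vector"
  assumes lin: "\<And>i. i \<in> I \<Longrightarrow> linear (F i)"
    and diag: "\<And>i. i \<in> I \<Longrightarrow> F i (v i) \<noteq> (0::real)"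
    and off: "\<And>i j. i \<in> I \<Longrightarrow> j \<in> I \<Longrightarrow> i \<noteq> j \<Longrightarrow> (d j :: nat) \<le> d i \<Longrightarrow> F i (v j) = 0"
  shows "independent_family v I"
proof -
  have inj: "inj_on v I"
  proof (rule inj_onI, rule ccontr)
    fix i j assume ij: "i \<in> I" "j \<in> I" "v i = v j" "i \<noteq> j"
    show False
    proof (cases "d i \<le> d j")
      case True
      then show ?thesis using off[of j i] diag[of j] ij by simp
    next
      case False
      then show ?thesis using off[of i j] diag[of i] ij by simp
    qed
  qed
  moreover have "independent (v ` I)"
  proof
    assume "dependent (v ` I)"
    then obtain X where X: "finite {x. X x \<noteq> 0}" "{x. X x \<noteq> 0} \<subseteq> v ` I"
      "(\<Sum>x | X x \<noteq> 0. X x *\<^sub>R x) = 0" "\<exists>x. X x \<noteq> 0"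
      unfolding dependent_alt by blast
    define T where "T = {i \<in> I. X (v i) \<noteq> 0}"
    have T: "v ` T = {x. X x \<noteq> 0}" "inj_on v T"
      using X(2) inj by (auto simp: T_def inj_on_def)
    have fin: "finite T" using T X(1) by (metis finite_imageD)
    have "T \<noteq> {}" using T(1) X(4) by auto
    then have "Max (d ` T) \<in> d ` T" using fin by simp
    then obtain i where i: "i \<in> T" "d i = Max (d ` T)" by auto
    have le: "d j \<le> d i" if "j \<in> T" for j using fin that i(2) by simp
    have lini: "linear (F i)" using lin i(1) by (simp add: T_def)
    have "F i (\<Sum>x | X x \<noteq> 0. X x *\<^sub>R x) = (\<Sum>j\<in>T. X (v j) * F i (v j))"
      unfolding T(1)[symmetric] by (simp add: sum.reindex[OF T(2)] linear_sum[OF lini] linear_scale[OF lini])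
    also have "\<dots> = (\<Sum>j\<in>T. if j = i then X (v i) * F i (v i) else 0)"
      using i(1) le off by (intro sum.cong refl) (auto simp: T_def)
    also have "\<dots> = X (v i) * F i (v i)" using fin i(1) by simp
    finally show False using X(3) i(1) diag[of i] linear_0[OF lini] by (auto simp: T_def)
  qed
  ultimately show ?thesis by (simp add: independent_family_def)
qed

lemma sorted_wrt_mset_unique:
  assumes "antisym r" "mset xs = mset ys"
    and "sorted_wrt (\<lambda>x y. (x, y) \<in> r) xs" "sorted_wrt (\<lambda>x y. (x, y) \<in> r) ys"
  shows "xs = ys"
  using assms(2-4)
proof (induction xs arbitrary: ys)
  case (Cons x xs)
  then obtain y ys' where ys: "ys = y # ys'" by (cases ys) auto
  have "x = y"
  proof (rule ccontr)
    assume "x \<noteq> y"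
    have "y \<in> set (x # xs)" "x \<in> set ys"
      using Cons.prems(1) ys by (metis list.set_intros(1) set_mset_mset)+
    then have "y \<in> set xs" "x \<in> set ys'" using \<open>x \<noteq> y\<close> ys by auto
    then have "(x, y) \<in> r" "(y, x) \<in> r" using Cons.prems ys by auto
    then show False using assms(1) \<open>x \<noteq> y\<close> by (auto dest: antisymD)
  qed
  then show ?case using Cons ys by auto
qed simp

text \<open>Insertion sort for an order given as a relation; totality on \<open>P\<close> puts the
  remaining letters after \<open>x\<close>.\<close>

lemma sorted_wrt_arrangement_exists:
  assumes "linear_order_on P r" "set xs \<subseteq> P"
  shows "\<exists>ys. mset ys = mset xs \<and> sorted_wrt (\<lambda>x y. (x, y) \<in> r) ys"
  using assms(2)
proof (induction xs)
  case (Cons x xs)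
  then obtain ys where ys: "mset ys = mset xs" "sorted_wrt (\<lambda>x y. (x, y) \<in> r) ys" by auto
  have sub: "set ys \<subseteq> P" "x \<in> P" using Cons.prems ys(1) by (metis set_mset_mset set_subset_Cons subset_trans, simp)
  let ?l = "filter (\<lambda>y. (y, x) \<in> r) ys" and ?g = "filter (\<lambda>y. (y, x) \<notin> r) ys"
  have xy: "(x, y) \<in> r" if "y \<in> set ys" "(y, x) \<notin> r" for y
    using assms(1) sub that
    by (cases "x = y") (auto simp: linear_order_on_def partial_order_on_def preorder_on_def total_on_def refl_on_def)
  have "trans r" using assms(1) by (auto simp: linear_order_on_def partial_order_on_def preorder_on_def)
  then have "sorted_wrt (\<lambda>x y. (x, y) \<in> r) (?l @ x # ?g)"
    using ys(2) xy by (auto simp: sorted_wrt_append sorted_wrt_filter dest: transD)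
  moreover have "mset (?l @ x # ?g) = mset (x # xs)"
    using ys(1) by (simp add: mset_filter multiset_partition[symmetric])
  ultimately show ?case by blast
qed simp

lemma disjoint_if_trivial_intersection:
  fixes A B :: "'a::real_vector set"
  assumes "independent A" "span A \<inter> span B \<subseteq> {0}"
  shows "A \<inter> B = {}"
proof (rule ccontr)
  assume "A \<inter> B \<noteq> {}"
  then obtain x where x: "x \<in> A" "x \<in> B" by auto
  then have "x = 0" using assms(2) span_base[of x A] span_base[of x B] by auto
  then show False using x(1) assms(1) dependent_zero by auto
qed

lemma independent_Un_if_trivial_intersection:
  fixes A B :: "'a::real_vector set"
  assumes "independent A" "independent B" "span A \<inter> span B \<subseteq> {0}"
  shows "independent (A \<union> B)"
  unfolding independent_explicit_module
proof (intro allI impI)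
  fix t u x
  assume t: "finite t" "t \<subseteq> A \<union> B" "(\<Sum>v\<in>t. u v *\<^sub>R v) = 0" "x \<in> t"
  have "A \<inter> B = {}" by (rule disjoint_if_trivial_intersection[OF assms(1,3)])
  let ?a = "\<Sum>v\<in>t \<inter> A. u v *\<^sub>R v" and ?b = "\<Sum>v\<in>t \<inter> B. u v *\<^sub>R v"
  have "t = (t \<inter> A) \<union> (t \<inter> B)" using t(2) by auto
  moreover have "t \<inter> A \<inter> (t \<inter> B) = {}" using \<open>A \<inter> B = {}\<close> by auto
  ultimately have "?a + ?b = (\<Sum>v\<in>t. u v *\<^sub>R v)"
    using t(1) sum.union_disjoint[of "t \<inter> A" "t \<inter> B" "\<lambda>v. u v *\<^sub>R v"] by auto
  then have ab: "?a = - ?b" using t(3) by (simp add: eq_neg_iff_add_eq_0)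
  have "?a \<in> span A" "?b \<in> span B" by (intro span_sum span_scale; simp add: span_base)+
  then have "?a = 0" using ab assms(3) by (metis IntI singletonD span_neg subsetD)
  then have "?b = 0" using ab by simp
  then show "u x = 0"
    using \<open>?a = 0\<close> t independentD[OF assms(1), of "t \<inter> A" u x] independentD[OF assms(2), of "t \<inter> B" u x]
    by auto
qed

section \<open>Independence of the families\<close>

context hopf_antiinvolution
begin

lemma independent_bases_Un:
  assumes "is_basis P prim_plus" "is_basis Q prim_minus"
  shows "independent (P \<union> Q)" "P \<inter> Q = {}" "P \<subseteq> prim_plus" "Q \<subseteq> prim_minus" "P \<union> Q \<subseteq> primitives \<Delta>"
proof -
  have triv: "span P \<inter> span Q \<subseteq> {0}"
  proof
    fix x assume "x \<in> span P \<inter> span Q"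
    then have "x = - x" using assms by (auto simp: is_basis_def eigenspace_def)
    then have "x + x = 0" by (metis add.right_inverse)
    then have "2 *\<^sub>R x = 0" by (simp add: scaleR_2)
    then show "x \<in> {0}" by simp
  qed
  then show "independent (P \<union> Q)"
    using assms by (intro independent_Un_if_trivial_intersection) (auto simp: is_basis_def)
  show "P \<inter> Q = {}"
    using assms triv by (intro disjoint_if_trivial_intersection) (auto simp: is_basis_def)
  show "P \<subseteq> prim_plus" "Q \<subseteq> prim_minus"
    using assms span_superset by (auto simp: is_basis_def)
  then show "P \<union> Q \<subseteq> primitives \<Delta>" by (auto simp: eigenspace_def)
qed

lemma vec_nonzero:
  assumes "set ps \<subseteq> prim_plus" "set qs \<subseteq> prim_minus" "0 \<notin> set ps \<union> set qs"
    and "v \<in> {vec_right, vec_left, vec_sum, vec_rev_sum}"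
  shows "v (ps, qs) \<noteq> 0"
  by (rule arrangement_sum_nonzero[OF arrangement_sum_vec[OF assms(4)]])
     (use assms(1-3) in \<open>auto simp: eigenspace_def\<close>)

text \<open>Disjointness of the two bases separates the letters of \<open>ps\<close> from those of
  \<open>qs\<close>, and sortedness recovers their order.\<close>

lemma ordered_pairs_mset_inj:
  assumes "P \<inter> Q = {}" "linear_order_on P r" "linear_order_on Q s"
    and "(ps, qs) \<in> ordered_pairs P r Q s" "(ps', qs') \<in> ordered_pairs P r Q s"
    and "mset (ps @ qs) = mset (ps' @ qs')"
  shows "ps = ps' \<and> qs = qs'"
proof -
  have anti: "antisym r" "antisym s"
    using assms(2,3) by (auto simp: linear_order_on_def partial_order_on_def)
  have P: "filter_mset (\<lambda>x. x \<in> P) (mset (ps @ qs)) = mset ps"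
    and Q: "filter_mset (\<lambda>x. x \<notin> P) (mset (ps @ qs)) = mset qs"
    if "(ps, qs) \<in> ordered_pairs P r Q s" for ps qs
  proof -
    have "filter (\<lambda>x. x \<in> P) ps = ps" "filter (\<lambda>x. x \<in> P) qs = []"
      "filter (\<lambda>x. x \<notin> P) ps = []" "filter (\<lambda>x. x \<notin> P) qs = qs"
      using that assms(1) by (auto simp: ordered_pairs_def filter_empty_conv filter_id_conv)
    then show "filter_mset (\<lambda>x. x \<in> P) (mset (ps @ qs)) = mset ps"
      "filter_mset (\<lambda>x. x \<notin> P) (mset (ps @ qs)) = mset qs"
      by (metis filter_append append_Nil2 append_Nil mset_filter)+
  qed
  have "mset ps = mset ps'" "mset qs = mset qs'"
    using P[OF assms(4)] P[OF assms(5)] Q[OF assms(4)] Q[OF assms(5)] assms(6) by metis+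
  then show ?thesis
    using assms(4,5) anti by (auto simp: ordered_pairs_def intro: sorted_wrt_mset_unique)
qed

text \<open>Triangular with respect to the number of letters: the functional of a pair convolves the
  dual basis vectors of its letters.\<close>

lemma independent_family_vec:
  assumes "is_basis P prim_plus" "linear_order_on P r" "is_basis Q prim_minus" "linear_order_on Q s"
    and v: "v \<in> {vec_right, vec_left, vec_sum, vec_rev_sum}"
  shows "independent_family v (ordered_pairs P r Q s)"
proof -
  note PQ = independent_bases_Un[OF assms(1,3)]
  obtain \<phi> :: "'a \<Rightarrow> 'a \<Rightarrow> real" where \<phi>: "\<And>b. linear (\<phi> b)" "\<And>b. b \<in> P \<union> Q \<Longrightarrow> \<phi> b 1 = 0"
      "\<And>b c. b \<in> P \<union> Q \<Longrightarrow> c \<in> P \<union> Q \<Longrightarrow> \<phi> b c = (if c = b then 1 else 0)"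
    using dual_basis_exists[OF PQ(1,5)] by blast
  let ?w = "\<lambda>(ps, qs). ps @ qs :: 'a list"
  have sub: "set (?w i) \<subseteq> P \<union> Q" if "i \<in> ordered_pairs P r Q s" for i
    using that by (auto simp: ordered_pairs_def)
  have arr: "arrangement_sum (?w i) (v i)" for i
    using arrangement_sum_vec[OF v] by (cases i) auto
  note val = arrangement_sum_dual_conv[OF \<phi> PQ(5) sub sub _ arr]
  show ?thesis
  proof (rule independent_family_triangular)
    fix i assume "i \<in> ordered_pairs P r Q s"
    show "linear (dual_conv (map \<phi> (?w i)))" by (rule linear_dual_conv) (use \<phi>(1) in auto)
    show "dual_conv (map \<phi> (?w i)) (v i) \<noteq> 0"
      using val(1)[of i i] \<open>i \<in> _\<close> by simp
  next
    fix i j assume ij: "i \<in> ordered_pairs P r Q s" "j \<in> ordered_pairs P r Q s" "i \<noteq> j" "length (?w j) \<le> length (?w i)"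
    then have "mset (?w j) \<noteq> mset (?w i)"
      using ordered_pairs_mset_inj[OF PQ(2) assms(2,4)] by (cases i, cases j) (metis case_prod_conv)
    then show "dual_conv (map \<phi> (?w i)) (v j) = 0" using val(2)[of i j] ij by simp
  qed
qed

end

section \<open>Spanning\<close>

lemma span_mult:
  fixes x y :: "'a::real_algebra"
  assumes "x \<in> span A" "y \<in> span B"
  shows "x * y \<in> span {a * b | a b. a \<in> A \<and> b \<in> B}"
proof -
  have "a * y \<in> span {a * b | a b. a \<in> A \<and> b \<in> B}" if "a \<in> A" for a
  proof -
    have "(\<lambda>y. a * y) ` span B \<subseteq> span {a * b | a b. a \<in> A \<and> b \<in> B}"
      unfolding linear_span_image[OF linear_mult_right[OF linear_ident], symmetric]
      by (rule span_mono) (use that in auto)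
    then show ?thesis using assms(2) by auto
  qed
  then have "(\<lambda>x. x * y) ` span A \<subseteq> span {a * b | a b. a \<in> A \<and> b \<in> B}"
    unfolding linear_span_image[OF linear_mult_left[OF linear_ident], symmetric]
    by (intro span_minimal) auto
  then show ?thesis using assms(1) by auto
qed

definition word_span :: "'a::real_algebra_1 set \<Rightarrow> nat \<Rightarrow> 'a set" where
  "word_span B n = span {prod_list w | w. set w \<subseteq> B \<and> length w \<le> n}"

lemma word_span_mult:
  assumes "x \<in> word_span B m" "y \<in> word_span B n"
  shows "x * y \<in> word_span B (m + n)"
proof -
  have "span {a * b | a b. a \<in> {prod_list w | w. set w \<subseteq> B \<and> length w \<le> m}
      \<and> b \<in> {prod_list w | w. set w \<subseteq> B \<and> length w \<le> n}} \<subseteq> word_span B (m + n)"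
    unfolding word_span_def
  proof (intro span_mono subsetI)
    fix x assume "x \<in> {a * b | a b. a \<in> {prod_list w | w. set w \<subseteq> B \<and> length w \<le> m}
      \<and> b \<in> {prod_list w | w. set w \<subseteq> B \<and> length w \<le> n}}"
    then obtain u v where "x = prod_list u * prod_list v" "set u \<subseteq> B" "length u \<le> m" "set v \<subseteq> B" "length v \<le> n"
      by auto
    then show "x \<in> {prod_list w | w. set w \<subseteq> B \<and> length w \<le> m + n}"
      by (intro CollectI exI[of _ "u @ v"]) auto
  qed
  then show ?thesis using span_mult assms unfolding word_span_def by blast
qed

lemma word_span_prod: "set w \<subseteq> B \<Longrightarrow> length w \<le> n \<Longrightarrow> prod_list w \<in> word_span B n"
  unfolding word_span_def by (rule span_base) auto

text \<open>Expanding the letters of a word multilinearly keeps their number, so arbitrary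
  primitives may be replaced by basis elements within the same step of the filtration.\<close>

lemma word_span_span: "word_span (span B) n \<subseteq> word_span B n"
proof -
  have "prod_list w \<in> word_span B (length w)" if "set w \<subseteq> span B" for w
    using that
  proof (induction w)
    case Nil
    show ?case by (rule word_span_prod) auto
  next
    case (Cons x w)
    have "span B \<subseteq> word_span B 1"
      unfolding word_span_def
      by (rule span_mono) (force intro: exI[of _ "[b]" for b])
    then show ?case using Cons word_span_mult[of x B 1 "prod_list w" "length w"] by auto
  qed
  moreover have "word_span B m \<subseteq> word_span B n" if "m \<le> n" for m
    unfolding word_span_def by (rule span_mono) (use that in auto)
  ultimately show ?thesis
    unfolding word_span_def[of "span B"] by (intro span_minimal) (auto simp: word_span_def)
qed

context hopf_algebra
begin

text \<open>The commutator is again a single primitive letter, so the difference is a word with one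
  letter less.\<close>

lemma swap_adjacent_letters:
  assumes "set (u @ [x, y] @ v) \<subseteq> primitives \<Delta>" "length (u @ v) < n"
  shows "prod_list (u @ [x, y] @ v) - prod_list (u @ [y, x] @ v) \<in> word_span (primitives \<Delta>) n"
proof -
  have "prod_list (u @ [x, y] @ v) - prod_list (u @ [y, x] @ v) = prod_list (u @ [x * y - y * x] @ v)"
    by (simp add: algebra_simps)
  also have "\<dots> \<in> word_span (primitives \<Delta>) n"
    by (rule word_span_prod) (use assms commutator_primitive in auto)
  finally show ?thesis .
qed

lemma move_letter_to_front:
  assumes "set (u @ [x] @ v) \<subseteq> primitives \<Delta>" "length (u @ v) \<le> n"
  shows "prod_list (u @ [x] @ v) - prod_list ([x] @ u @ v) \<in> word_span (primitives \<Delta>) n"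
  using assms
proof (induction u arbitrary: v rule: rev_induct)
  case Nil
  then show ?case by (simp add: word_span_def span_zero)
next
  case (snoc y u)
  have "prod_list (u @ [y, x] @ v) - prod_list (u @ [x, y] @ v) \<in> word_span (primitives \<Delta>) n"
    by (rule swap_adjacent_letters) (use snoc.prems in auto)
  moreover have "prod_list (u @ [x] @ (y # v)) - prod_list ([x] @ u @ (y # v)) \<in> word_span (primitives \<Delta>) n"
    by (rule snoc.IH) (use snoc.prems in auto)
  ultimately have "(prod_list (u @ [y, x] @ v) - prod_list (u @ [x, y] @ v))
      + (prod_list (u @ [x] @ (y # v)) - prod_list ([x] @ u @ (y # v))) \<in> word_span (primitives \<Delta>) n"
    unfolding word_span_def by (rule span_add)
  then show ?case by simp
qed

text \<open>Bring the first letter of \<open>w\<close> to the front of \<open>w'\<close> and compare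
  the tails inductively.\<close>

lemma rearrange_letters:
  assumes "mset w = mset w'" "set w \<subseteq> primitives \<Delta>" "length w \<le> Suc n"
  shows "prod_list w - prod_list w' \<in> word_span (primitives \<Delta>) n"
  using assms
proof (induction w arbitrary: w' n)
  case Nil
  then show ?case by (simp add: word_span_def span_zero)
next
  case (Cons x w)
  have "x \<in> set w'" using Cons.prems(1) by (metis list.set_intros(1) set_mset_mset)
  then obtain u v where w': "w' = u @ [x] @ v" by (metis append_Cons append_Nil split_list)
  have m: "mset w = mset (u @ v)" using Cons.prems(1) w' by simp
  have set': "set w' \<subseteq> primitives \<Delta>" using Cons.prems(1,2) by (metis set_mset_mset)
  have len': "length w' \<le> Suc n" using Cons.prems(1,3) by (metis size_mset)
  have 1: "prod_list ([x] @ u @ v) - prod_list w' \<in> word_span (primitives \<Delta>) n"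
    using move_letter_to_front[of u x v n] set' len' w' span_neg[of "prod_list (u @ [x] @ v) - prod_list ([x] @ u @ v)"]
    by (auto simp: word_span_def)
  have 2: "x * (prod_list w - prod_list (u @ v)) \<in> word_span (primitives \<Delta>) n"
  \<comment> \<open>For \<open>n = 0\<close> both tails are empty; otherwise they are compared one
    step lower in the filtration, and the factor \<open>x\<close> makes up for that step.\<close>
  proof (cases n)
    case 0
    then have "w = []" using Cons.prems by simp
    then show ?thesis using m by (simp add: word_span_def span_zero)
  next
    case (Suc k)
    have "prod_list w - prod_list (u @ v) \<in> word_span (primitives \<Delta>) k"
      by (rule Cons.IH[OF m]) (use Cons.prems Suc in auto)
    moreover have "prod_list [x] \<in> word_span (primitives \<Delta>) 1"
      by (rule word_span_prod) (use Cons.prems in auto)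
    ultimately show ?thesis using word_span_mult[of "prod_list [x]" _ 1 _ k] Suc by simp
  qed
  have "prod_list (x # w) - prod_list w' = x * (prod_list w - prod_list (u @ v)) + (prod_list ([x] @ u @ v) - prod_list w')"
    by (simp add: algebra_simps)
  also have "\<dots> \<in> word_span (primitives \<Delta>) n" using 2 1 unfolding word_span_def by (rule span_add)
  finally show ?case .
qed

end

context hopf_antiinvolution
begin

text \<open>The coproduct of a primitive element is symmetric, so the morphism and the antimorphism
  case give the same formula.\<close>

lemma tau_primitive: "x \<in> primitives \<Delta> \<Longrightarrow> \<tau> x \<in> primitives \<Delta>"
proof -
  assume x: "x \<in> primitives \<Delta>"
  have lin: "linear (tmap [\<tau>, \<tau>])" by (rule linear_tmap) (use linear_tau in auto)
  have t: "tmap [\<tau>, \<tau>] (tens [y, z]) = tens [\<tau> y, \<tau> z]" for y z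
    using tmap_tens[of "[\<tau>, \<tau>]" "[y, z]"] linear_tau by simp
  have "linear (tswap :: 'a tensor \<Rightarrow> _)"
    unfolding tswap_def by (intro linear_tlift2' bilinI linear_rules)
  then show ?thesis
    using comorphism x
    by (auto simp: primitives_def coalgebra_morphism_def coalgebra_antimorphism_def
        linear_add[OF lin] linear_add t tswap_tens tau_one)
qed

lemma primitives_subset_span:
  assumes "is_basis P prim_plus" "is_basis Q prim_minus"
  shows "primitives \<Delta> \<subseteq> span (P \<union> Q)"
proof
  fix x assume x: "x \<in> primitives \<Delta>"
  note sub = subspace_primitives
  have "(1/2) *\<^sub>R (x + \<tau> x) \<in> prim_plus"
    using x tau_primitive[OF x] sub
    by (auto simp: eigenspace_def subspace_scale subspace_add linear_add[OF linear_tau]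
        linear_scale[OF linear_tau] tau_tau add.commute)
  moreover have "(1/2) *\<^sub>R (x - \<tau> x) \<in> prim_minus"
    using x tau_primitive[OF x] sub
    by (auto simp: eigenspace_def subspace_scale subspace_diff linear_diff[OF linear_tau]
        linear_scale[OF linear_tau] tau_tau algebra_simps)
  ultimately have "(1/2) *\<^sub>R (x + \<tau> x) + (1/2) *\<^sub>R (x - \<tau> x) \<in> span (P \<union> Q)"
    using assms by (auto simp: is_basis_def span_Un)
  moreover have "(1/2) *\<^sub>R (x + \<tau> x) + (1/2) *\<^sub>R (x - \<tau> x) = x"
    by (simp add: scaleR_add_right[symmetric] scaleR_2[symmetric])
  ultimately show "x \<in> span (P \<union> Q)" by simp
qed

lemma ordered_pair_exists:
  assumes "linear_order_on P r" "linear_order_on Q s" "set w \<subseteq> P \<union> Q"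
  shows "\<exists>ps qs. (ps, qs) \<in> ordered_pairs P r Q s \<and> mset (ps @ qs) = mset w"
proof -
  obtain ps where ps: "mset ps = mset (filter (\<lambda>x. x \<in> P) w)" "sorted_wrt (\<lambda>x y. (x, y) \<in> r) ps"
    using sorted_wrt_arrangement_exists[OF assms(1), of "filter (\<lambda>x. x \<in> P) w"] by auto
  have "set (filter (\<lambda>x. x \<notin> P) w) \<subseteq> Q" using assms(3) by auto
  then obtain qs where qs: "mset qs = mset (filter (\<lambda>x. x \<notin> P) w)" "sorted_wrt (\<lambda>x y. (x, y) \<in> s) qs"
    using sorted_wrt_arrangement_exists[OF assms(2)] by blast
  have "set ps \<subseteq> P" "set qs \<subseteq> Q"
    using assms(3) mset_eq_setD[OF ps(1)] mset_eq_setD[OF qs(1)] by auto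
  moreover have "mset (ps @ qs) = mset w"
    using ps(1) qs(1) by (simp add: mset_filter multiset_partition[symmetric])
  ultimately show ?thesis using ps(2) qs(2) by (auto simp: ordered_pairs_def)
qed

text \<open>A vector with the letters of \<open>w\<close> is a sum of rearrangements of
  \<open>w\<close>, hence a positive integer multiple of \<open>w\<close> modulo shorter words,
  which are covered by induction.\<close>

lemma word_span_subset_span_vec:
  assumes "is_basis P prim_plus" "linear_order_on P r" "is_basis Q prim_minus" "linear_order_on Q s"
    and v: "v \<in> {vec_right, vec_left, vec_sum, vec_rev_sum}"
  shows "word_span (primitives \<Delta>) n \<subseteq> span (v ` ordered_pairs P r Q s)"
proof (induction n)
  \<comment> \<open>The vectors have letters in the chosen bases, so arbitrary primitives are
    expanded first, keeping the length.\<close>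
  have reduce: "word_span (primitives \<Delta>) n \<subseteq> word_span (P \<union> Q) n" for n
  proof -
    have "word_span (primitives \<Delta>) n \<subseteq> word_span (span (P \<union> Q)) n"
      unfolding word_span_def using primitives_subset_span[OF assms(1,3)] by (intro span_mono) auto
    then show ?thesis using word_span_span by blast
  qed
  note PQ = independent_bases_Un[OF assms(1,3)]
  have leading: "prod_list w \<in> span (v ` ordered_pairs P r Q s)"
    if w: "set w \<subseteq> P \<union> Q" and rearrange: "\<And>w'. mset w' = mset w \<Longrightarrow> prod_list w' - prod_list w \<in> span (v ` ordered_pairs P r Q s)"
    for w
  proof -
    obtain ps qs where i: "(ps, qs) \<in> ordered_pairs P r Q s" "mset (ps @ qs) = mset w"
      using ordered_pair_exists[OF assms(2,4) w] by blast
    obtain L where L: "L \<noteq> []" "\<forall>w'\<in>set L. mset w' = mset w" "v (ps, qs) = sum_list (map prod_list L)"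
      using arrangement_sum_vec[OF v, of ps qs] i(2) by (auto simp: arrangement_sum_def)
    have "sum_list (map prod_list M) - real (length M) *\<^sub>R prod_list w \<in> span (v ` ordered_pairs P r Q s)"
      if "set M \<subseteq> set L" for M
      using that
    proof (induction M)
      case (Cons w' M)
      have "(prod_list w' - prod_list w) + (sum_list (map prod_list M) - real (length M) *\<^sub>R prod_list w)
          \<in> span (v ` ordered_pairs P r Q s)"
        using Cons L(2) by (intro span_add rearrange) auto
      then show ?case by (simp add: algebra_simps)
    qed (simp add: span_zero)
    from this[of L] have "v (ps, qs) - real (length L) *\<^sub>R prod_list w \<in> span (v ` ordered_pairs P r Q s)"
      by (simp add: L(3))
    moreover have "v (ps, qs) \<in> span (v ` ordered_pairs P r Q s)" using i(1) by (intro span_base) auto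
    ultimately have "real (length L) *\<^sub>R prod_list w \<in> span (v ` ordered_pairs P r Q s)"
      using span_diff[of "v (ps, qs)" _ "v (ps, qs) - real (length L) *\<^sub>R prod_list w"] by simp
    then have "(1 / real (length L)) *\<^sub>R (real (length L) *\<^sub>R prod_list w) \<in> span (v ` ordered_pairs P r Q s)"
      by (rule span_scale)
    then show ?thesis using L(1) by simp
  qed
  {
    case 0
    have "prod_list w \<in> span (v ` ordered_pairs P r Q s)" if "length w \<le> 0" for w
      by (rule leading) (use that in \<open>auto simp: span_zero\<close>)
    then show ?case unfolding word_span_def by (intro span_minimal) auto
  next
    case (Suc n)
    have "prod_list w \<in> span (v ` ordered_pairs P r Q s)" if "set w \<subseteq> P \<union> Q" "length w \<le> Suc n" for w
    proof (rule leading[OF that(1)])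
      fix w' assume m: "mset w' = mset w"
      then have "set w' = set w" "length w' = length w" by (metis set_mset_mset, metis size_mset)
      moreover have "set w \<subseteq> primitives \<Delta>" using that(1) PQ(5) by blast
      ultimately show "prod_list w' - prod_list w \<in> span (v ` ordered_pairs P r Q s)"
        using rearrange_letters[OF m, of n] Suc that(2) by auto
    qed
    then have "word_span (P \<union> Q) (Suc n) \<subseteq> span (v ` ordered_pairs P r Q s)"
      unfolding word_span_def by (intro span_minimal) auto
    then show ?case using reduce by blast
  }
qed

end

section \<open>Vector-valued polynomials\<close>

text \<open>Otherwise a functional that kills \<open>D\<close> but not \<open>v k\<close> would give
  a real polynomial with a nonzero coefficient that vanishes at every natural number.\<close>

lemma polynomial_coeff_in_subspace:
  fixes v :: "nat \<Rightarrow> 'a::real_vector"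
  assumes D: "subspace D" and val: "\<And>a::nat. (\<Sum>k\<le>N. real a ^ k *\<^sub>R v k) \<in> D" and "k \<le> N"
  shows "v k \<in> D"
proof (rule ccontr)
  assume "v k \<notin> D"
  obtain B where B: "B \<subseteq> D" "independent B" "D \<subseteq> span B" using maximal_independent_subset[of D] by blast
  have "span B = D" using B D by (metis span_minimal subset_antisym)
  then have "independent (insert (v k) B)" using B(2) \<open>v k \<notin> D\<close> by (simp add: independent_insert)
  then obtain g where g: "linear g" "\<forall>x\<in>insert (v k) B. g x = (if x = v k then 1 else 0 :: real)"
    using linear_independent_extend[of "insert (v k) B" "\<lambda>x. if x = v k then 1 else 0"] by blast
  have "v k \<notin> B" using B(1) \<open>v k \<notin> D\<close> by auto
  then have gD: "g x = 0" if "x \<in> D" for x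
    using g that \<open>span B = D\<close> by (intro linear_eq_0_on_span[of g B x]) auto
  have "(\<Sum>j\<le>N. g (v j) * real a ^ j) = 0" for a :: nat
    using gD[OF val[of a]] by (simp add: linear_sum[OF g(1)] linear_scale[OF g(1)] mult.commute)
  then have "range real \<subseteq> {x. (\<Sum>j\<le>N. g (v j) * x ^ j) = 0}" by auto
  moreover have "infinite (range real)" using finite_imageD[OF _ inj_of_nat] by auto
  ultimately have "infinite {x. (\<Sum>j\<le>N. g (v j) * x ^ j) = 0}" using finite_subset by blast
  then have "g (v k) = 0" using polyfun_finite_roots[of "\<lambda>j. g (v j)" N] \<open>k \<le> N\<close> by auto
  then show False using g(2) by auto
qed

text \<open>Demanding the formula for all large cutoffs makes \<open>c\<close> vanish eventually
  (compare consecutive cutoffs at \<open>a = 1\<close>), so no degree has to be carried through sums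
  and products.\<close>

definition has_coeffs :: "(nat \<Rightarrow> 'a::real_vector) \<Rightarrow> (nat \<Rightarrow> 'a) \<Rightarrow> bool" where
  "has_coeffs f c \<longleftrightarrow> (\<forall>\<^sub>F N in sequentially. \<forall>a. f a = (\<Sum>k\<le>N. real a ^ k *\<^sub>R c k))"

lemma has_coeffsI: "(\<And>N a. N \<ge> M \<Longrightarrow> f a = (\<Sum>k\<le>N. real a ^ k *\<^sub>R c k)) \<Longrightarrow> has_coeffs f c"
  by (auto simp: has_coeffs_def eventually_sequentially)

lemma has_coeffsE:
  assumes "has_coeffs f c"
  obtains M where "\<And>N a. N \<ge> M \<Longrightarrow> f a = (\<Sum>k\<le>N. real a ^ k *\<^sub>R c k)" "\<And>k. k > M \<Longrightarrow> c k = 0"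
proof -
  obtain M where M: "\<And>N a. N \<ge> M \<Longrightarrow> f a = (\<Sum>k\<le>N. real a ^ k *\<^sub>R c k)"
    using assms by (auto simp: has_coeffs_def eventually_sequentially)
  have "c k = 0" if "k > M" for k
    using M[of k 1] M[of "k - 1" 1] that by (cases k) auto
  then show ?thesis using M that by blast
qed

lemma has_coeffs_unique:
  assumes "has_coeffs f c" "has_coeffs f d"
  shows "c = d"
proof
  fix k
  obtain M where M: "\<And>N a. N \<ge> M \<Longrightarrow> f a = (\<Sum>k\<le>N. real a ^ k *\<^sub>R c k)" using assms(1) by (rule has_coeffsE) blast
  obtain M' where M': "\<And>N a. N \<ge> M' \<Longrightarrow> f a = (\<Sum>k\<le>N. real a ^ k *\<^sub>R d k)" using assms(2) by (rule has_coeffsE) blast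
  let ?N = "max k (max M M')"
  have "(\<Sum>k\<le>?N. real a ^ k *\<^sub>R (c k - d k)) \<in> {0}" for a
    using M[of ?N a] M'[of ?N a] by (simp add: scaleR_diff_right sum_subtractf)
  then have "c k - d k \<in> {0}" by (rule polynomial_coeff_in_subspace[rotated]) auto
  then show "c k = d k" by simp
qed

lemma has_coeffs_add:
  assumes "has_coeffs f c" "has_coeffs g d"
  shows "has_coeffs (\<lambda>a. f a + g a) (\<lambda>k. c k + d k)"
  using assms unfolding has_coeffs_def
  by eventually_elim (simp add: scaleR_add_right sum.distrib)

lemma has_coeffs_linear:
  assumes "has_coeffs f c" "linear L"
  shows "has_coeffs (\<lambda>a. L (f a)) (\<lambda>k. L (c k))"
  using assms(1) unfolding has_coeffs_def
  by eventually_elim (simp add: linear_sum[OF assms(2)] linear_scale[OF assms(2)])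

lemma has_coeffs_monomial: "has_coeffs (\<lambda>a. real a ^ j *\<^sub>R x) (\<lambda>k. if k = j then x else 0)"
  by (rule has_coeffsI[of j]) (simp add: if_distrib[of "\<lambda>x. _ *\<^sub>R x"] cong: if_cong)

lemma has_coeffs_at_0: "has_coeffs f c \<Longrightarrow> c 0 = f 0"
proof (erule has_coeffsE)
  fix M assume "\<And>N a. N \<ge> M \<Longrightarrow> f a = (\<Sum>k\<le>N. real a ^ k *\<^sub>R c k)"
  from this[of M 0] show "c 0 = f 0" by (simp add: sum.atMost_shift)
qed

lemma has_coeffs_bilin:
  assumes "has_coeffs f c" "has_coeffs g d" "bilin b"
  shows "has_coeffs (\<lambda>a. b (f a) (g a)) (\<lambda>m. \<Sum>i\<le>m. b (c i) (d (m - i)))"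
proof -
  obtain M where M: "\<And>N a. N \<ge> M \<Longrightarrow> f a = (\<Sum>k\<le>N. real a ^ k *\<^sub>R c k)" "\<And>k. k > M \<Longrightarrow> c k = 0"
    using assms(1) by (rule has_coeffsE) blast
  obtain M' where M': "\<And>N a. N \<ge> M' \<Longrightarrow> g a = (\<Sum>k\<le>N. real a ^ k *\<^sub>R d k)" "\<And>k. k > M' \<Longrightarrow> d k = 0"
    using assms(2) by (rule has_coeffsE) blast
  note l = bilinD1[OF assms(3)] and r = bilinD2[OF assms(3)]
  show ?thesis
  proof (rule has_coeffsI[of "M + M'"])
    fix N a assume N: "N \<ge> M + M'"
    have "b (f a) (g a) = (\<Sum>i\<le>M. \<Sum>j\<le>M'. real a ^ (i + j) *\<^sub>R b (c i) (d j))"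
      unfolding M(1)[OF order_refl] M'(1)[OF order_refl]
      by (subst sum.swap) (simp add: linear_sum[OF l] linear_sum[OF r] linear_scale[OF l] linear_scale[OF r]
          power_add scaleR_sum_right mult.commute)
    also have "\<dots> = (\<Sum>(i, j)\<in>{..M} \<times> {..M'}. real a ^ (i + j) *\<^sub>R b (c i) (d j))"
      by (rule sum.cartesian_product)
    \<comment> \<open>The rectangle is enlarged to a triangle, which only adds zero terms, in order
      to sum by total degree.\<close>
    also have "\<dots> = (\<Sum>(i, j)\<in>{(i, j). i + j \<le> N}. real a ^ (i + j) *\<^sub>R b (c i) (d j))"
    proof (rule sum.mono_neutral_left)
      show "finite {(i, j). i + j \<le> N}"
        by (rule finite_subset[of _ "{..N} \<times> {..N}"]) auto
      show "{..M} \<times> {..M'} \<subseteq> {(i, j). i + j \<le> N}" using N by auto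
      show "\<forall>ij\<in>{(i, j). i + j \<le> N} - {..M} \<times> {..M'}. (case ij of (i, j) \<Rightarrow> real a ^ (i + j) *\<^sub>R b (c i) (d j)) = 0"
      proof
        fix ij assume "ij \<in> {(i, j). i + j \<le> N} - {..M} \<times> {..M'}"
        then obtain i j where ij: "ij = (i, j)" "\<not> (i \<le> M \<and> j \<le> M')" by auto
        then have "c i = 0 \<or> d j = 0" using M(2)[of i] M'(2)[of j] by (meson not_le)
        then show "(case ij of (i, j) \<Rightarrow> real a ^ (i + j) *\<^sub>R b (c i) (d j)) = 0"
          using ij(1) linear_0[OF l] linear_0[OF r] by auto
      qed
    qed
    also have "\<dots> = (\<Sum>m\<le>N. \<Sum>i\<le>m. real a ^ (i + (m - i)) *\<^sub>R b (c i) (d (m - i)))"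
      by (rule sum.triangle_reindex_eq)
    finally show "b (f a) (g a) = (\<Sum>m\<le>N. real a ^ m *\<^sub>R (\<Sum>i\<le>m. b (c i) (d (m - i))))"
      by (simp add: scaleR_sum_right)
  qed
qed

section \<open>Summation of polynomial functions\<close>

definition polynomial_fun :: "(nat \<Rightarrow> 'a::real_vector) \<Rightarrow> bool" where
  "polynomial_fun f \<longleftrightarrow> (\<exists>c. has_coeffs f c)"

lemma polynomial_fun_add: "polynomial_fun f \<Longrightarrow> polynomial_fun g \<Longrightarrow> polynomial_fun (\<lambda>a. f a + g a)"
  and polynomial_fun_linear: "polynomial_fun f \<Longrightarrow> linear L \<Longrightarrow> polynomial_fun (\<lambda>a. L (f a))"
  and polynomial_fun_monomial: "polynomial_fun (\<lambda>a. real a ^ k *\<^sub>R x)"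
  unfolding polynomial_fun_def
  by (blast intro: has_coeffs_add has_coeffs_linear has_coeffs_monomial)+

lemma polynomial_fun_scaleR: "polynomial_fun f \<Longrightarrow> polynomial_fun (\<lambda>a. r *\<^sub>R f a)"
  by (rule polynomial_fun_linear) (auto intro: linear_rules)

lemma polynomial_fun_const: "polynomial_fun (\<lambda>a. x)"
  using polynomial_fun_monomial[of 0 x] by simp

lemma polynomial_fun_sum: "(\<And>i. i \<in> I \<Longrightarrow> polynomial_fun (f i)) \<Longrightarrow> polynomial_fun (\<lambda>a. \<Sum>i\<in>I. f i a)"
  by (induction I rule: infinite_finite_induct) (auto intro: polynomial_fun_add polynomial_fun_const)

text \<open>Faulhaber's formula: telescope the differences of (k+1)-st powers and expand them by the
  binomial theorem.\<close>

lemma polynomial_fun_power_sum: "polynomial_fun (\<lambda>a. (\<Sum>i<a. real i ^ k) *\<^sub>R x)"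
proof (induction k rule: less_induct)
  case (less k)
  let ?s = "\<lambda>j a. \<Sum>i<a. real i ^ j"
  have "real a ^ Suc k = (\<Sum>j\<le>k. real (Suc k choose j) * ?s j a)" for a
  proof -
    have "real a ^ Suc k = (\<Sum>i<a. real (Suc i) ^ Suc k - real i ^ Suc k)"
      using sum_lessThan_telescope[of "\<lambda>i. real i ^ Suc k" a] by (simp del: power_Suc of_nat_Suc)
    also have "\<dots> = (\<Sum>i<a. \<Sum>j\<le>k. real (Suc k choose j) * real i ^ j)"
    proof (rule sum.cong[OF refl])
      fix i
      have "real (Suc i) ^ Suc k = (\<Sum>j\<le>Suc k. real (Suc k choose j) * real i ^ j)"
        using binomial_ring[of "real i" 1 "Suc k"] by (simp add: add.commute del: power_Suc binomial_Suc_Suc)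
      then show "real (Suc i) ^ Suc k - real i ^ Suc k = (\<Sum>j\<le>k. real (Suc k choose j) * real i ^ j)"
        by (simp del: power_Suc binomial_Suc_Suc)
    qed
    finally show ?thesis by (simp add: sum.swap[of _ "{..<a}"] sum_distrib_left del: power_Suc binomial_Suc_Suc)
  qed
  moreover have "{..k} = insert k {..<k}" by auto
  \<comment> \<open>The term \<open>j = k\<close> has the coefficient \<open>Suc k\<close>, so the
    equation can be solved for it; the other power sums have lower exponents.\<close>
  ultimately have "?s k a = (1 / real (Suc k)) * (real a ^ Suc k + (\<Sum>j<k. - real (Suc k choose j) * ?s j a))" for a
    by (simp add: field_simps sum_negf del: power_Suc binomial_Suc_Suc)
  then have "(\<lambda>a. ?s k a *\<^sub>R x) = (\<lambda>a. ((1 / real (Suc k)) * (real a ^ Suc k + (\<Sum>j<k. - real (Suc k choose j) * ?s j a))) *\<^sub>R x)"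
    by presburger
  also have "\<dots> = (\<lambda>a. (1 / real (Suc k)) *\<^sub>R (real a ^ Suc k *\<^sub>R x
      + (\<Sum>j<k. (- real (Suc k choose j)) *\<^sub>R (?s j a *\<^sub>R x))))"
    by (simp only: scaleR_scaleR scaleR_sum_left[symmetric] scaleR_add_left[symmetric])
  finally have eq: "(\<lambda>a. ?s k a *\<^sub>R x) = (\<lambda>a. (1 / real (Suc k)) *\<^sub>R (real a ^ Suc k *\<^sub>R x
      + (\<Sum>j<k. (- real (Suc k choose j)) *\<^sub>R (?s j a *\<^sub>R x))))" .
  show ?case unfolding eq
    by (intro polynomial_fun_scaleR polynomial_fun_add polynomial_fun_sum polynomial_fun_monomial less.IH) auto
qed

text \<open>The recursion for Hopf powers only controls their differences; telescoping and power
  sums recover the function itself.\<close>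

lemma polynomial_fun_antidifference:
  assumes "polynomial_fun (\<lambda>a. f (Suc a) - f a)"
  shows "polynomial_fun f"
proof -
  obtain N c where c: "\<And>a. f (Suc a) - f a = (\<Sum>k\<le>N. real a ^ k *\<^sub>R c k)"
    using assms by (auto simp: polynomial_fun_def elim!: has_coeffsE)
  have "f a = f 0 + (\<Sum>k\<le>N. (\<Sum>i<a. real i ^ k) *\<^sub>R c k)" for a
  proof -
    have "f a = f 0 + (\<Sum>i<a. f (Suc i) - f i)" by (simp add: sum_lessThan_telescope)
    also have "(\<Sum>i<a. f (Suc i) - f i) = (\<Sum>k\<le>N. \<Sum>i<a. real i ^ k *\<^sub>R c k)"
      unfolding c by (rule sum.swap)
    finally show ?thesis by (simp add: scaleR_sum_left)
  qed
  then have eq: "f = (\<lambda>a. f 0 + (\<Sum>k\<le>N. (\<Sum>i<a. real i ^ k) *\<^sub>R c k))" by blast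
  show ?thesis
    by (subst eq) (intro polynomial_fun_add polynomial_fun_const polynomial_fun_sum polynomial_fun_power_sum)
qed

section \<open>Cocommutative Hopf algebras are generated by primitives\<close>

lemma linear_image_span_in_subspace:
  assumes "linear L" "subspace D" "\<And>s. s \<in> S \<Longrightarrow> L s \<in> D" "t \<in> span S"
  shows "L t \<in> D"
proof -
  have "L ` span S \<subseteq> D"
    unfolding linear_span_image[OF assms(1), symmetric] by (rule span_minimal) (use assms in auto)
  then show ?thesis using assms(4) by auto
qed

section \<open>Hopf powers\<close>

context hopf_algebra
begin

primrec hopf_power :: "nat \<Rightarrow> 'a \<Rightarrow> 'a" where
  "hopf_power 0 = (\<lambda>x. \<epsilon> x *\<^sub>R 1)"
| "hopf_power (Suc a) = conv (hopf_power a) id"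

lemma linear_hopf_power: "linear (hopf_power a)"
  by (induction a) (auto intro: linear_rules linear_counit linear_conv)

lemma hopf_power_one: "hopf_power a 1 = 1"
proof (induction a)
  case (Suc a)
  then show ?case
    using conv_prod_primitives[of "[]" "hopf_power a" id] by (simp add: linear_hopf_power linear_id)
qed (simp add: counit_one)

lemma bilin_hopf_power: "bilin (\<lambda>y z. hopf_power a y * z)"
  by (intro bilinI linear_rules linear_hopf_power)

lemma hopf_power_Suc: "hopf_power (Suc a) x = tlift2 (\<lambda>y z. hopf_power a y * z) (\<Delta> x)"
  by (simp add: conv_def sweedler_def)

text \<open>Multiplicativity of \<open>\<Delta>\<close> groups the four legs as y1 z1 \<otimes> y2
  z2. Exchanging the middle legs regroups them as y1 y2 \<otimes> z1 z2, two separate convolutions;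
  this is where cocommutativity enters.\<close>

lemma coproduct_hopf_power:
  assumes "cocommutative \<Delta>"
  shows "\<Delta> (hopf_power a x) = sweedler (\<lambda>y z. tens [hopf_power a y, hopf_power a z]) x"
proof (induction a arbitrary: x)
  case 0
  have "sweedler (\<lambda>y z. tens [\<epsilon> y *\<^sub>R 1, \<epsilon> z *\<^sub>R 1]) x = sweedler (\<lambda>y z. \<epsilon> (\<epsilon> y *\<^sub>R z) *\<^sub>R tens [1, 1 :: 'a]) x"
    by (simp add: linear_scale[OF linear_tens2_left] linear_scale[OF linear_tens2_right] linear_scale[OF linear_counit] mult.commute)
  also have "\<dots> = \<epsilon> (sweedler (\<lambda>y z. \<epsilon> y *\<^sub>R z) x) *\<^sub>R tens [1, 1]"
    by (rule sweedler_image[symmetric]) (intro linear_rules linear_counit)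
  finally show ?case
    by (simp add: linear_scale[OF linear_coproduct] coproduct_one sweedler_def counit_left)
next
  case (Suc a)
  let ?h = "hopf_power a"
  have \<Delta>: "\<Delta> (?h y * z) = sweedler (\<lambda>y1 y2. sweedler (\<lambda>z1 z2. tens [?h y1 * z1, ?h y2 * z2]) z) y" for y z
  proof -
    have "\<Delta> (?h y * z) = tmult (sweedler (\<lambda>y1 y2. tens [?h y1, ?h y2]) y) (sweedler (\<lambda>z1 z2. tens [z1, z2]) z)"
      by (simp add: coproduct_mult Suc sweedler_tens)
    then show ?thesis by (simp add: sweedler_def tmult_tlift2 tmult_tens)
  qed
  have "\<Delta> (hopf_power (Suc a) x)
      = sweedler (\<lambda>y z. sweedler (\<lambda>y1 y2. sweedler (\<lambda>z1 z2. tens [?h y1 * z1, ?h y2 * z2]) z) y) x"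
    using sweedler_image[OF linear_coproduct] by (simp add: conv_def \<Delta>)
  also have "\<dots> = sweedler (\<lambda>y z. sweedler (\<lambda>y1 y2. sweedler (\<lambda>z1 z2. tens [?h y1 * y2, ?h z1 * z2]) z) y) x"
    by (rule sweedler_interchange[OF assms]) (intro linear_rules linear_hopf_power)+
  also have "(\<lambda>y z. sweedler (\<lambda>y1 y2. sweedler (\<lambda>z1 z2. tens [?h y1 * y2, ?h z1 * z2]) z) y)
      = (\<lambda>y z. tens [hopf_power (Suc a) y, hopf_power (Suc a) z])"
    by (simp add: conv_def sweedler_image[OF linear_tens2_left, of _ _ "sweedler b z" for b z])
       (simp add: sweedler_image[OF linear_tens2_right])
  finally show ?case .
qed

end

context graded_connected_hopf_algebra
begin

lemma hopf_power_graded: "x \<in> H n \<Longrightarrow> hopf_power a x \<in> H n"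
proof (induction a arbitrary: x n)
  case 0
  show ?case
  proof (cases "n = 0")
    case True
    then show ?thesis using span_scale[OF span_base, of 1 "{1}" "\<epsilon> x"] by (simp add: connected)
  next
    case False
    then show ?thesis using 0 counit_graded[of x n] subspace_0[OF subspace_grading] by simp
  qed
next
  case (Suc a)
  show ?case
    unfolding hopf_power_Suc
    by (rule linear_image_span_in_subspace[OF linear_tlift2'[OF bilin_hopf_power] subspace_grading _ coproduct_graded[OF Suc.prems]])
       (auto simp: tlift2_tens'[OF bilin_hopf_power] intro!: mult_graded Suc.IH)
qed

definition reduced_tensors :: "nat \<Rightarrow> 'a tensor set" where
  "reduced_tensors n = span {tens [y, z] | y z i j. i + j = n \<and> 0 < i \<and> 0 < j \<and> y \<in> H i \<and> z \<in> H j}"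

text \<open>In bidegrees (n, 0) and (0, n) connectedness leaves only tensors y \<otimes> 1 and 1
  \<otimes> z. The counit kills positive degrees, so the counit axioms identify both y and z with
  \<open>x\<close>.\<close>

lemma coproduct_reduced:
  assumes x: "x \<in> H n" and n: "n > 0"
  obtains t where "t \<in> reduced_tensors n" "\<Delta> x = tens [x, 1] + tens [1, x] + t"
proof -
  let ?A = "(\<lambda>y. tens [y, 1]) ` H n" and ?B = "(\<lambda>z. tens [1, z]) ` H n"
  let ?T = "{a + t | a t. a \<in> {a + b | a b. a \<in> ?A \<and> b \<in> ?B} \<and> t \<in> reduced_tensors n}"
  have subA: "subspace ?A" and subB: "subspace ?B" and subR: "subspace (reduced_tensors n)"
    by (auto intro!: linear_subspace_image subspace_grading linear_tens2_left linear_tens2_right simp: reduced_tensors_def)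
  have in_T: "a + b + t \<in> ?T" if "a \<in> ?A" "b \<in> ?B" "t \<in> reduced_tensors n" for a b t using that by blast
  have "span {tens [y, z] | y z i j. i + j = n \<and> y \<in> H i \<and> z \<in> H j} \<subseteq> ?T"
  proof (rule span_minimal)
    show "subspace ?T" by (intro subspace_sums subA subB subR)
    show "{tens [y, z] | y z i j. i + j = n \<and> y \<in> H i \<and> z \<in> H j} \<subseteq> ?T"
    proof
      fix s assume "s \<in> {tens [y, z] | y z i j. i + j = n \<and> y \<in> H i \<and> z \<in> H j}"
      then obtain y z i j where s: "s = tens [y, z]" "i + j = n" "y \<in> H i" "z \<in> H j" by auto
      consider "j = 0" "i = n" | "i = 0" "j = n" | "0 < i" "0 < j" using s(2) by (cases "i = 0"; cases "j = 0") auto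
      then show "s \<in> ?T"
      proof cases
        case 1
        then obtain r where "z = r *\<^sub>R 1" using s(4) by (auto simp: connected span_singleton)
        then have "s = tens [r *\<^sub>R y, 1]" using s(1) by (simp add: linear_scale[OF linear_tens2_left] linear_scale[OF linear_tens2_right])
        then have "s \<in> ?A" using s(3) 1 subspace_scale[OF subspace_grading] by blast
        then show ?thesis using in_T[of s 0 0] subspace_0[OF subB] subspace_0[OF subR] by simp
      next
        case 2
        then obtain r where "y = r *\<^sub>R 1" using s(3) by (auto simp: connected span_singleton)
        then have "s = tens [1, r *\<^sub>R z]" using s(1) by (simp add: linear_scale[OF linear_tens2_left] linear_scale[OF linear_tens2_right])
        then have "s \<in> ?B" using s(4) 2 subspace_scale[OF subspace_grading] by blast
        then show ?thesis using in_T[of 0 s 0] subspace_0[OF subA] subspace_0[OF subR] by simp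
      next
        case 3
        then have "s \<in> reduced_tensors n" using s unfolding reduced_tensors_def by (intro span_base) blast
        then show ?thesis using in_T[of 0 0 s] subspace_0[OF subA] subspace_0[OF subB] by simp
      qed
    qed
  qed
  then have "\<Delta> x \<in> ?T" using coproduct_graded[OF x] by blast
  then obtain y z t where yzt: "y \<in> H n" "z \<in> H n" "t \<in> reduced_tensors n" "\<Delta> x = tens [y, 1] + tens [1, z] + t"
    by auto
  have br: "bilin (\<lambda>y z. \<epsilon> z *\<^sub>R y)" and bl: "bilin (\<lambda>y z. \<epsilon> y *\<^sub>R z)"
    by (intro bilinI linear_rules linear_counit)+
  have "tlift2 (\<lambda>y z. \<epsilon> z *\<^sub>R y) t = 0"
    by (rule linear_eq_0_on_span[OF linear_tlift2'[OF br] _ yzt(3)[unfolded reduced_tensors_def]])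
       (auto simp: tlift2_tens'[OF br] counit_graded)
  then have "x = y"
    using counit_right[of x] yzt(2) n
    by (simp add: yzt(4) linear_add[OF linear_tlift2'[OF br]] tlift2_tens'[OF br] counit_one counit_graded)
  have "tlift2 (\<lambda>y z. \<epsilon> y *\<^sub>R z) t = 0"
    by (rule linear_eq_0_on_span[OF linear_tlift2'[OF bl] _ yzt(3)[unfolded reduced_tensors_def]])
       (auto simp: tlift2_tens'[OF bl] counit_graded)
  then have "x = z"
    using counit_left[of x] yzt(1) n
    by (simp add: yzt(4) linear_add[OF linear_tlift2'[OF bl]] tlift2_tens'[OF bl] counit_one counit_graded)
  show ?thesis using that yzt(3,4) \<open>x = y\<close> \<open>x = z\<close> by simp
qed

lemma hopf_power_Suc_reduced:
  assumes "\<Delta> x = tens [x, 1] + tens [1, x] + t"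
  shows "hopf_power (Suc a) x = hopf_power a x + x + tlift2 (\<lambda>y z. hopf_power a y * z) t"
  unfolding hopf_power_Suc assms
  by (simp add: linear_add[OF linear_tlift2'[OF bilin_hopf_power]] tlift2_tens'[OF bilin_hopf_power] hopf_power_one)

lemma span_homogeneous: "span (\<Union>n. H n) = UNIV"
proof -
  have "x \<in> span (\<Union>n. H n)" for x
  proof -
    obtain f where f: "\<forall>n. f n \<in> H n" "x = (\<Sum>n | f n \<noteq> 0. f n)" using direct_sum[of x] by blast
    show ?thesis unfolding f(2) by (intro span_sum span_base) (use f(1) in auto)
  qed
  then show ?thesis by auto
qed

text \<open>Induction on the degree: the difference of consecutive Hopf powers of \<open>x\<close>
  is \<open>x\<close> plus products in which Hopf powers act only on elements of lower
  degree.\<close>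

lemma polynomial_fun_hopf_power: "polynomial_fun (\<lambda>a. hopf_power a x)"
proof -
  have "polynomial_fun (\<lambda>a. hopf_power a x)" if "x \<in> H n" for x n
    using that
  proof (induction n arbitrary: x rule: less_induct)
    case (less n)
    show ?case
    proof (cases "n = 0")
      case True
      then obtain r where "x = r *\<^sub>R 1" using less.prems by (auto simp: connected span_singleton)
      then have "(\<lambda>a. hopf_power a x) = (\<lambda>a. r *\<^sub>R 1)"
        by (auto simp: linear_scale[OF linear_hopf_power] hopf_power_one)
      then show ?thesis using polynomial_fun_const by metis
    next
      case False
      then obtain t where t: "t \<in> reduced_tensors n" "\<Delta> x = tens [x, 1] + tens [1, x] + t"
        using coproduct_reduced[OF less.prems] by auto
      let ?V = "{t. polynomial_fun (\<lambda>a. tlift2 (\<lambda>y z. hopf_power a y * z) t)}"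
      have "reduced_tensors n \<subseteq> ?V"
        unfolding reduced_tensors_def
      proof (rule span_minimal)
        note lin = linear_tlift2'[OF bilin_hopf_power]
        show "subspace ?V"
          by (rule subspaceI) (auto simp: linear_0[OF lin] linear_add[OF lin] linear_scale[OF lin]
              intro: polynomial_fun_const polynomial_fun_add polynomial_fun_scaleR)
        show "{tens [y, z] | y z i j. i + j = n \<and> 0 < i \<and> 0 < j \<and> y \<in> H i \<and> z \<in> H j} \<subseteq> ?V"
        proof
          fix t assume "t \<in> {tens [y, z] | y z i j. i + j = n \<and> 0 < i \<and> 0 < j \<and> y \<in> H i \<and> z \<in> H j}"
          then obtain y z i j where "t = tens [y, z]" "i + j = n" "0 < j" "y \<in> H i" by blast
          then show "t \<in> ?V"
            using polynomial_fun_linear[OF less.IH[of i y] linear_mult_left[OF linear_ident]]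
            by (simp add: tlift2_tens'[OF bilin_hopf_power])
        qed
      qed
      then have "polynomial_fun (\<lambda>a. x + tlift2 (\<lambda>y z. hopf_power a y * z) t)"
        using t(1) by (intro polynomial_fun_add polynomial_fun_const) auto
      then have "polynomial_fun (\<lambda>a. hopf_power (Suc a) x - hopf_power a x)"
        by (simp add: hopf_power_Suc_reduced[OF t(2)] del: hopf_power.simps)
      then show ?thesis by (rule polynomial_fun_antidifference)
    qed
  qed
  moreover have "subspace {x. polynomial_fun (\<lambda>a. hopf_power a x)}"
    by (rule subspaceI) (auto simp: linear_0[OF linear_hopf_power] linear_add[OF linear_hopf_power]
        linear_scale[OF linear_hopf_power] intro: polynomial_fun_const polynomial_fun_add polynomial_fun_scaleR)
  ultimately have "span (\<Union>n. H n) \<subseteq> {x. polynomial_fun (\<lambda>a. hopf_power a x)}"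
    by (intro span_minimal) auto
  then show ?thesis by (auto simp: span_homogeneous)
qed

text \<open>\<open>eulerian x 1\<close> is the first Eulerian idempotent, the convolution logarithm of the identity.\<close>

definition eulerian :: "'a \<Rightarrow> nat \<Rightarrow> 'a" where
  "eulerian x = (SOME c. has_coeffs (\<lambda>a. hopf_power a x) c)"

lemma eulerian_coeffs: "has_coeffs (\<lambda>a. hopf_power a x) (eulerian x)"
  using polynomial_fun_hopf_power[of x] unfolding eulerian_def polynomial_fun_def by (rule someI_ex)

text \<open>The coefficients are picked by choice, but they are unique, so they inherit linearity
  from the Hopf powers.\<close>

lemma linear_eulerian: "linear (\<lambda>x. eulerian x k)"
proof (rule linearI)
  fix x y
  have "eulerian (x + y) = (\<lambda>k. eulerian x k + eulerian y k)"
    using has_coeffs_unique[OF eulerian_coeffs[of "x + y"]] has_coeffs_add[OF eulerian_coeffs[of x] eulerian_coeffs[of y]]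
    by (simp add: linear_add[OF linear_hopf_power])
  then show "eulerian (x + y) k = eulerian x k + eulerian y k" by simp
next
  fix r x
  have "eulerian (r *\<^sub>R x) = (\<lambda>k. r *\<^sub>R eulerian x k)"
    using has_coeffs_unique[OF eulerian_coeffs[of "r *\<^sub>R x"]] has_coeffs_linear[OF eulerian_coeffs[of x] linear_scaleR_right[OF linear_ident, of r]]
    by (simp add: linear_scale[OF linear_hopf_power])
  then show "eulerian (r *\<^sub>R x) k = r *\<^sub>R eulerian x k" by simp
qed

lemma eulerian_0: "eulerian x 0 = \<epsilon> x *\<^sub>R 1"
  using has_coeffs_at_0[OF eulerian_coeffs[of x]] by simp

text \<open>Compare the coefficients of \<open>a\<close> in the identity expressing that the Hopf powers are coalgebra maps.\<close>

lemma eulerian_primitive: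
  assumes "cocommutative \<Delta>"
  shows "eulerian x 1 \<in> primitives \<Delta>"
proof -
  let ?\<beta> = "\<lambda>m y z. \<Sum>i\<le>m. tens [eulerian y i, eulerian z (m - i)]"
  have bh: "bilin (\<lambda>y z. tens [hopf_power a y, hopf_power a z])" for a
    by (intro bilinI linear_rules linear_hopf_power)
  have b\<beta>: "bilin (?\<beta> m)" for m
    by (intro bilinI linear_compose_sum ballI linear_rules linear_eulerian)
  \<comment> \<open>The tensors whose image under the two Hopf powers has these coefficients form a
    subspace. On pure tensors the coefficients are those of a Cauchy product.\<close>
  let ?V = "{t. has_coeffs (\<lambda>a. tlift2 (\<lambda>y z. tens [hopf_power a y, hopf_power a z]) t) (\<lambda>m. tlift2 (?\<beta> m) t)}"
  have "tensor_power 2 \<subseteq> ?V"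
    unfolding tensor_power_2
  proof (rule span_minimal)
    note lin = linear_tlift2'[OF bh] linear_tlift2'[OF b\<beta>]
    have "has_coeffs (\<lambda>a. 0) (\<lambda>k. 0)" by (rule has_coeffsI[of 0]) simp
    then show "subspace ?V"
      by (intro subspaceI) (auto simp: linear_0[OF lin(1)] linear_add[OF lin(1)] linear_scale[OF lin(1)]
          linear_0[OF lin(2)] linear_add[OF lin(2)] linear_scale[OF lin(2)]
          intro: has_coeffs_add has_coeffs_linear[OF _ linear_scaleR_right[OF linear_ident]])
    show "{tens [y, z] | y z. True} \<subseteq> ?V"
      using has_coeffs_bilin[OF eulerian_coeffs eulerian_coeffs bilin_tens]
      by (auto simp: tlift2_tens'[OF bh] tlift2_tens'[OF b\<beta>])
  qed
  then have "has_coeffs (\<lambda>a. \<Delta> (hopf_power a x)) (\<lambda>m. tlift2 (?\<beta> m) (\<Delta> x))"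
    using coproduct_in[of x] by (auto simp: coproduct_hopf_power[OF assms] sweedler_def)
  moreover have "has_coeffs (\<lambda>a. \<Delta> (hopf_power a x)) (\<lambda>m. \<Delta> (eulerian x m))"
    by (rule has_coeffs_linear[OF eulerian_coeffs linear_coproduct])
  ultimately have "(\<lambda>m. \<Delta> (eulerian x m)) = (\<lambda>m. tlift2 (?\<beta> m) (\<Delta> x))"
    using has_coeffs_unique by blast
  then have "\<Delta> (eulerian x 1) = tlift2 (?\<beta> 1) (\<Delta> x)" by (rule fun_cong)
  \<comment> \<open>Only the indices 0 and 1 occur, and the coefficient at 0 is the counit. Its
    scalar is moved into the other factor so that the counit axioms apply.\<close>
  also have "?\<beta> 1 = (\<lambda>y z. tens [1, eulerian (\<epsilon> y *\<^sub>R z) 1] + tens [eulerian (\<epsilon> z *\<^sub>R y) 1, 1])"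
    by (simp add: fun_eq_iff eulerian_0 linear_scale[OF linear_eulerian] linear_scale[OF linear_tens2_left] linear_scale[OF linear_tens2_right])
  also have "tlift2 \<dots> (\<Delta> x) = tens [1, eulerian (tlift2 (\<lambda>y z. \<epsilon> y *\<^sub>R z) (\<Delta> x)) 1]
      + tens [eulerian (tlift2 (\<lambda>y z. \<epsilon> z *\<^sub>R y) (\<Delta> x)) 1, 1]"
    by (simp add: tlift2_add tlift2_image[OF linear_comp[OF linear_tens2_right linear_eulerian]]
        tlift2_image[OF linear_comp[OF linear_tens2_left linear_eulerian]])
  finally show ?thesis by (simp add: primitives_def counit_left counit_right)
qed

text \<open>Every Hopf power of \<open>x\<close> is \<open>a\<close> times \<open>x\<close> modulo
  products of lower-degree elements. Compare linear coefficients modulo that subspace.\<close>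

lemma eulerian_decomposable:
  assumes x: "x \<in> H n" and n: "n > 0"
  shows "eulerian x 1 - x \<in> span {y * z | y z i j. i + j = n \<and> 0 < i \<and> 0 < j \<and> y \<in> H i \<and> z \<in> H j}"
    (is "_ \<in> ?D")
proof -
  obtain t where t: "t \<in> reduced_tensors n" "\<Delta> x = tens [x, 1] + tens [1, x] + t"
    using coproduct_reduced[OF x n] by auto
  have power: "hopf_power a x - real a *\<^sub>R x \<in> ?D" for a
  proof (induction a)
    case 0
    show ?case using counit_graded[OF x n] by (simp add: span_zero)
  next
    case (Suc a)
    have "tlift2 (\<lambda>y z. hopf_power a y * z) t \<in> ?D"
    proof (rule linear_image_span_in_subspace[OF linear_tlift2'[OF bilin_hopf_power] _ _ t(1)[unfolded reduced_tensors_def]])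
      fix s assume "s \<in> {tens [y, z] | y z i j. i + j = n \<and> 0 < i \<and> 0 < j \<and> y \<in> H i \<and> z \<in> H j}"
      then show "tlift2 (\<lambda>y z. hopf_power a y * z) s \<in> ?D"
        using hopf_power_graded by (intro span_base) (fastforce simp: tlift2_tens'[OF bilin_hopf_power])
    qed simp
    with Suc have "(hopf_power a x - real a *\<^sub>R x) + tlift2 (\<lambda>y z. hopf_power a y * z) t \<in> ?D" by (rule span_add)
    then show ?case by (simp add: hopf_power_Suc_reduced[OF t(2)] algebra_simps del: hopf_power.simps)
  qed
  obtain M where M: "\<And>N a. N \<ge> M \<Longrightarrow> hopf_power a x = (\<Sum>k\<le>N. real a ^ k *\<^sub>R eulerian x k)"
    using eulerian_coeffs[of x] by (rule has_coeffsE) blast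
  \<comment> \<open>The cutoff \<open>Suc M\<close> keeps the linear term in range even if
    \<open>M = 0\<close>.\<close>
  have "(\<Sum>k\<le>Suc M. real a ^ k *\<^sub>R (eulerian x k - (if k = 1 then x else 0))) \<in> ?D" for a
  proof -
    have "(\<Sum>k\<le>Suc M. real a ^ k *\<^sub>R (if k = 1 then x else 0)) = real a *\<^sub>R x"
      by (simp add: if_distrib[of "\<lambda>x. _ *\<^sub>R x"] sum.delta cong: if_cong del: sum.atMost_Suc)
    then show ?thesis
      using power[of a] M[of "Suc M" a] by (simp add: scaleR_diff_right sum_subtractf del: sum.atMost_Suc)
  qed
  then have "eulerian x 1 - (if (1::nat) = 1 then x else 0) \<in> ?D"
    by (rule polynomial_coeff_in_subspace[rotated]) auto
  then show ?thesis by simp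
qed

lemma span_words_primitives:
  assumes "cocommutative \<Delta>"
  shows "span {prod_list w | w. set w \<subseteq> primitives \<Delta>} = UNIV" (is "?U = _")
proof -
  have mult: "y * z \<in> ?U" if "y \<in> ?U" "z \<in> ?U" for y z
  proof -
    have "{a * b | a b. a \<in> {prod_list w | w. set w \<subseteq> primitives \<Delta>} \<and> b \<in> {prod_list w | w. set w \<subseteq> primitives \<Delta>}}
        \<subseteq> {prod_list w | w. set w \<subseteq> primitives \<Delta>}"
      by (auto, metis (no_types) Un_least prod_list.append set_append)
    then show ?thesis using span_mult[OF that] span_mono by blast
  qed
  have "x \<in> ?U" if "x \<in> H n" for x n
    using that
  proof (induction n arbitrary: x rule: less_induct)
    case (less n)
    show ?case
    proof (cases "n = 0")
      case True
      have "1 \<in> ?U" by (rule span_base) (auto intro: exI[of _ "[]"])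
      then show ?thesis
        using True less.prems span_minimal[of "{1}" ?U] by (auto simp: connected)
    next
      case False
      then have "eulerian x 1 - x \<in> span {y * z | y z i j. i + j = n \<and> 0 < i \<and> 0 < j \<and> y \<in> H i \<and> z \<in> H j}"
        using eulerian_decomposable[OF less.prems] by simp
      moreover have "span {y * z | y z i j. i + j = n \<and> 0 < i \<and> 0 < j \<and> y \<in> H i \<and> z \<in> H j} \<subseteq> ?U"
      proof (rule span_minimal)
        show "{y * z | y z i j. i + j = n \<and> 0 < i \<and> 0 < j \<and> y \<in> H i \<and> z \<in> H j} \<subseteq> ?U"
        proof
          fix t assume "t \<in> {y * z | y z i j. i + j = n \<and> 0 < i \<and> 0 < j \<and> y \<in> H i \<and> z \<in> H j}"
          then obtain y z i j where "t = y * z" "i + j = n" "0 < i" "0 < j" "y \<in> H i" "z \<in> H j" by blast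
          then show "t \<in> ?U" using mult[OF less.IH[of i y] less.IH[of j z]] by simp
        qed
      qed simp
      moreover have "eulerian x 1 \<in> ?U"
        using eulerian_primitive[OF assms, of x]
        by (intro span_base CollectI exI[of _ "[eulerian x 1]"]) auto
      ultimately have "eulerian x 1 - (eulerian x 1 - x) \<in> ?U"
        using span_diff[of "eulerian x 1" _ "eulerian x 1 - x"] by blast
      then show ?thesis by simp
    qed
  qed
  then have "span (\<Union>n. H n) \<subseteq> ?U" by (intro span_minimal) auto
  then show ?thesis by (auto simp: span_homogeneous)
qed

end

context hopf_antiinvolution
begin

lemma is_basis_vec:
  assumes "cocommutative \<Delta>"
    and "is_basis P prim_plus" "linear_order_on P r" "is_basis Q prim_minus" "linear_order_on Q s"
    and v: "v \<in> {vec_right, vec_left, vec_sum, vec_rev_sum}"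
  shows "is_basis (v ` ordered_pairs P r Q s) UNIV"
proof -
  have "prod_list w \<in> span (v ` ordered_pairs P r Q s)" if "set w \<subseteq> primitives \<Delta>" for w
    using word_span_subset_span_vec[OF assms(2-)] word_span_prod[OF that order_refl] by blast
  then have "span {prod_list w | w. set w \<subseteq> primitives \<Delta>} \<subseteq> span (v ` ordered_pairs P r Q s)"
    by (intro span_minimal) auto
  then show ?thesis
    using independent_family_vec[OF assms(2-)] span_words_primitives[OF assms(1)]
    by (auto simp: is_basis_def independent_family_def)
qed

end

text \<open>Part (i) uses eigenspaces and states nonvanishing separately for nonzero letters, since
  a zero letter makes the vector zero. Bases do not contain 0, so the last part has genuine
  eigenvectors. For \<open>tau_minus\<close> and odd \<open>a\<close> the general claim is about
  \<open>vec_rev_sum\<close>; for \<open>vec_sum\<close> it assumes that the product of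
  \<open>qs\<close> equals its reversal.\<close>

theorem theorem3p3:
  fixes H :: "nat \<Rightarrow> 'a::real_algebra_1 set"
    and \<Delta> :: "'a \<Rightarrow> 'a tensor"
    and \<epsilon> :: "'a \<Rightarrow> real"
    and antipode \<tau> :: "'a \<Rightarrow> 'a"
  assumes "graded_connected_hopf_algebra H \<Delta> \<epsilon> antipode"
    and "linear \<tau>"
    and "\<And>n. \<tau> ` H n \<subseteq> H n"
    and "\<And>x. \<tau> (\<tau> x) = x"
    and "algebra_antimorphism \<tau>"
    and "coalgebra_morphism \<Delta> \<tau> \<or> coalgebra_antimorphism \<Delta> \<tau>"
  shows
    "(\<forall>ps qs. set ps \<subseteq> eigenspace (primitives \<Delta>) \<tau> 1 \<and> set qs \<subseteq> eigenspace (primitives \<Delta>) \<tau> (-1) \<longrightarrow>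
        (0 \<notin> set ps \<union> set qs \<longrightarrow>
           vec_right (ps, qs) \<noteq> 0 \<and> vec_left (ps, qs) \<noteq> 0 \<and>
           vec_sum (ps, qs) \<noteq> 0 \<and> vec_rev_sum (ps, qs) \<noteq> 0) \<and>
        (\<forall>a\<ge>1.
           (even a \<longrightarrow>
              vec_right (ps, qs) \<in> eigenspace UNIV (tau_plus \<Delta> \<tau> a)
                (if qs = [] then real a ^ length ps else 0) \<and>
              vec_left (ps, qs) \<in> eigenspace UNIV (tau_minus \<Delta> \<tau> a)
                (if qs = [] then real a ^ length ps else 0)) \<and>
           (odd a \<longrightarrow>
              vec_left (ps, qs) \<in> eigenspace UNIV (tau_plus \<Delta> \<tau> a) (real a ^ length ps) \<and>
              vec_right (ps, qs) \<in> eigenspace UNIV (tau_plus \<Delta> \<tau> a) (real a ^ length ps)) \<and>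
           (odd a \<longrightarrow>
              vec_rev_sum (ps, qs) \<in> eigenspace UNIV (tau_minus \<Delta> \<tau> a)
                ((-1) ^ length qs * real a ^ length ps) \<and>
              (prod_list (rev qs) = prod_list qs \<longrightarrow>
                 vec_sum (ps, qs) \<in> eigenspace UNIV (tau_minus \<Delta> \<tau> a)
                   ((-1) ^ length qs * real a ^ length ps)))))
     \<and>
     (\<forall>P r Q s. is_basis P (eigenspace (primitives \<Delta>) \<tau> 1) \<and> linear_order_on P r \<and>
        is_basis Q (eigenspace (primitives \<Delta>) \<tau> (-1)) \<and> linear_order_on Q s \<longrightarrow>
        (\<forall>v\<in>{vec_right, vec_left, vec_sum, vec_rev_sum}.
           independent_family v (ordered_pairs P r Q s)))
     \<and>
     (cocommutative \<Delta> \<longrightarrow>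
      (\<forall>P r Q s. is_basis P (eigenspace (primitives \<Delta>) \<tau> 1) \<and> linear_order_on P r \<and>
        is_basis Q (eigenspace (primitives \<Delta>) \<tau> (-1)) \<and> linear_order_on Q s \<longrightarrow>
        (\<forall>v\<in>{vec_right, vec_left, vec_sum, vec_rev_sum}.
           is_basis (v ` ordered_pairs P r Q s) UNIV) \<and>
        (\<forall>a\<ge>1. \<forall>(ps, qs) \<in> ordered_pairs P r Q s.
           (even a \<longrightarrow>
              eigenvector (tau_plus \<Delta> \<tau> a) (if qs = [] then real a ^ length ps else 0)
                (vec_right (ps, qs)) \<and>
              eigenvector (tau_minus \<Delta> \<tau> a) (if qs = [] then real a ^ length ps else 0)
                (vec_left (ps, qs))) \<and>
           (odd a \<longrightarrow>
              eigenvector (tau_plus \<Delta> \<tau> a) (real a ^ length ps) (vec_left (ps, qs)) \<and>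
              eigenvector (tau_plus \<Delta> \<tau> a) (real a ^ length ps) (vec_right (ps, qs)) \<and>
              eigenvector (tau_minus \<Delta> \<tau> a) ((-1) ^ length qs * real a ^ length ps)
                (vec_rev_sum (ps, qs)) \<and>
              (prod_list (rev qs) = prod_list qs \<longrightarrow>
                 eigenvector (tau_minus \<Delta> \<tau> a) ((-1) ^ length qs * real a ^ length ps)
                   (vec_sum (ps, qs)))))))"
proof -
  interpret hopf_antiinvolution H \<Delta> \<epsilon> antipode \<tau>
    using assms by (intro hopf_antiinvolution.intro hopf_antiinvolution_axioms.intro)
  have eigen:
    "even a \<Longrightarrow> tau_plus \<Delta> \<tau> a (vec_right (ps, qs)) = (if qs = [] then real a ^ length ps else 0) *\<^sub>R vec_right (ps, qs)"
    "even a \<Longrightarrow> tau_minus \<Delta> \<tau> a (vec_left (ps, qs)) = (if qs = [] then real a ^ length ps else 0) *\<^sub>R vec_left (ps, qs)"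
    "odd a \<Longrightarrow> tau_plus \<Delta> \<tau> a (vec_left (ps, qs)) = real a ^ length ps *\<^sub>R vec_left (ps, qs)"
    "odd a \<Longrightarrow> tau_plus \<Delta> \<tau> a (vec_right (ps, qs)) = real a ^ length ps *\<^sub>R vec_right (ps, qs)"
    "odd a \<Longrightarrow> tau_minus \<Delta> \<tau> a (vec_rev_sum (ps, qs)) = ((-1) ^ length qs * real a ^ length ps) *\<^sub>R vec_rev_sum (ps, qs)"
    "odd a \<Longrightarrow> prod_list (rev qs) = prod_list qs \<Longrightarrow>
      tau_minus \<Delta> \<tau> a (vec_sum (ps, qs)) = ((-1) ^ length qs * real a ^ length ps) *\<^sub>R vec_sum (ps, qs)"
    if "set ps \<subseteq> prim_plus" "set qs \<subseteq> prim_minus" "a \<ge> 1" for ps qs a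
    using that eigen_right_plus[of ps qs a] eigen_left_minus[of ps qs a] eigen_left_plus[of ps qs a]
      eigen_rev_sum_minus[of ps qs a] eigen_sum_minus[of ps qs a]
    by (simp_all del: vec_right.simps vec_left.simps vec_sum.simps vec_rev_sum.simps)
  have nonzero: "vec_right (ps, qs) \<noteq> 0" "vec_left (ps, qs) \<noteq> 0" "vec_sum (ps, qs) \<noteq> 0" "vec_rev_sum (ps, qs) \<noteq> 0"
    if "set ps \<subseteq> prim_plus" "set qs \<subseteq> prim_minus" "0 \<notin> set ps \<union> set qs" for ps qs
    by (rule vec_nonzero[OF that], simp)+
  have basis_words: "set ps \<subseteq> prim_plus" "set qs \<subseteq> prim_minus" "0 \<notin> set ps \<union> set qs"
    if "is_basis P prim_plus" "is_basis Q prim_minus" "(ps, qs) \<in> ordered_pairs P r Q s" for P r Q s ps qs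
    using that independent_bases_Un[OF that(1,2)] dependent_zero[of "P \<union> Q"] by (auto simp: ordered_pairs_def)
  show ?thesis
  proof (intro conjI)
    show "\<forall>ps qs. set ps \<subseteq> prim_plus \<and> set qs \<subseteq> prim_minus \<longrightarrow>
        (0 \<notin> set ps \<union> set qs \<longrightarrow>
           vec_right (ps, qs) \<noteq> 0 \<and> vec_left (ps, qs) \<noteq> 0 \<and>
           vec_sum (ps, qs) \<noteq> 0 \<and> vec_rev_sum (ps, qs) \<noteq> 0) \<and>
        (\<forall>a\<ge>1.
           (even a \<longrightarrow>
              vec_right (ps, qs) \<in> eigenspace UNIV (tau_plus \<Delta> \<tau> a)
                (if qs = [] then real a ^ length ps else 0) \<and>
              vec_left (ps, qs) \<in> eigenspace UNIV (tau_minus \<Delta> \<tau> a)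
                (if qs = [] then real a ^ length ps else 0)) \<and>
           (odd a \<longrightarrow>
              vec_left (ps, qs) \<in> eigenspace UNIV (tau_plus \<Delta> \<tau> a) (real a ^ length ps) \<and>
              vec_right (ps, qs) \<in> eigenspace UNIV (tau_plus \<Delta> \<tau> a) (real a ^ length ps)) \<and>
           (odd a \<longrightarrow>
              vec_rev_sum (ps, qs) \<in> eigenspace UNIV (tau_minus \<Delta> \<tau> a)
                ((-1) ^ length qs * real a ^ length ps) \<and>
              (prod_list (rev qs) = prod_list qs \<longrightarrow>
                 vec_sum (ps, qs) \<in> eigenspace UNIV (tau_minus \<Delta> \<tau> a)
                   ((-1) ^ length qs * real a ^ length ps))))"
      unfolding eigenspace_def[of UNIV]
      by (intro allI impI conjI CollectI UNIV_I; elim conjE; (rule eigen nonzero; assumption))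
    show "\<forall>P r Q s. is_basis P prim_plus \<and> linear_order_on P r \<and> is_basis Q prim_minus \<and> linear_order_on Q s \<longrightarrow>
        (\<forall>v\<in>{vec_right, vec_left, vec_sum, vec_rev_sum}. independent_family v (ordered_pairs P r Q s))"
      using independent_family_vec by blast
    show "cocommutative \<Delta> \<longrightarrow>
      (\<forall>P r Q s. is_basis P prim_plus \<and> linear_order_on P r \<and> is_basis Q prim_minus \<and> linear_order_on Q s \<longrightarrow>
        (\<forall>v\<in>{vec_right, vec_left, vec_sum, vec_rev_sum}.
           is_basis (v ` ordered_pairs P r Q s) UNIV) \<and>
        (\<forall>a\<ge>1. \<forall>(ps, qs) \<in> ordered_pairs P r Q s.
           (even a \<longrightarrow>
              eigenvector (tau_plus \<Delta> \<tau> a) (if qs = [] then real a ^ length ps else 0)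
                (vec_right (ps, qs)) \<and>
              eigenvector (tau_minus \<Delta> \<tau> a) (if qs = [] then real a ^ length ps else 0)
                (vec_left (ps, qs))) \<and>
           (odd a \<longrightarrow>
              eigenvector (tau_plus \<Delta> \<tau> a) (real a ^ length ps) (vec_left (ps, qs)) \<and>
              eigenvector (tau_plus \<Delta> \<tau> a) (real a ^ length ps) (vec_right (ps, qs)) \<and>
              eigenvector (tau_minus \<Delta> \<tau> a) ((-1) ^ length qs * real a ^ length ps)
                (vec_rev_sum (ps, qs)) \<and>
              (prod_list (rev qs) = prod_list qs \<longrightarrow>
                 eigenvector (tau_minus \<Delta> \<tau> a) ((-1) ^ length qs * real a ^ length ps)
                   (vec_sum (ps, qs))))))"
    proof (intro impI allI, elim conjE, intro conjI ballI allI impI)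
      fix P Q :: "'a set" and r s and v :: "'a list \<times> 'a list \<Rightarrow> 'a"
      assume "cocommutative \<Delta>" "is_basis P prim_plus" "linear_order_on P r" "is_basis Q prim_minus" "linear_order_on Q s"
        "v \<in> {vec_right, vec_left, vec_sum, vec_rev_sum}"
      then show "is_basis (v ` ordered_pairs P r Q s) UNIV" by (rule is_basis_vec)
    next
      fix P Q :: "'a set" and r s and a :: nat and i
      assume *: "is_basis P prim_plus" "is_basis Q prim_minus" "a \<ge> 1" "i \<in> ordered_pairs P r Q s"
      obtain ps qs where i: "i = (ps, qs)" by (cases i)
      note w = basis_words[OF *(1,2) *(4)[unfolded i]]
      show "case i of (ps, qs) \<Rightarrow> (even a \<longrightarrow>
              eigenvector (tau_plus \<Delta> \<tau> a) (if qs = [] then real a ^ length ps else 0)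
                (vec_right (ps, qs)) \<and>
              eigenvector (tau_minus \<Delta> \<tau> a) (if qs = [] then real a ^ length ps else 0)
                (vec_left (ps, qs))) \<and>
           (odd a \<longrightarrow>
              eigenvector (tau_plus \<Delta> \<tau> a) (real a ^ length ps) (vec_left (ps, qs)) \<and>
              eigenvector (tau_plus \<Delta> \<tau> a) (real a ^ length ps) (vec_right (ps, qs)) \<and>
              eigenvector (tau_minus \<Delta> \<tau> a) ((-1) ^ length qs * real a ^ length ps)
                (vec_rev_sum (ps, qs)) \<and>
              (prod_list (rev qs) = prod_list qs \<longrightarrow>
                 eigenvector (tau_minus \<Delta> \<tau> a) ((-1) ^ length qs * real a ^ length ps)
                   (vec_sum (ps, qs))))"
        unfolding i prod.case eigenvector_def
        by (intro conjI impI; (rule nonzero[OF w] eigen[OF w(1,2) *(3)]; assumption?))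
    qed
  qed
qed

end
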